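(* Fix integers $p\ge0$ and $K\ge0$. Consider the one-step method for the initial value problem that, on each subinterval $I_n$ ($n=0,\dots,N-1$), starting from $u_0$ given and the current value $u_n$, performs $K$ iterations of the explicit SDG scheme (from the explicit-Euler initial iterate) or of the implicit SDG scheme (from the implicit-Euler initial iterate), and sets $u_{n+1}=u^K_{n,p}$. Then the method is accurate of order $\min\{2p+1,K+1\}$, i.e. $\max_{0\le n\le N}|u(t_n)-u_n|=\mathcal{O}\left(h^{\min\{2p+1,K+1\}}\right)$ as $h\to0$.
   Context: Initial value problem: $u'(t)=f(t,u(t))$ for $t\in[0,T]$, $u(0)=u_0\in\mathbb{R}$, with $f:\mathbb{R}\times\mathbb{R}\to\mathbb{R}$ sufficiently smooth (of class $\mathcal{C}^{2p+1}$) and Lipschitz in $u$; $u$ denotes the exact solution. Partition $0=t_0<t_1<\dots<t_N=T$, $I_n=[t_n,t_{n+1}]$, $\Delta t_n=t_{n+1}-t_n$, $h=\max_n\Delta t_n$. On the reference interval $[-1,1]$ let $-1<\tau_0<\tau_1<\dots<\tau_p=1$ be the $p+1$ right Gauss–Radau points (including the right endpoint; the quadrature $\int_{-1}^1 g\approx\sum_j\omega_j g(\tau_j)$ with the corresponding weights $\omega_j$ is exact for polynomials of degree $\le 2p$), and $\ell_0,\dots,\ell_p$ the Lagrange polynomials of degree $p$ with $\ell_i(\tau_j)=\delta_{ij}$. Nodes on $I_n$: $t_{n,m}=t_n+\frac{(\tau_m+1)\Delta t_n}{2}$, so $t_{n,p}=t_{n+1}$. Define the $(p+1)\times(p+1)$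 matrix $L_{i,j}=\int_{-1}^1\ell_i'(\tau)\ell_j(\tau)\,d\tau-\delta_{ip}\delta_{jp}$ (invertible), with inverse $L^{-1}=(l^{-1}_{i,j})$. Define the matrix $\tilde L=(\tilde l_{i,j})_{0\le i,j\le p}$ by $\tilde l_{0,j}=-l^{-1}_{0,j}$ and $\tilde l_{m+1,j}=l^{-1}_{m,j}-l^{-1}_{m+1,j}$ for $0\le m\le p-1$. Write $f^k_{n,j}=f(t_{n,j},u^k_{n,j})$. Explicit SDG scheme: for $k\ge0$, $u^{k+1}_{n,0}=u_n+\frac{\Delta t_n}{2}\sum_{j=0}^p\tilde l_{0,j}\omega_j f^k_{n,j}$, and for $0\le m\le p-1$: $u^{k+1}_{n,m+1}=u^{k+1}_{n,m}+\frac{\Delta t_n}{2}\omega_m\big(f^{k+1}_{n,m}-f^k_{n,m}\big)+\frac{\Delta t_n}{2}\sum_{j=0}^p\tilde l_{m+1,j}\omega_j f^k_{n,j}$. Implicit SDG scheme: for $k\ge0$ (each step solves a scalar equation, uniquely solvable for $h$ small), $u^{k+1}_{n,0}=u_n+\frac{\Delta t_n}{2}\omega_0\big(f^{k+1}_{n,0}-f^k_{n,0}\big)+\frac{\Delta t_n}{2}\sum_{j=0}^p\tilde l_{0,j}\omega_j f^k_{n,j}$, and for $0\le m\le p-1$: $u^{k+1}_{n,m+1}=u^{k+1}_{n,m}+\frac{\Delta t_n}{2}\omega_{m+1}\big(f^{k+1}_{n,m+1}-f^k_{n,m+1}\big)+\frac{\Delta t_n}{2}\sum_{j=0}^p\tilde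 l_{m+1,j}\omega_j f^k_{n,j}$. The explicit-Euler initial iterate is $u^0_{n,0}=u_n+(t_{n,0}-t_n)f(t_n,u_n)$, $u^0_{n,m+1}=u^0_{n,m}+(t_{n,m+1}-t_{n,m})f(t_{n,m},u^0_{n,m})$; the implicit-Euler initial iterate is $u^0_{n,0}=u_n+(t_{n,0}-t_n)f(t_{n,0},u^0_{n,0})$, $u^0_{n,m+1}=u^0_{n,m}+(t_{n,m+1}-t_{n,m})f(t_{n,m+1},u^0_{n,m+1})$. All $\mathcal{O}(\cdot)$ constants are independent of $n$ and $h$. *)

theory Defs
  imports "HOL-Analysis.Analysis" "HOL-Computational_Algebra.Polynomial"
begin

definition Ck_R2 :: "nat \<Rightarrow> (real \<Rightarrow> real \<Rightarrow> real) \<Rightarrow> bool" where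
  "Ck_R2 k g \<longleftrightarrow> (\<exists>D :: nat \<Rightarrow> nat \<Rightarrow> real \<Rightarrow> real \<Rightarrow> real.
     D 0 0 = g \<and>
     (\<forall>i j. i + j \<le> k \<longrightarrow> continuous_on UNIV (\<lambda>z. D i j (fst z) (snd z))) \<and>
     (\<forall>i j t x. i + j < k \<longrightarrow>
        ((\<lambda>s. D i j s x) has_real_derivative D (Suc i) j t x) (at t) \<and>
        ((\<lambda>y. D i j t y) has_real_derivative D i (Suc j) t x) (at x)))"

definition right_radau :: "nat \<Rightarrow> (nat \<Rightarrow> real) \<Rightarrow> (nat \<Rightarrow> real) \<Rightarrow> bool" where
  "right_radau p \<tau> \<omega> \<longleftrightarrow>
     -1 < \<tau> 0 \<and> (\<forall>m<p. \<tau> m < \<tau> (Suc m)) \<and> \<tau> p = 1 \<and>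
     (\<forall>g :: real poly. degree g \<le> 2 * p \<longrightarrow>
        integral {-1..1} (poly g) = (\<Sum>j\<le>p. \<omega> j * poly g (\<tau> j)))"

definition lagrange :: "nat \<Rightarrow> (nat \<Rightarrow> real) \<Rightarrow> nat \<Rightarrow> real poly" where
  "lagrange p \<tau> i = (\<Prod>j\<in>{0..p} - {i}. smult (1 / (\<tau> i - \<tau> j)) [:- \<tau> j, 1:])"

definition Lmat :: "nat \<Rightarrow> (nat \<Rightarrow> real) \<Rightarrow> nat \<Rightarrow> nat \<Rightarrow> real" where
  "Lmat p \<tau> i j =
     integral {-1..1} (\<lambda>x. poly (pderiv (lagrange p \<tau> i)) x * poly (lagrange p \<tau> j) x)
     - (if i = p \<and> j = p then 1 else 0)"

definition Linv :: "nat \<Rightarrow> (nat \<Rightarrow> real) \<Rightarrow> nat \<Rightarrow> nat \<Rightarrow> real" where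
  "Linv p \<tau> = (SOME M. \<forall>i\<le>p. \<forall>j\<le>p.
      (\<Sum>k\<le>p. Lmat p \<tau> i k * M k j) = (if i = j then 1 else 0) \<and>
      (\<Sum>k\<le>p. M i k * Lmat p \<tau> k j) = (if i = j then 1 else 0))"

fun Ltil :: "nat \<Rightarrow> (nat \<Rightarrow> real) \<Rightarrow> nat \<Rightarrow> nat \<Rightarrow> real" where
  "Ltil p \<tau> 0 j = - Linv p \<tau> 0 j"
| "Ltil p \<tau> (Suc m) j = Linv p \<tau> m j - Linv p \<tau> (Suc m) j"

definition node :: "(nat \<Rightarrow> real) \<Rightarrow> real \<Rightarrow> real \<Rightarrow> nat \<Rightarrow> real" where
  "node \<tau> tn dt m = tn + (\<tau> m + 1) * dt / 2"

fun euler_expl :: "(real \<Rightarrow> real \<Rightarrow> real) \<Rightarrow> (nat \<Rightarrow> real) \<Rightarrow> real \<Rightarrow> real \<Rightarrow> real \<Rightarrow> nat \<Rightarrow> real" where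
  "euler_expl f \<tau> tn dt un 0 = un + (node \<tau> tn dt 0 - tn) * f tn un"
| "euler_expl f \<tau> tn dt un (Suc m) =
     euler_expl f \<tau> tn dt un m
     + (node \<tau> tn dt (Suc m) - node \<tau> tn dt m) * f (node \<tau> tn dt m) (euler_expl f \<tau> tn dt un m)"

fun euler_impl :: "(real \<Rightarrow> real \<Rightarrow> real) \<Rightarrow> (nat \<Rightarrow> real) \<Rightarrow> real \<Rightarrow> real \<Rightarrow> real \<Rightarrow> nat \<Rightarrow> real" where
  "euler_impl f \<tau> tn dt un 0 =
     (THE x. x = un + (node \<tau> tn dt 0 - tn) * f (node \<tau> tn dt 0) x)"
| "euler_impl f \<tau> tn dt un (Suc m) =
     (THE x. x = euler_impl f \<tau> tn dt un m
        + (node \<tau> tn dt (Suc m) - node \<tau> tn dt m) * f (node \<tau> tn dt (Suc m)) x)"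

definition sdg_corr :: "(real \<Rightarrow> real \<Rightarrow> real) \<Rightarrow> nat \<Rightarrow> (nat \<Rightarrow> real) \<Rightarrow> (nat \<Rightarrow> real)
    \<Rightarrow> real \<Rightarrow> real \<Rightarrow> (nat \<Rightarrow> real) \<Rightarrow> nat \<Rightarrow> real" where
  "sdg_corr f p \<tau> \<omega> tn dt uk m =
     dt / 2 * (\<Sum>j\<le>p. Ltil p \<tau> m j * \<omega> j * f (node \<tau> tn dt j) (uk j))"

fun sweep_expl :: "(real \<Rightarrow> real \<Rightarrow> real) \<Rightarrow> nat \<Rightarrow> (nat \<Rightarrow> real) \<Rightarrow> (nat \<Rightarrow> real)
    \<Rightarrow> real \<Rightarrow> real \<Rightarrow> real \<Rightarrow> (nat \<Rightarrow> real) \<Rightarrow> nat \<Rightarrow> real" where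
  "sweep_expl f p \<tau> \<omega> tn dt un uk 0 = un + sdg_corr f p \<tau> \<omega> tn dt uk 0"
| "sweep_expl f p \<tau> \<omega> tn dt un uk (Suc m) =
     sweep_expl f p \<tau> \<omega> tn dt un uk m
     + dt / 2 * \<omega> m * (f (node \<tau> tn dt m) (sweep_expl f p \<tau> \<omega> tn dt un uk m)
                       - f (node \<tau> tn dt m) (uk m))
     + sdg_corr f p \<tau> \<omega> tn dt uk (Suc m)"

fun sweep_impl :: "(real \<Rightarrow> real \<Rightarrow> real) \<Rightarrow> nat \<Rightarrow> (nat \<Rightarrow> real) \<Rightarrow> (nat \<Rightarrow> real)
    \<Rightarrow> real \<Rightarrow> real \<Rightarrow> real \<Rightarrow> (nat \<Rightarrow> real) \<Rightarrow> nat \<Rightarrow> real" where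
  "sweep_impl f p \<tau> \<omega> tn dt un uk 0 =
     (THE x. x = un + dt / 2 * \<omega> 0 * (f (node \<tau> tn dt 0) x - f (node \<tau> tn dt 0) (uk 0))
                 + sdg_corr f p \<tau> \<omega> tn dt uk 0)"
| "sweep_impl f p \<tau> \<omega> tn dt un uk (Suc m) =
     (THE x. x = sweep_impl f p \<tau> \<omega> tn dt un uk m
                 + dt / 2 * \<omega> (Suc m) * (f (node \<tau> tn dt (Suc m)) x
                                         - f (node \<tau> tn dt (Suc m)) (uk (Suc m)))
                 + sdg_corr f p \<tau> \<omega> tn dt uk (Suc m))"

primrec iter_expl :: "(real \<Rightarrow> real \<Rightarrow> real) \<Rightarrow> nat \<Rightarrow> (nat \<Rightarrow> real) \<Rightarrow> (nat \<Rightarrow> real)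
    \<Rightarrow> real \<Rightarrow> real \<Rightarrow> real \<Rightarrow> nat \<Rightarrow> nat \<Rightarrow> real" where
  "iter_expl f p \<tau> \<omega> tn dt un 0 = euler_expl f \<tau> tn dt un"
| "iter_expl f p \<tau> \<omega> tn dt un (Suc k) =
     sweep_expl f p \<tau> \<omega> tn dt un (iter_expl f p \<tau> \<omega> tn dt un k)"

primrec iter_impl :: "(real \<Rightarrow> real \<Rightarrow> real) \<Rightarrow> nat \<Rightarrow> (nat \<Rightarrow> real) \<Rightarrow> (nat \<Rightarrow> real)
    \<Rightarrow> real \<Rightarrow> real \<Rightarrow> real \<Rightarrow> nat \<Rightarrow> nat \<Rightarrow> real" where
  "iter_impl f p \<tau> \<omega> tn dt un 0 = euler_impl f \<tau> tn dt un"
| "iter_impl f p \<tau> \<omega> tn dt un (Suc k) =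
     sweep_impl f p \<tau> \<omega> tn dt un (iter_impl f p \<tau> \<omega> tn dt un k)"

definition step_expl :: "(real \<Rightarrow> real \<Rightarrow> real) \<Rightarrow> nat \<Rightarrow> (nat \<Rightarrow> real) \<Rightarrow> (nat \<Rightarrow> real)
    \<Rightarrow> nat \<Rightarrow> real \<Rightarrow> real \<Rightarrow> real \<Rightarrow> real" where
  "step_expl f p \<tau> \<omega> K tn dt un = iter_expl f p \<tau> \<omega> tn dt un K p"

definition step_impl :: "(real \<Rightarrow> real \<Rightarrow> real) \<Rightarrow> nat \<Rightarrow> (nat \<Rightarrow> real) \<Rightarrow> (nat \<Rightarrow> real)
    \<Rightarrow> nat \<Rightarrow> real \<Rightarrow> real \<Rightarrow> real \<Rightarrow> real" where
  "step_impl f p \<tau> \<omega> K tn dt un = iter_impl f p \<tau> \<omega> tn dt un K p"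

primrec onestep_sol :: "(real \<Rightarrow> real \<Rightarrow> real \<Rightarrow> real) \<Rightarrow> (nat \<Rightarrow> real) \<Rightarrow> real \<Rightarrow> nat \<Rightarrow> real" where
  "onestep_sol step t u0 0 = u0"
| "onestep_sol step t u0 (Suc n) = step (t n) (t (Suc n) - t n) (onestep_sol step t u0 n)"

definition time_partition :: "real \<Rightarrow> nat \<Rightarrow> (nat \<Rightarrow> real) \<Rightarrow> bool" where
  "time_partition T N t \<longleftrightarrow> t 0 = 0 \<and> t N = T \<and> (\<forall>n<N. t n < t (Suc n))"

definition mesh :: "nat \<Rightarrow> (nat \<Rightarrow> real) \<Rightarrow> real" where
  "mesh N t = Max ((\<lambda>n. t (Suc n) - t n) ` {..<N})"

end

theory Submission
  imports Defs
begin

text \<open>Since the quadrature is exact up to degree \<open>2 p\<close>, the discontinuous Galerkin matrix acts on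
  nodal values as weighted differentiation, so the fixed point of the sweeps is the Radau IIA
  collocation scheme. The Euler iterate has collocation residual \<open>O(h\<^sup>2)\<close> and each sweep multiplies
  the residual by \<open>O(h)\<close>. If \<open>U\<close> has residual \<open>r\<close>, its nodal errors are \<open>O(h\<^bsup>p+2\<^esup> + r)\<close>. At the
  right endpoint the error improves to \<open>O(h\<^bsup>2p+2\<^esup> + r)\<close>: with \<open>V\<close> the collocation polynomial of
  \<open>U\<close> and \<open>\<pi>\<close> a polynomial of degree \<open>p - 1\<close> such that \<open>\<pi>' + f\<^sub>u(t, u) \<pi> = O(h\<^bsup>p-1\<^esup>)\<close>, apply the
  quadrature to \<open>(\<pi> (V - u))'\<close>, which is small at the nodes. Hence the local error along \<open>u\<close> is
  \<open>O(h\<^bsup>min(2p+1, K+1)+1\<^esup>)\<close>, and since a step is Lipschitz with constant \<open>1 + O(h)\<close> the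
  global error follows by the discrete Gronwall argument.\<close>

section \<open>Radau quadrature and collocation\<close>

text \<open>The collocation solution is never constructed: the argument works with the residual of
  arbitrary nodal values in the collocation equations. Derivatives of \<open>f\<close> may be
  unbounded on the plane. Hence consistency is measured only for steps that start on the exact
  solution, where all relevant arguments stay in a compact set, while stability rests on the global
  Lipschitz constant. The degree p - 1 of \<pi> balances exactly: the quadrature sum carries a
  factor h, the adjoint defect a factor h^(p-1), the nodal errors are of order h^(p+2), in total
  h^(2p+2). For p = 0 there is no such \<pi>, but then p + 2 and 2p + 2 coincide. Two ingredients of
  the schemes are given only by description operators, the inverse matrix by \<open>SOME\<close> and
  the implicit values by \<open>THE\<close>. Their defining equations become available through an
  explicit two-sided inverse and through a contraction argument.\<close>

lemma exists_antiderivative_poly: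
  fixes q :: "real poly"
  shows "\<exists>Q. pderiv Q = q \<and> poly Q c = 0 \<and> degree Q \<le> Suc (degree q)"
proof -
  define R where "R = (\<Sum>i\<le>degree q. monom (coeff q i / real (Suc i)) (Suc i))"
  have cR: "coeff R (Suc n) = coeff q n / real (Suc n)" for n
  proof -
    have "coeff R (Suc n) = (\<Sum>i\<le>degree q. if i = n then coeff q i / real (Suc i) else 0)"
      by (auto simp: R_def coeff_sum intro!: sum.cong)
    also have "\<dots> = coeff q n / real (Suc n)"
      by (simp add: coeff_eq_0 del: of_nat_Suc)
    finally show ?thesis .
  qed
  have "pderiv R = q"
    by (rule poly_eqI) (simp add: coeff_pderiv cR)
  moreover have "degree R \<le> Suc (degree q)"
    unfolding R_def by (rule degree_sum_le) (auto intro: order_trans[OF degree_monom_le])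
  ultimately have "pderiv (R - [:poly R c:]) = q \<and> poly (R - [:poly R c:]) c = 0 \<and>
      degree (R - [:poly R c:]) \<le> Suc (degree q)"
    by (auto simp: pderiv_diff pderiv_pCons intro!: degree_diff_le)
  then show ?thesis by blast
qed

lemma poly_eq_of_pderiv_eq:
  fixes P Q :: "real poly"
  assumes "pderiv P = pderiv Q" "poly P c = poly Q c"
  shows "P = Q"
proof -
  have "pderiv (P - Q) = 0" using assms(1) by (simp add: pderiv_diff)
  then have "degree (P - Q) = 0" by (simp add: pderiv_eq_0_iff)
  then obtain d where d: "P - Q = [:d:]" by (metis degree_0_id)
  have "poly (P - Q) c = 0" using assms(2) by simp
  with d have "P - Q = 0" by simp
  then show ?thesis by simp
qed

lemma pderiv_sum: "pderiv (\<Sum>i\<in>A. f i) = (\<Sum>i\<in>A. pderiv (f i))"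
  by (induction A rule: infinite_finite_induct) (auto simp: pderiv_add)

lemma integral_pderiv:
  fixes P :: "real poly"
  assumes "a \<le> b"
  shows "integral {a..b} (poly (pderiv P)) = poly P b - poly P a"
proof -
  have "(poly P has_vector_derivative poly (pderiv P) x) (at x within {a..b})" for x
    using poly_DERIV[of P x]
    by (metis has_real_derivative_iff_has_vector_derivative has_vector_derivative_at_within)
  then show ?thesis
    using fundamental_theorem_of_calculus[OF assms, of "poly P" "poly (pderiv P)"]
    by (auto intro: integral_unique)
qed

locale radau =
  fixes p :: nat and \<tau> \<omega> :: "nat \<Rightarrow> real"
  assumes right_radau: "right_radau p \<tau> \<omega>"
begin

lemma tau_mono: "i < j \<Longrightarrow> j \<le> p \<Longrightarrow> \<tau> i < \<tau> j"
proof (induction j)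
  case (Suc j)
  have "\<tau> j < \<tau> (Suc j)" using Suc.prems right_radau by (auto simp: right_radau_def)
  with Suc show ?case by (cases "i = j") auto
qed simp

lemma tau_p: "\<tau> p = 1"
  using right_radau by (simp add: right_radau_def)

lemma tau_bounds: "j \<le> p \<Longrightarrow> -1 < \<tau> j" "j \<le> p \<Longrightarrow> \<tau> j \<le> 1"
proof -
  assume j: "j \<le> p"
  have "-1 < \<tau> 0" using right_radau by (simp add: right_radau_def)
  then show "-1 < \<tau> j" using tau_mono[of 0 j] j by (cases "j = 0") auto
  show "\<tau> j \<le> 1" using tau_mono[of j p] j tau_p by (cases "j = p") auto
qed

lemma inj_on_tau: "inj_on \<tau> {..p}"
  using tau_mono by (auto intro!: linorder_inj_onI dest: less_imp_neq)

lemma tau_eq_iff: "i \<le> p \<Longrightarrow> j \<le> p \<Longrightarrow> \<tau> i = \<tau> j \<longleftrightarrow> i = j"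
  using inj_on_tau by (auto simp: inj_on_def)

lemma quadrature:
  assumes "degree g \<le> 2 * p"
  shows "integral {-1..1} (poly g) = (\<Sum>j\<le>p. \<omega> j * poly g (\<tau> j))"
  using right_radau assms by (simp add: right_radau_def)

lemma quadrature_pderiv:
  assumes "degree P \<le> 2 * p + 1"
  shows "poly P 1 - poly P (-1) = (\<Sum>j\<le>p. \<omega> j * poly (pderiv P) (\<tau> j))"
proof -
  have "degree (pderiv P) \<le> 2 * p" using assms by (simp add: degree_pderiv)
  then show ?thesis using quadrature[of "pderiv P"] integral_pderiv[of "-1" 1 P] by simp
qed

lemma poly_lagrange:
  assumes "i \<le> p" "j \<le> p"
  shows "poly (lagrange p \<tau> i) (\<tau> j) = (if i = j then 1 else 0)"
proof -
  have "poly (lagrange p \<tau> i) (\<tau> j) = (\<Prod>k\<in>{0..p} - {i}. (\<tau> j - \<tau> k) / (\<tau> i - \<tau> k))"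
    by (simp add: lagrange_def poly_prod diff_divide_distrib)
  also have "\<dots> = (if i = j then 1 else 0)"
  proof (cases "i = j")
    case True
    then show ?thesis using assms by (auto intro!: prod.neutral simp: tau_eq_iff)
  next
    case False
    then have "j \<in> {0..p} - {i}" using assms by auto
    then show ?thesis using False by (auto intro!: prod_zero)
  qed
  finally show ?thesis .
qed

lemma degree_lagrange:
  assumes "i \<le> p"
  shows "degree (lagrange p \<tau> i) \<le> p"
proof -
  have "degree (lagrange p \<tau> i) \<le>
      (\<Sum>j\<in>{0..p} - {i}. degree (smult (1 / (\<tau> i - \<tau> j)) [:- \<tau> j, 1:]))"
    unfolding lagrange_def by (rule degree_prod_sum_le[unfolded o_def]) simp
  also have "\<dots> \<le> (\<Sum>j\<in>{0..p} - {i}. 1)"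
    by (intro sum_mono order_trans[OF degree_smult_le]) simp
  also have "\<dots> = p" using assms by simp
  finally show ?thesis .
qed

lemma poly_eq_at_nodes:
  assumes "degree P \<le> p" "degree Q \<le> p" "\<And>j. j \<le> p \<Longrightarrow> poly P (\<tau> j) = poly Q (\<tau> j)"
  shows "P = Q"
proof (rule poly_eqI_degree[of "\<tau> ` {..p}"])
  have "card (\<tau> ` {..p}) = Suc p" using card_image[OF inj_on_tau] by simp
  then show "degree P < card (\<tau> ` {..p})" "degree Q < card (\<tau> ` {..p})" using assms by auto
qed (use assms in auto)

lemma lagrange_interpolation:
  assumes "degree P \<le> p"
  shows "P = (\<Sum>j\<le>p. smult (poly P (\<tau> j)) (lagrange p \<tau> j))"
proof (rule poly_eq_at_nodes)
  show "degree (\<Sum>j\<le>p. smult (poly P (\<tau> j)) (lagrange p \<tau> j)) \<le> p"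
    by (intro degree_sum_le) (auto intro: order_trans[OF degree_smult_le] degree_lagrange)
next
  fix j assume j: "j \<le> p"
  have "(\<Sum>i\<le>p. poly P (\<tau> i) * poly (lagrange p \<tau> i) (\<tau> j)) =
      (\<Sum>i\<le>p. if i = j then poly P (\<tau> i) else 0)"
    using j by (intro sum.cong) (auto simp: poly_lagrange)
  then show "poly P (\<tau> j) = poly (\<Sum>i\<le>p. smult (poly P (\<tau> i)) (lagrange p \<tau> i)) (\<tau> j)"
    using j by (simp add: poly_sum)
qed (rule assms)

text \<open>The square of a Lagrange polynomial has degree at most 2p, so it is still integrated
  exactly, and it vanishes at all nodes but one.\<close>

lemma weight_eq_integral:
  assumes "j \<le> p"
  shows "\<omega> j = integral {-1..1} (poly (lagrange p \<tau> j * lagrange p \<tau> j))"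
proof -
  let ?g = "lagrange p \<tau> j * lagrange p \<tau> j"
  have "degree ?g \<le> 2 * p"
    using degree_mult_le[of "lagrange p \<tau> j" "lagrange p \<tau> j"] degree_lagrange[OF assms] by linarith
  then have "integral {-1..1} (poly ?g) = (\<Sum>i\<le>p. \<omega> i * poly ?g (\<tau> i))"
    by (rule quadrature)
  also have "\<dots> = (\<Sum>i\<le>p. if i = j then \<omega> i else 0)"
    using assms by (intro sum.cong) (auto simp: poly_lagrange)
  finally show ?thesis using assms by simp
qed

text \<open>A vanishing weight would force the integral of a nonnegative continuous function to be
  zero, although this function equals 1 at the node. The weights are divided by when the Galerkin
  matrix is inverted.\<close>

lemma weight_nonzero:
  assumes "j \<le> p"
  shows "\<omega> j \<noteq> 0"
proof
  let ?g = "\<lambda>x. poly (lagrange p \<tau> j * lagrange p \<tau> j) x"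
  assume "\<omega> j = 0"
  then have "integral {-1..1} ?g = 0" using weight_eq_integral[OF assms] by metis
  moreover have "continuous_on {-1..1} ?g" by (intro continuous_intros)
  ultimately have "\<forall>x\<in>{-1..1}. ?g x = 0"
    using integral_eq_0_iff[of "-1" 1 ?g] by simp
  then have "?g (\<tau> j) = 0" using tau_bounds[OF assms] by auto
  then show False using assms by (simp add: poly_lagrange)
qed

section \<open>Collocation coefficients and the inverse of the discontinuous Galerkin matrix\<close>

definition antider :: "nat \<Rightarrow> real poly" where
  "antider j = (SOME Q. pderiv Q = lagrange p \<tau> j \<and> poly Q (-1) = 0 \<and>
     degree Q \<le> Suc (degree (lagrange p \<tau> j)))"

lemma antider:
  "pderiv (antider j) = lagrange p \<tau> j" "poly (antider j) (-1) = 0"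
  "j \<le> p \<Longrightarrow> degree (antider j) \<le> Suc p"
proof -
  have *: "pderiv (antider j) = lagrange p \<tau> j \<and> poly (antider j) (-1) = 0 \<and>
      degree (antider j) \<le> Suc (degree (lagrange p \<tau> j))"
    unfolding antider_def by (rule someI_ex) (rule exists_antiderivative_poly)
  then show "pderiv (antider j) = lagrange p \<tau> j" "poly (antider j) (-1) = 0" by auto
  show "degree (antider j) \<le> Suc p" if "j \<le> p" using * degree_lagrange[OF that] by simp
qed

text \<open>The derivative has degree at most p, so it equals its Lagrange interpolant; integrating
  from -1 gives the formula.\<close>

lemma poly_eq_antider_expansion:
  assumes "degree P \<le> Suc p"
  shows "poly P x = poly P (-1) + (\<Sum>j\<le>p. poly (antider j) x * poly (pderiv P) (\<tau> j))"
proof -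
  define Q where "Q = [:poly P (-1):] + (\<Sum>j\<le>p. smult (poly (pderiv P) (\<tau> j)) (antider j))"
  have "degree (pderiv P) \<le> p" using assms by (simp add: degree_pderiv)
  from lagrange_interpolation[OF this]
  have "pderiv P = pderiv Q"
    by (simp add: Q_def pderiv_add pderiv_sum pderiv_smult antider pderiv_pCons)
  moreover have "poly P (-1) = poly Q (-1)"
    by (simp add: Q_def poly_sum antider)
  ultimately have "P = Q" by (rule poly_eq_of_pderiv_eq)
  then have "poly P x = poly Q x" by simp
  then show ?thesis by (simp add: Q_def poly_sum mult.commute)
qed

text \<open>The discontinuous Galerkin matrix differentiates: applied to the nodal values of a
  polynomial of degree \<open>p + 1\<close> vanishing at \<open>-1\<close> it returns the negative weighted nodal
  derivatives. This identifies the scheme with Radau IIA collocation.\<close>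

lemma Lmat_apply:
  assumes V: "degree V \<le> Suc p" "poly V (-1) = 0" and i: "i \<le> p"
  shows "(\<Sum>j\<le>p. Lmat p \<tau> i j * poly V (\<tau> j)) = - \<omega> i * poly (pderiv V) (\<tau> i)"
proof -
  let ?l = "lagrange p \<tau>"
  \<comment> \<open>The integrand has degree at most 2p - 1 (or is zero), so the integral in the
    matrix entry is a quadrature sum, of which a single term survives.\<close>
  have L: "Lmat p \<tau> i j = \<omega> j * poly (pderiv (?l i)) (\<tau> j) - (if i = p \<and> j = p then 1 else 0)"
    if j: "j \<le> p" for j
  proof -
    have "degree (pderiv (?l i) * ?l j) \<le> 2 * p"
      using degree_mult_le[of "pderiv (?l i)" "?l j"] degree_pderiv[of "?l i"]
        degree_lagrange[OF i] degree_lagrange[OF j] by linarith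
    then have "integral {-1..1} (poly (pderiv (?l i) * ?l j)) =
        (\<Sum>k\<le>p. \<omega> k * poly (pderiv (?l i) * ?l j) (\<tau> k))"
      by (rule quadrature)
    also have "\<dots> = (\<Sum>k\<le>p. if k = j then \<omega> k * poly (pderiv (?l i)) (\<tau> k) else 0)"
      using j by (intro sum.cong) (auto simp: poly_lagrange)
    finally have *: "integral {-1..1} (poly (pderiv (?l i) * ?l j)) =
        \<omega> j * poly (pderiv (?l i)) (\<tau> j)"
      using j by simp
    have fe: "(\<lambda>x. poly (pderiv (?l i)) x * poly (?l j) x) = poly (pderiv (?l i) * ?l j)" by auto
    show ?thesis unfolding Lmat_def fe * ..
  qed
  have "(\<Sum>j\<le>p. Lmat p \<tau> i j * poly V (\<tau> j)) =
     (\<Sum>j\<le>p. \<omega> j * poly (pderiv (?l i) * V) (\<tau> j) - (if i = p \<and> j = p then poly V (\<tau> j) else 0))"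
    by (intro sum.cong) (auto simp: L algebra_simps)
  also have "\<dots> = (\<Sum>j\<le>p. \<omega> j * poly (pderiv (?l i) * V) (\<tau> j)) - (if i = p then poly V 1 else 0)"
    by (simp add: sum_subtractf tau_p)
  finally have 1: "(\<Sum>j\<le>p. Lmat p \<tau> i j * poly V (\<tau> j)) =
    (\<Sum>j\<le>p. \<omega> j * poly (pderiv (?l i) * V) (\<tau> j)) - (if i = p then poly V 1 else 0)" .
  \<comment> \<open>Discrete integration by parts: the quadrature is exact for the derivative of
    this product. The boundary term at -1 vanishes with \<open>V\<close>, and the one at 1 cancels
    the entry subtracted in \<open>Lmat\<close>.\<close>
  have "degree (?l i * V) \<le> 2 * p + 1"
    using degree_mult_le[of "?l i" V] degree_lagrange[OF i] V by linarith
  from quadrature_pderiv[OF this]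
  have "poly (?l i) 1 * poly V 1 =
     (\<Sum>j\<le>p. \<omega> j * poly (?l i * pderiv V) (\<tau> j)) + (\<Sum>j\<le>p. \<omega> j * poly (pderiv (?l i) * V) (\<tau> j))"
    using V by (simp add: pderiv_mult algebra_simps sum.distrib)
  moreover have "poly (?l i) 1 = (if i = p then 1 else 0)"
    using poly_lagrange[OF i, of p] tau_p by simp
  moreover have "(\<Sum>j\<le>p. \<omega> j * poly (?l i * pderiv V) (\<tau> j)) = \<omega> i * poly (pderiv V) (\<tau> i)"
  proof -
    have "(\<Sum>j\<le>p. \<omega> j * poly (?l i * pderiv V) (\<tau> j)) =
      (\<Sum>j\<le>p. if j = i then \<omega> j * poly (pderiv V) (\<tau> j) else 0)"
      using i by (intro sum.cong) (auto simp: poly_lagrange)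
    then show ?thesis using i by simp
  qed
  ultimately show ?thesis using 1 by (auto split: if_splits)
qed

text \<open>\<open>Linv\<close> is picked by choice, so its entries are known only once an inverse
  is exhibited and shown to be the only one. By \<open>Lmat_apply\<close> the nodal values of
  \<open>antider j\<close> are mapped to minus \<omega>_j times the j-th unit vector, which dictates
  the columns of the candidate \<open>M\<close>.\<close>

lemma Linv_eq:
  assumes "i \<le> p" "j \<le> p"
  shows "- Linv p \<tau> i j * \<omega> j = poly (antider j) (\<tau> i)"
proof -
  let ?l = "lagrange p \<tau>"
  define M where "M i k = - poly (antider k) (\<tau> i) / \<omega> k" for i k
  define inverse_of where "inverse_of M \<longleftrightarrow> (\<forall>i\<le>p. \<forall>j\<le>p.
      (\<Sum>k\<le>p. Lmat p \<tau> i k * M k j) = (if i = j then 1 else 0) \<and>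
      (\<Sum>k\<le>p. M i k * Lmat p \<tau> k j) = (if i = j then 1 else (0::real)))" for M
  have LM: "(\<Sum>k\<le>p. Lmat p \<tau> i k * M k j) = (if i = j then 1 else 0)" if "i \<le> p" "j \<le> p" for i j
  proof -
    have "(\<Sum>k\<le>p. Lmat p \<tau> i k * M k j) = - (\<Sum>k\<le>p. Lmat p \<tau> i k * poly (antider j) (\<tau> k)) / \<omega> j"
      by (simp add: M_def sum_divide_distrib sum_negf)
    then show ?thesis
      using Lmat_apply[of "antider j" i] that by (auto simp: antider poly_lagrange weight_nonzero)
  qed
  have left: "(\<Sum>k\<le>p. M i k * Lmat p \<tau> k j) = (if i = j then 1 else 0)" if i: "i \<le> p" and j: "j \<le> p" for i j
  proof -
    \<comment> \<open>The polynomial of degree p + 1 with value 0 at -1 and the j-th unit vector as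
      nodal values. Applying the matrix to it reads off column j, and the expansion in
      \<open>antider\<close> then recovers its nodal values.\<close>
    define V where "V = smult (1 / (\<tau> j + 1)) ([:1, 1:] * ?l j)"
    have dV: "degree V \<le> Suc p"
      using degree_mult_le[of "[:1, 1:]" "?l j"] degree_lagrange[OF j]
        degree_smult_le[of "1 / (\<tau> j + 1)" "[:1, 1:] * ?l j"] by (simp add: V_def)
    have V0: "poly V (-1) = 0" by (simp add: V_def)
    have Vn: "poly V (\<tau> i) = (if i = j then 1 else 0)" if "i \<le> p" for i
      using that j tau_bounds[of j] by (auto simp: V_def poly_lagrange field_simps)
    have L: "Lmat p \<tau> k j = - \<omega> k * poly (pderiv V) (\<tau> k)" if k: "k \<le> p" for k
    proof -
      have "(\<Sum>i\<le>p. Lmat p \<tau> k i * poly V (\<tau> i)) = (\<Sum>i\<le>p. if i = j then Lmat p \<tau> k i else 0)"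
        by (intro sum.cong) (auto simp: Vn)
      then show ?thesis using Lmat_apply[OF dV V0 k] j by simp
    qed
    have "(\<Sum>k\<le>p. M i k * Lmat p \<tau> k j) = (\<Sum>k\<le>p. poly (antider k) (\<tau> i) * poly (pderiv V) (\<tau> k))"
      by (intro sum.cong) (auto simp: M_def L weight_nonzero)
    also have "\<dots> = poly V (\<tau> i)" using poly_eq_antider_expansion[OF dV] V0 by simp
    finally show ?thesis using Vn i by simp
  qed
  have "inverse_of M" using LM left by (auto simp: inverse_of_def)
  moreover have "Linv p \<tau> = (SOME M. inverse_of M)"
    by (simp add: Linv_def inverse_of_def)
  ultimately have inv: "inverse_of (Linv p \<tau>)" by (metis someI)
  \<comment> \<open>The usual uniqueness argument: the left inverse \<open>Linv\<close> is
    multiplied by the product of the matrix with its right inverse \<open>M\<close>, and the sums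
    are regrouped.\<close>
  have "Linv p \<tau> i j = (\<Sum>k\<le>p. Linv p \<tau> i k * (\<Sum>l\<le>p. Lmat p \<tau> k l * M l j))"
  proof -
    have "(\<Sum>k\<le>p. Linv p \<tau> i k * (\<Sum>l\<le>p. Lmat p \<tau> k l * M l j)) =
        (\<Sum>k\<le>p. if k = j then Linv p \<tau> i k else 0)"
      using assms by (intro sum.cong) (auto simp: LM)
    then show ?thesis using assms by simp
  qed
  also have "\<dots> = (\<Sum>l\<le>p. (\<Sum>k\<le>p. Linv p \<tau> i k * Lmat p \<tau> k l) * M l j)"
    unfolding sum_distrib_left sum_distrib_right mult.assoc by (rule sum.swap)
  also have "\<dots> = (\<Sum>l\<le>p. if l = i then M l j else 0)"
    using inv assms by (intro sum.cong) (auto simp: inverse_of_def)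
  also have "\<dots> = M i j" using assms by simp
  finally show ?thesis using weight_nonzero assms by (simp add: M_def)
qed

text \<open>The integral of the j-th Lagrange polynomial from -1 to the m-th node. This is twice the
  Radau IIA Butcher matrix of the unit interval, hence the half step \<open>d\<close> in front of it
  later on.\<close>

definition colloc :: "nat \<Rightarrow> nat \<Rightarrow> real" where
  "colloc m j = poly (antider j) (\<tau> m)"

text \<open>The rows of \<open>Ltil\<close> are successive differences of the rows of
  -\<open>Linv\<close>, so the sum telescopes. Node-to-node increments thereby add up to the
  collocation formula from the left end point.\<close>

lemma sum_Ltil:
  assumes "m \<le> p" "j \<le> p"
  shows "(\<Sum>i\<le>m. Ltil p \<tau> i j * \<omega> j) = colloc m j"
proof -
  have "(\<Sum>i\<le>m. Ltil p \<tau> i j) = - Linv p \<tau> m j" by (induction m) auto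
  then show ?thesis
    using Linv_eq[OF assms] by (simp add: colloc_def flip: sum_distrib_right)
qed

lemma colloc_exact:
  assumes "degree P \<le> Suc p"
  shows "poly P (\<tau> m) = poly P (-1) + (\<Sum>j\<le>p. colloc m j * poly (pderiv P) (\<tau> j))"
  unfolding colloc_def by (rule poly_eq_antider_expansion[OF assms])

text \<open>Exactness for the identity polynomial. The same row sums hold for the Euler
  coefficients, which makes the Euler residual quadratic in the step.\<close>

lemma sum_colloc: "(\<Sum>j\<le>p. colloc m j) = \<tau> m + 1"
  using colloc_exact[of "[:0, 1:]" m] by (simp add: pderiv_pCons)

end

section \<open>Polynomial estimates\<close>

lemma poly_bound_high_order:
  fixes R :: "real poly"
  assumes "degree R \<le> n" "\<And>i. \<bar>coeff R i\<bar> \<le> B" "\<And>i. i < q \<Longrightarrow> coeff R i = 0" "0 \<le> x" "x \<le> 1"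
  shows "\<bar>poly R x\<bar> \<le> real (Suc n) * B * x ^ q"
proof -
  have B: "0 \<le> B" using assms(2)[of 0] by linarith
  have "poly R x = (\<Sum>i\<le>n. coeff R i * x ^ i)"
    unfolding poly_altdef using assms(1)
    by (intro sum.mono_neutral_left) (auto simp: coeff_eq_0)
  also have "\<bar>\<dots>\<bar> \<le> (\<Sum>i\<le>n. \<bar>coeff R i * x ^ i\<bar>)" by (rule sum_abs)
  also have "\<dots> \<le> (\<Sum>i\<le>n. B * x ^ q)"
  proof (rule sum_mono)
    fix i
    show "\<bar>coeff R i * x ^ i\<bar> \<le> B * x ^ q"
    proof (cases "i < q")
      case True
      then show ?thesis using assms B by simp
    next
      case False
      then have "x ^ i \<le> x ^ q" using assms by (intro power_decreasing) auto
      then show ?thesis using assms B by (auto simp: abs_mult intro!: mult_mono)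
    qed
  qed
  also have "\<dots> = real (Suc n) * B * x ^ q" by simp
  finally show ?thesis .
qed

lemma abs_coeff_mult_le:
  fixes P Q :: "real poly"
  assumes "\<And>i. \<bar>coeff P i\<bar> \<le> B" "\<And>i. \<bar>coeff Q i\<bar> \<le> C" "degree (P * Q) \<le> n"
  shows "\<bar>coeff (P * Q) i\<bar> \<le> real (Suc n) * (B * C)"
proof -
  have B: "0 \<le> B" "0 \<le> C" using assms(1)[of 0] assms(2)[of 0] by linarith+
  show ?thesis
  proof (cases "i \<le> n")
    case True
    have "\<bar>coeff (P * Q) i\<bar> \<le> (\<Sum>j\<le>i. \<bar>coeff P j * coeff Q (i - j)\<bar>)"
      unfolding coeff_mult by (rule sum_abs)
    also have "\<dots> \<le> (\<Sum>j\<le>i. B * C)"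
      using assms B by (intro sum_mono) (auto simp: abs_mult intro!: mult_mono)
    also have "\<dots> = real (Suc i) * (B * C)" by simp
    also have "\<dots> \<le> real (Suc n) * (B * C)" using B True by (intro mult_right_mono) auto
    finally show ?thesis .
  next
    case False
    then have "coeff (P * Q) i = 0" using assms(3) by (intro coeff_eq_0) simp
    then show ?thesis using B by simp
  qed
qed

lemma abs_coeff_pderiv_le:
  fixes R :: "real poly"
  assumes "\<And>i. \<bar>coeff R i\<bar> \<le> B" "degree R \<le> n"
  shows "\<bar>coeff (pderiv R) i\<bar> \<le> real n * B"
proof (cases "Suc i \<le> n")
  case True
  have "0 \<le> B" using assms(1)[of 0] by linarith
  then have "real (Suc i) * \<bar>coeff R (Suc i)\<bar> \<le> real n * B"
    using True assms by (intro mult_mono) auto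
  then show ?thesis by (simp add: coeff_pderiv abs_mult)
next
  case False
  then have "coeff R (Suc i) = 0" using assms(2) by (intro coeff_eq_0) simp
  moreover have "0 \<le> B" using assms(1)[of 0] by linarith
  ultimately show ?thesis by (simp add: coeff_pderiv)
qed

text \<open>Power series coefficients of the solution of \<pi>' + a \<pi> = 0 with \<pi>(0) = 1,
  where \<open>a\<close> is given by its own coefficient sequence.\<close>

fun adjoint_coeff :: "(nat \<Rightarrow> real) \<Rightarrow> nat \<Rightarrow> real" where
  "adjoint_coeff a 0 = 1"
| "adjoint_coeff a (Suc i) = - (\<Sum>j\<le>i. a j * adjoint_coeff a (i - j)) / real (Suc i)"

text \<open>The convolution has k + 1 terms, which the division by k + 1 compensates; each index
  therefore costs at most a factor 1 + M.\<close>

lemma abs_adjoint_coeff_le: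
  assumes "\<And>i. \<bar>a i\<bar> \<le> M"
  shows "\<bar>adjoint_coeff a i\<bar> \<le> (1 + M) ^ i"
proof (induction i rule: less_induct)
  case (less i)
  have M: "0 \<le> M" using assms[of 0] by linarith
  show ?case
  proof (cases i)
    case (Suc k)
    have "\<bar>\<Sum>j\<le>k. a j * adjoint_coeff a (k - j)\<bar> \<le> (\<Sum>j\<le>k. \<bar>a j * adjoint_coeff a (k - j)\<bar>)"
      by (rule sum_abs)
    also have "\<dots> \<le> (\<Sum>j\<le>k. M * (1 + M) ^ k)"
    proof (rule sum_mono)
      fix j assume "j \<in> {..k}"
      have "\<bar>adjoint_coeff a (k - j)\<bar> \<le> (1 + M) ^ (k - j)" using Suc by (intro less) auto
      also have "\<dots> \<le> (1 + M) ^ k" using M by (intro power_increasing) auto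
      finally show "\<bar>a j * adjoint_coeff a (k - j)\<bar> \<le> M * (1 + M) ^ k"
        using assms M by (auto simp: abs_mult intro!: mult_mono)
    qed
    also have "\<dots> = real (Suc k) * (M * (1 + M) ^ k)" by simp
    finally have "\<bar>adjoint_coeff a i\<bar> \<le> M * (1 + M) ^ k"
      using Suc by (simp add: abs_mult field_simps del: of_nat_Suc)
    also have "\<dots> \<le> (1 + M) ^ i" using Suc M by (auto intro!: mult_right_mono)
    finally show ?thesis .
  qed simp
qed

text \<open>The polynomial is the truncated power series. One constant serves all \<open>a\<close>
  with coefficients bounded by \<open>M\<close>; since \<open>a\<close> will be a Taylor polynomial
  at the current time, this gives uniformity in time.\<close>

lemma exists_adjoint_poly:
  fixes M :: real
  assumes "0 \<le> M"
  shows "\<exists>C\<ge>0. \<forall>a :: real poly. degree a \<le> q \<and> (\<forall>i. \<bar>coeff a i\<bar> \<le> M) \<longrightarrow>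
    (\<exists>\<pi>. degree \<pi> \<le> q \<and> poly \<pi> 0 = 1 \<and> (\<forall>i. \<bar>coeff \<pi> i\<bar> \<le> C) \<and>
      (\<forall>x\<in>{0..1}. \<bar>poly (pderiv \<pi> + a * \<pi>) x\<bar> \<le> C * x ^ q))"
proof -
  \<comment> \<open>\<open>B\<close> bounds the coefficients of the truncated series,
    \<open>D\<close> those of its adjoint defect, and \<open>C\<close> also covers the value of the
    defect.\<close>
  define B where "B = (1 + M) ^ q"
  define D where "D = real q * B + real (Suc (2 * q)) * (M * B)"
  define C where "C = max B (real (Suc (2 * q)) * D)"
  have B0: "0 \<le> B" using assms by (simp add: B_def)
  have "\<exists>\<pi>. degree \<pi> \<le> q \<and> poly \<pi> 0 = 1 \<and> (\<forall>i. \<bar>coeff \<pi> i\<bar> \<le> C) \<and>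
      (\<forall>x\<in>{0..1}. \<bar>poly (pderiv \<pi> + a * \<pi>) x\<bar> \<le> C * x ^ q)"
    if a: "degree a \<le> q" "\<And>i. \<bar>coeff a i\<bar> \<le> M" for a
  proof -
    define c where "c = adjoint_coeff (coeff a)"
    define P where "P = (\<Sum>i\<le>q. monom (c i) i)"
    have cP: "coeff P i = (if i \<le> q then c i else 0)" for i
      by (simp add: P_def coeff_sum if_distrib cong: if_cong)
    have dP: "degree P \<le> q" by (rule degree_le) (simp add: cP)
    have PB: "\<bar>coeff P i\<bar> \<le> B" for i
    proof (cases "i \<le> q")
      case True
      have "\<bar>c i\<bar> \<le> (1 + M) ^ i" unfolding c_def using a by (intro abs_adjoint_coeff_le) auto
      also have "\<dots> \<le> B" unfolding B_def using True assms by (intro power_increasing) auto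
      finally show ?thesis using True by (simp add: cP)
    qed (simp add: cP B0)
    let ?R = "pderiv P + a * P"
    have daP: "degree (a * P) \<le> 2 * q" using degree_mult_le[of a P] a dP by linarith
    have dR: "degree ?R \<le> 2 * q"
      using daP dP by (intro degree_add_le) (auto simp: degree_pderiv)
    have RD: "\<bar>coeff ?R i\<bar> \<le> D" for i
      using abs_coeff_mult_le[OF a(2) PB daP, of i] abs_coeff_pderiv_le[OF PB dP, of i]
      by (simp add: D_def)
    \<comment> \<open>For i < q the recursion involves only indices up to i + 1 \<le> q, where the
      truncation is not yet visible.\<close>
    have low: "coeff ?R i = 0" if "i < q" for i
    proof -
      have "coeff (a * P) i = (\<Sum>j\<le>i. coeff a j * c (i - j))"
        unfolding coeff_mult using that by (intro sum.cong) (auto simp: cP)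
      then show ?thesis using that by (simp add: coeff_pderiv cP) (simp add: c_def)
    qed
    have "\<bar>poly ?R x\<bar> \<le> C * x ^ q" if x: "x \<in> {0..1}" for x
    proof -
      have "\<bar>poly ?R x\<bar> \<le> real (Suc (2 * q)) * D * x ^ q"
        by (rule poly_bound_high_order[OF dR RD low]) (use x in auto)
      also have "\<dots> \<le> C * x ^ q" using x by (intro mult_right_mono) (auto simp: C_def)
      finally show ?thesis .
    qed
    moreover have "poly P 0 = 1" by (simp add: poly_0_coeff_0 cP c_def)
    moreover have "\<bar>coeff P i\<bar> \<le> C" for i using PB[of i] by (simp add: C_def)
    ultimately show ?thesis using dP by blast
  qed
  moreover have "0 \<le> C" using B0 by (simp add: C_def)
  ultimately show ?thesis by blast
qed

section \<open>Quadrature error on a short interval\<close>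

context radau
begin

lemma quadrature_pderiv_scaled:
  assumes "degree S \<le> 2 * p + 1"
  shows "poly S (2 * d) - poly S 0 = d * (\<Sum>j\<le>p. \<omega> j * poly (pderiv S) (d * (\<tau> j + 1)))"
proof -
  let ?r = "[:d, d:]"
  have "degree (pcompose S ?r) \<le> 2 * p + 1"
    using assms by (simp add: degree_pcompose)
  from quadrature_pderiv[OF this] show ?thesis
    by (simp add: pderiv_pcompose poly_pcompose pderiv_pCons sum_distrib_left algebra_simps)
qed

text \<open>Terms of \<open>S\<close> up to degree 2p + 1 are treated exactly, and the remaining
  terms start with the power 2p + 2. The constant depends on \<open>S\<close> only through the
  bounds on its degree and its coefficients.\<close>

lemma quadrature_pderiv_scaled_error:
  fixes B :: real
  shows "\<exists>C\<ge>0. \<forall>S d. degree S \<le> n \<and> (\<forall>i. \<bar>coeff S i\<bar> \<le> B) \<and> 0 \<le> d \<and> 2 * d \<le> 1 \<longrightarrow>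
    \<bar>poly S (2 * d) - poly S 0 - d * (\<Sum>j\<le>p. \<omega> j * poly (pderiv S) (d * (\<tau> j + 1)))\<bar>
      \<le> C * (2 * d) ^ (2 * p + 2)"
proof (cases "0 \<le> B")
  \<comment> \<open>No polynomial has coefficients with a negative bound, so any constant
    works.\<close>
  case False
  then have "\<not> (\<forall>i. \<bar>coeff S i\<bar> \<le> B)" for S :: "real poly" by (metis abs_ge_zero order_trans)
  then show ?thesis by (intro exI[of _ 0]) auto
next
  case B: True
  define A where "A = real (Suc n) * B"
  define A' where "A' = real (Suc n) * (real n * B)"
  define C where "C = A + (\<Sum>j\<le>p. \<bar>\<omega> j\<bar> * A')"
  have A: "0 \<le> A" "0 \<le> A'" using B by (auto simp: A_def A'_def)
  have "\<bar>poly S (2 * d) - poly S 0 - d * (\<Sum>j\<le>p. \<omega> j * poly (pderiv S) (d * (\<tau> j + 1)))\<bar>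
      \<le> C * (2 * d) ^ (2 * p + 2)"
    if S: "degree S \<le> n" "\<And>i. \<bar>coeff S i\<bar> \<le> B" and d: "0 \<le> d" "2 * d \<le> 1" for S d
  proof -
    define S1 where "S1 = poly_cutoff (2 * p + 2) S"
    define R where "R = S - S1"
    have cR: "coeff R i = (if i < 2 * p + 2 then 0 else coeff S i)" for i
      by (simp add: R_def S1_def coeff_poly_cutoff)
    have dS1: "degree S1 \<le> 2 * p + 1" by (rule degree_le) (simp add: S1_def coeff_poly_cutoff)
    have dR: "degree R \<le> n"
      by (rule degree_le) (use S(1) in \<open>simp add: cR coeff_eq_0\<close>)
    have RB: "\<bar>coeff R i\<bar> \<le> B" for i using S(2)[of i] B by (simp add: cR)
    have SR: "S = S1 + R" by (simp add: R_def)
    have R1: "\<bar>poly R (2 * d)\<bar> \<le> A * (2 * d) ^ (2 * p + 2)"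
      unfolding A_def by (rule poly_bound_high_order[OF dR RB]) (use d in \<open>auto simp: cR\<close>)
    have R0: "poly R 0 = 0" by (simp add: poly_0_coeff_0 cR)
    have dR': "degree (pderiv R) \<le> n" using dR by (simp add: degree_pderiv)
    have R': "\<bar>poly (pderiv R) (d * (\<tau> j + 1))\<bar> \<le> A' * (2 * d) ^ (2 * p + 1)" if j: "j \<le> p" for j
    proof -
      have x: "0 \<le> d * (\<tau> j + 1)" "d * (\<tau> j + 1) \<le> 2 * d"
        using tau_bounds[OF j] d mult_left_mono[of "\<tau> j + 1" 2 d] by auto
      have "\<bar>poly (pderiv R) (d * (\<tau> j + 1))\<bar> \<le> A' * (d * (\<tau> j + 1)) ^ (2 * p + 1)"
        unfolding A'_def
        by (rule poly_bound_high_order[OF dR' abs_coeff_pderiv_le[OF RB dR]])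
          (use x d in \<open>auto simp: coeff_pderiv cR\<close>)
      also have "\<dots> \<le> A' * (2 * d) ^ (2 * p + 1)"
        using x A by (intro mult_left_mono power_mono) auto
      finally show ?thesis .
    qed
    have "\<bar>\<Sum>j\<le>p. \<omega> j * poly (pderiv R) (d * (\<tau> j + 1))\<bar> \<le>
        (\<Sum>j\<le>p. \<bar>\<omega> j * poly (pderiv R) (d * (\<tau> j + 1))\<bar>)" by (rule sum_abs)
    also have "\<dots> \<le> (\<Sum>j\<le>p. \<bar>\<omega> j\<bar> * A' * (2 * d) ^ (2 * p + 1))"
      using R' by (intro sum_mono) (auto simp: abs_mult mult.assoc intro!: mult_left_mono)
    also have "\<dots> = (\<Sum>j\<le>p. \<bar>\<omega> j\<bar> * A') * (2 * d) ^ (2 * p + 1)"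
      by (simp add: sum_distrib_right)
    finally have "d * \<bar>\<Sum>j\<le>p. \<omega> j * poly (pderiv R) (d * (\<tau> j + 1))\<bar> \<le>
        (2 * d) * ((\<Sum>j\<le>p. \<bar>\<omega> j\<bar> * A') * (2 * d) ^ (2 * p + 1))"
      using d by (intro mult_mono) auto
    also have "\<dots> = (\<Sum>j\<le>p. \<bar>\<omega> j\<bar> * A') * (2 * d) ^ (2 * p + 2)" by (simp add: algebra_simps)
    finally have R2: "\<bar>d * (\<Sum>j\<le>p. \<omega> j * poly (pderiv R) (d * (\<tau> j + 1)))\<bar> \<le>
        (\<Sum>j\<le>p. \<bar>\<omega> j\<bar> * A') * (2 * d) ^ (2 * p + 2)"
      using d by (simp add: abs_mult)
    have "poly S (2 * d) - poly S 0 - d * (\<Sum>j\<le>p. \<omega> j * poly (pderiv S) (d * (\<tau> j + 1))) =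
        poly R (2 * d) - d * (\<Sum>j\<le>p. \<omega> j * poly (pderiv R) (d * (\<tau> j + 1)))"
      using quadrature_pderiv_scaled[OF dS1, of d]
      by (simp add: SR R0 pderiv_add distrib_left sum.distrib)
    then show ?thesis using R1 R2 unfolding C_def distrib_right by linarith
  qed
  moreover have "0 \<le> C" using A by (auto simp: C_def intro!: add_nonneg_nonneg sum_nonneg)
  ultimately show ?thesis by blast
qed

end

section \<open>Smoothness along the solution\<close>

text \<open>The recursion exposes one pair of partial derivatives at a time, so that closure under
  sums, products and differentiation along a solution are plain inductions without a Leibniz formula
  for mixed derivatives.\<close>

primrec smooth2 :: "nat \<Rightarrow> (real \<Rightarrow> real \<Rightarrow> real) \<Rightarrow> bool" where
  "smooth2 0 g \<longleftrightarrow> continuous_on UNIV (\<lambda>z. g (fst z) (snd z))"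
| "smooth2 (Suc k) g \<longleftrightarrow> continuous_on UNIV (\<lambda>z. g (fst z) (snd z)) \<and>
     (\<exists>g1 g2. (\<forall>t x. ((\<lambda>s. g s x) has_real_derivative g1 t x) (at t) \<and>
        ((\<lambda>y. g t y) has_real_derivative g2 t x) (at x)) \<and> smooth2 k g1 \<and> smooth2 k g2)"

lemma smooth2_continuous: "smooth2 k g \<Longrightarrow> continuous_on UNIV (\<lambda>z. g (fst z) (snd z))"
  by (cases k) auto

lemma smooth2_SucD: "smooth2 (Suc k) g \<Longrightarrow> smooth2 k g"
proof (induction k arbitrary: g)
  case (Suc k)
  from Suc.prems obtain g1 g2 where g:
    "\<forall>t x. ((\<lambda>s. g s x) has_real_derivative g1 t x) (at t) \<and>
        ((\<lambda>y. g t y) has_real_derivative g2 t x) (at x)"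
    "smooth2 (Suc k) g1" "smooth2 (Suc k) g2" "continuous_on UNIV (\<lambda>z. g (fst z) (snd z))"
    by (subst (asm) smooth2.simps(2)) blast
  then have "smooth2 k g1" "smooth2 k g2" using Suc.IH by blast+
  with g show ?case unfolding smooth2.simps by blast
qed auto

lemma smooth2_mono: "smooth2 k g \<Longrightarrow> j \<le> k \<Longrightarrow> smooth2 j g"
proof (induction k)
  case (Suc k)
  then show ?case using smooth2_SucD[OF Suc.prems(1)] by (cases "j = Suc k") auto
qed auto

lemma smooth2_add: "smooth2 k g \<Longrightarrow> smooth2 k h \<Longrightarrow> smooth2 k (\<lambda>t x. g t x + h t x)"
proof (induction k arbitrary: g h)
  case 0
  then show ?case by (auto intro: continuous_on_add)
next
  case (Suc k)
  from Suc.prems obtain g1 g2 where g: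
    "\<forall>t x. ((\<lambda>s. g s x) has_real_derivative g1 t x) (at t) \<and>
        ((\<lambda>y. g t y) has_real_derivative g2 t x) (at x)" "smooth2 k g1" "smooth2 k g2"
    by auto
  from Suc.prems obtain h1 h2 where h:
    "\<forall>t x. ((\<lambda>s. h s x) has_real_derivative h1 t x) (at t) \<and>
        ((\<lambda>y. h t y) has_real_derivative h2 t x) (at x)" "smooth2 k h1" "smooth2 k h2"
    by auto
  have "continuous_on UNIV (\<lambda>z. g (fst z) (snd z) + h (fst z) (snd z))"
    using Suc.prems by (auto intro: continuous_on_add)
  moreover have "smooth2 k (\<lambda>t x. g1 t x + h1 t x)" "smooth2 k (\<lambda>t x. g2 t x + h2 t x)"
    using g h Suc.IH by auto
  moreover have "\<forall>t x. ((\<lambda>s. g s x + h s x) has_real_derivative g1 t x + h1 t x) (at t) \<and>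
        ((\<lambda>y. g t y + h t y) has_real_derivative g2 t x + h2 t x) (at x)"
    using g h by (auto intro: DERIV_add)
  ultimately show ?case
    unfolding smooth2.simps
    by (intro conjI exI[of _ "\<lambda>t x. g1 t x + h1 t x"] exI[of _ "\<lambda>t x. g2 t x + h2 t x"]) auto
qed

lemma smooth2_mult: "smooth2 k g \<Longrightarrow> smooth2 k h \<Longrightarrow> smooth2 k (\<lambda>t x. g t x * h t x)"
proof (induction k arbitrary: g h)
  case 0
  then show ?case by (auto intro: continuous_on_mult)
next
  case (Suc k)
  from Suc.prems obtain g1 g2 where g:
    "\<forall>t x. ((\<lambda>s. g s x) has_real_derivative g1 t x) (at t) \<and>
        ((\<lambda>y. g t y) has_real_derivative g2 t x) (at x)" "smooth2 k g1" "smooth2 k g2"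
    by auto
  from Suc.prems obtain h1 h2 where h:
    "\<forall>t x. ((\<lambda>s. h s x) has_real_derivative h1 t x) (at t) \<and>
        ((\<lambda>y. h t y) has_real_derivative h2 t x) (at x)" "smooth2 k h1" "smooth2 k h2"
    by auto
  have gk: "smooth2 k g" "smooth2 k h" using Suc.prems smooth2_SucD by blast+
  have "continuous_on UNIV (\<lambda>z. g (fst z) (snd z) * h (fst z) (snd z))"
    using Suc.prems by (auto intro: continuous_on_mult)
  moreover have "smooth2 k (\<lambda>t x. g1 t x * h t x + h1 t x * g t x)"
    "smooth2 k (\<lambda>t x. g2 t x * h t x + h2 t x * g t x)"
    using g h gk Suc.IH by (auto intro!: smooth2_add)
  moreover have "\<forall>t x. ((\<lambda>s. g s x * h s x) has_real_derivative g1 t x * h t x + h1 t x * g t x) (at t) \<and>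
        ((\<lambda>y. g t y * h t y) has_real_derivative g2 t x * h t x + h2 t x * g t x) (at x)"
    using g h by (auto intro: DERIV_mult)
  ultimately show ?case
    unfolding smooth2.simps
    by (intro conjI exI[of _ "\<lambda>t x. g1 t x * h t x + h1 t x * g t x"]
        exI[of _ "\<lambda>t x. g2 t x * h t x + h2 t x * g t x"]) auto
qed

lemma Ck_R2_imp_smooth2:
  assumes "Ck_R2 k g"
  shows "smooth2 k g"
proof -
  from assms obtain D where D: "D 0 0 = g"
    "\<And>i j. i + j \<le> k \<Longrightarrow> continuous_on UNIV (\<lambda>z. D i j (fst z) (snd z))"
    "\<And>i j t x. i + j < k \<Longrightarrow> ((\<lambda>s. D i j s x) has_real_derivative D (Suc i) j t x) (at t) \<and>
        ((\<lambda>y. D i j t y) has_real_derivative D i (Suc j) t x) (at x)"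
    unfolding Ck_R2_def by blast
  have "i + j + m \<le> k \<Longrightarrow> smooth2 m (D i j)" for m i j
  proof (induction m arbitrary: i j)
    case 0
    then show ?case using D(2) by simp
  next
    case (Suc m)
    then have "smooth2 m (D (Suc i) j)" "smooth2 m (D i (Suc j))" by auto
    then show ?case
      unfolding smooth2.simps using Suc.prems D(2)[of i j] D(3)[of i j] by fastforce
  qed
  from this[of 0 0 k] show ?thesis using D(1) by simp
qed

text \<open>The derivative in the first variable and the jointly continuous partial derivative in
  the second combine to a total derivative, and the chain rule for the curve s -> (s, u s) applies.
  Derivatives within \<open>S\<close> cover the end points of the time interval.\<close>

lemma has_real_derivative_along:
  fixes g g1 g2 :: "real \<Rightarrow> real \<Rightarrow> real"
  assumes g: "\<And>t x. ((\<lambda>s. g s x) has_real_derivative g1 t x) (at t)"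
      "\<And>t x. ((\<lambda>y. g t y) has_real_derivative g2 t x) (at x)"
    and cont: "continuous_on UNIV (\<lambda>z. g2 (fst z) (snd z))"
    and u: "(u has_real_derivative u') (at t within S)"
  shows "((\<lambda>s. g s (u s)) has_real_derivative g1 t (u t) + g2 t (u t) * u') (at t within S)"
proof -
  have "((\<lambda>(s, y). g s y) has_derivative (\<lambda>(ds, dy). g1 t (u t) * ds + blinfun_mult_right (g2 t (u t)) dy))
      (at (t, u t) within UNIV \<times> UNIV)"
  proof (rule has_derivative_partialsI)
    show "((\<lambda>s. g s (u t)) has_derivative (*) (g1 t (u t))) (at t within UNIV)"
      using g(1) by (simp add: has_field_derivative_def)
    fix s y :: real
    show "(g s has_derivative blinfun_apply (blinfun_mult_right (g2 s y))) (at y within UNIV)"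
      using g(2)[of s y] by (simp add: has_field_derivative_def)
  next
    have "continuous (at (t, u t)) (\<lambda>z. g2 (fst z) (snd z))"
      using cont by (simp add: continuous_on_eq_continuous_at)
    then show "continuous (at (t, u t) within UNIV \<times> UNIV) (\<lambda>(x, y). blinfun_mult_right (g2 x y))"
      using bounded_linear.continuous[OF bounded_linear_blinfun_mult_right]
      by (simp add: case_prod_beta')
  qed auto
  then have dg: "((\<lambda>(s, y). g s y) has_derivative (\<lambda>(ds, dy). g1 t (u t) * ds + g2 t (u t) * dy))
      (at (t, u t))"
    by simp
  have du: "((\<lambda>s. (s, u s)) has_derivative (\<lambda>h. (h, u' * h))) (at t within S)"
    using u by (auto simp: has_field_derivative_def intro!: derivative_eq_intros)
  have "((\<lambda>s. (\<lambda>(s, y). g s y) (s, u s)) has_derivative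
      (\<lambda>h. (\<lambda>(ds, dy). g1 t (u t) * ds + g2 t (u t) * dy) (h, u' * h))) (at t within S)"
    by (rule has_derivative_compose[OF du dg])
  moreover have "(\<lambda>h. (\<lambda>(ds, dy). g1 t (u t) * ds + g2 t (u t) * dy) (h, u' * h)) =
      (*) (g1 t (u t) + g2 t (u t) * u')"
    by (auto simp: fun_eq_iff distrib_right)
  ultimately show ?thesis
    unfolding has_field_derivative_def by simp
qed

text \<open>\<open>G i\<close> plays the i-th derivative of \<open>G 0\<close>, one-sided at the end
  points, with one bound for all orders. An explicit sequence avoids iterating a derivative operator
  on a closed interval.\<close>

definition deriv_chain :: "real \<Rightarrow> nat \<Rightarrow> (nat \<Rightarrow> real \<Rightarrow> real) \<Rightarrow> real \<Rightarrow> bool" where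
  "deriv_chain T k G M \<longleftrightarrow>
     (\<forall>i<k. \<forall>t\<in>{0..T}. (G i has_real_derivative G (Suc i) t) (at t within {0..T})) \<and>
     (\<forall>i\<le>k. \<forall>t\<in>{0..T}. \<bar>G i t\<bar> \<le> M)"

lemma deriv_chain_Suc: "deriv_chain T (Suc k) G M \<Longrightarrow> deriv_chain T k (\<lambda>i. G (Suc i)) M"
  by (auto simp: deriv_chain_def)

lemma deriv_chain_mono: "deriv_chain T k G M \<Longrightarrow> j \<le> k \<Longrightarrow> M \<le> M' \<Longrightarrow> deriv_chain T j G M'"
  unfolding deriv_chain_def by (meson dual_order.trans less_le_trans)

lemma continuous_along:
  assumes "continuous_on UNIV (\<lambda>z. g (fst z) (snd z))" "continuous_on S u"
  shows "continuous_on S (\<lambda>t. g t (u t) :: real)"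
proof -
  have "continuous_on S (\<lambda>t. (t, u t))" using assms(2) by (intro continuous_intros)
  from continuous_on_compose2[OF assms(1) this] show ?thesis by simp
qed

text \<open>By the differential equation the derivative of g(t, u(t)) is again a function of (t,
  u(t)), namely g_t + g_u f, which is one order less smooth. Compactness of the time interval
  supplies the bounds.\<close>

lemma exists_deriv_chain_along:
  assumes f: "smooth2 k f" and g: "smooth2 k g"
    and u: "\<forall>t\<in>{0..T}. (u has_real_derivative f t (u t)) (at t within {0..T})"
  shows "\<exists>G M. G 0 = (\<lambda>t. g t (u t)) \<and> deriv_chain T k G M"
  using f g
proof (induction k arbitrary: g)
  have cu: "continuous_on {0..T} u"
    using u DERIV_continuous unfolding continuous_on_eq_continuous_within by blast
  have bound: "\<exists>M. \<forall>t\<in>{0..T}. \<bar>g t (u t)\<bar> \<le> M" if "continuous_on UNIV (\<lambda>z. g (fst z) (snd z))"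
    for g :: "real \<Rightarrow> real \<Rightarrow> real"
  proof -
    have "compact ((\<lambda>t. g t (u t)) ` {0..T})"
      using continuous_along[OF that cu] by (intro compact_continuous_image) auto
    then show ?thesis by (auto dest!: compact_imp_bounded simp: bounded_iff)
  qed
  {
    case 0
    then obtain M where "\<forall>t\<in>{0..T}. \<bar>g t (u t)\<bar> \<le> M" using bound by auto
    then show ?case
      by (intro exI[of _ "\<lambda>_ t. g t (u t)"] exI[of _ M]) (auto simp: deriv_chain_def)
  next
    case (Suc k)
    from Suc.prems(2) obtain g1 g2 where g:
      "\<And>t x. ((\<lambda>s. g s x) has_real_derivative g1 t x) (at t)"
      "\<And>t x. ((\<lambda>y. g t y) has_real_derivative g2 t x) (at x)"
      "smooth2 k g1" "smooth2 k g2" "continuous_on UNIV (\<lambda>z. g (fst z) (snd z))"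
      unfolding smooth2.simps by blast
    have fk: "smooth2 k f" using Suc.prems smooth2_SucD by blast
    have "smooth2 k (\<lambda>t x. g1 t x + g2 t x * f t x)"
      using g fk by (intro smooth2_add smooth2_mult)
    from Suc.IH[OF fk this] obtain G M where
      G: "G 0 = (\<lambda>t. g1 t (u t) + g2 t (u t) * f t (u t))" "deriv_chain T k G M"
      by auto
    from bound[OF g(5)] obtain M' where M': "\<forall>t\<in>{0..T}. \<bar>g t (u t)\<bar> \<le> M'" by auto
    define H where "H i = (case i of 0 \<Rightarrow> (\<lambda>t. g t (u t)) | Suc j \<Rightarrow> G j)" for i
    have "((\<lambda>t. g t (u t)) has_real_derivative G 0 t) (at t within {0..T})" if "t \<in> {0..T}" for t
      unfolding G(1)
      by (rule has_real_derivative_along[OF g(1,2) smooth2_continuous[OF g(4)] u[rule_format, OF that]])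
    then have "(H i has_real_derivative H (Suc i) t) (at t within {0..T})"
      if "i < Suc k" "t \<in> {0..T}" for i t
      using that G(2) by (cases i) (auto simp: H_def deriv_chain_def)
    moreover have "\<bar>H i t\<bar> \<le> max M M'" if "i \<le> Suc k" "t \<in> {0..T}" for i t
      using that G(2) M' by (cases i) (auto simp: H_def deriv_chain_def le_max_iff_disj)
    ultimately have "deriv_chain T (Suc k) H (max M M')" by (simp add: deriv_chain_def)
    moreover have "H 0 = (\<lambda>t. g t (u t))" by (simp add: H_def)
    ultimately show ?case by blast
  }
qed

text \<open>The last argument counts the terms: the degree is below \<open>r\<close>, and the error
  is of order \<open>r\<close>.\<close>

definition taylor_poly :: "(nat \<Rightarrow> real \<Rightarrow> real) \<Rightarrow> real \<Rightarrow> nat \<Rightarrow> real poly" where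
  "taylor_poly G t r = (\<Sum>i<r. monom (G i t / fact i) i)"

lemma coeff_taylor_poly: "coeff (taylor_poly G t r) i = (if i < r then G i t / fact i else 0)"
  by (simp add: taylor_poly_def coeff_sum if_distrib cong: if_cong)

lemma degree_taylor_poly: "degree (taylor_poly G t (Suc r)) \<le> r"
  by (rule degree_le) (simp add: coeff_taylor_poly)

lemma pderiv_taylor_poly: "pderiv (taylor_poly G t (Suc r)) = taylor_poly (\<lambda>i. G (Suc i)) t r"
  by (rule poly_eqI) (simp add: coeff_pderiv coeff_taylor_poly fact_Suc del: of_nat_Suc of_nat_add)

lemma abs_coeff_taylor_poly_le:
  assumes "deriv_chain T k G M" "r \<le> Suc k" "t \<in> {0..T}" "0 \<le> M"
  shows "\<bar>coeff (taylor_poly G t r) i\<bar> \<le> M"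
proof (cases "i < r")
  case True
  then have "\<bar>G i t\<bar> \<le> M" using assms by (auto simp: deriv_chain_def)
  moreover have "\<bar>G i t\<bar> / fact i \<le> \<bar>G i t\<bar> / 1" by (intro divide_left_mono) (auto simp: fact_ge_1)
  ultimately show ?thesis using True by (simp add: coeff_taylor_poly)
qed (simp add: coeff_taylor_poly assms)

lemma taylor_poly_error:
  assumes G: "deriv_chain T k G M" and r: "r \<le> k" and t: "t \<in> {0..T}" "t + x \<in> {0..T}" and M: "0 \<le> M"
  shows "\<bar>G 0 (t + x) - poly (taylor_poly G t r) x\<bar> \<le> M * \<bar>x\<bar> ^ r"
proof (cases r)
  \<comment> \<open>The empty Taylor polynomial is zero, so the claim is the bound on
    \<open>G 0\<close>; the Taylor theorem used below has at least one term.\<close>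
  case 0
  then show ?thesis using G t by (simp add: taylor_poly_def deriv_chain_def)
next
  case (Suc n)
  have "norm (G 0 (t + x) - (\<Sum>i\<le>n. G i t * ((t + x) - t) ^ i / fact i))
      \<le> M * norm ((t + x) - t) ^ Suc n / fact n"
    by (rule field_Taylor[of "{0..T}"]) (use G t Suc r in \<open>auto simp: deriv_chain_def\<close>)
  also have "\<dots> \<le> M * norm ((t + x) - t) ^ Suc n / 1"
    using M by (intro divide_left_mono) (auto simp: fact_ge_1)
  finally show ?thesis
    using Suc by (simp add: taylor_poly_def poly_sum poly_monom lessThan_Suc_atMost field_simps)
qed

text \<open>The second derivative in the state variable is bounded only on compact sets, so the
  quadratic constant \<open>Q\<close> depends on the box of radius \<open>R\<close>. Taking
  \<open>max Q 0\<close> keeps it nonnegative even if the box is empty.\<close>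

lemma linearization_bound:
  fixes f f2 f22 :: "real \<Rightarrow> real \<Rightarrow> real" and T R :: real
  assumes f: "\<And>t x. (f t has_real_derivative f2 t x) (at x)"
    and f2: "\<And>t x. (f2 t has_real_derivative f22 t x) (at x)"
    and cont: "continuous_on UNIV (\<lambda>z. f22 (fst z) (snd z))"
  shows "\<exists>Q\<ge>0. \<forall>t\<in>{0..T}. \<forall>x y. \<bar>x\<bar> \<le> R \<and> \<bar>y\<bar> \<le> R \<longrightarrow>
    \<bar>f t y - f t x - f2 t x * (y - x)\<bar> \<le> Q * (y - x)\<^sup>2"
proof -
  have "compact ((\<lambda>z. f22 (fst z) (snd z)) ` ({0..T} \<times> {-R..R}))"
    by (intro compact_continuous_image compact_Times continuous_on_subset[OF cont]) auto
  then obtain Q where Q: "\<forall>t\<in>{0..T}. \<forall>z\<in>{-R..R}. \<bar>f22 t z\<bar> \<le> Q"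
    by (auto dest!: compact_imp_bounded simp: bounded_iff)
  have "\<bar>f t y - f t x - f2 t x * (y - x)\<bar> \<le> max Q 0 * (y - x)\<^sup>2"
    if t: "t \<in> {0..T}" and xy: "\<bar>x\<bar> \<le> R" "\<bar>y\<bar> \<le> R" for t x y
  proof -
    define F where "F i = (if i = 0 then f t else if i = 1 then f2 t else f22 t)" for i :: nat
    have "norm (F 0 y - (\<Sum>i\<le>1. F i x * (y - x) ^ i / fact i)) \<le> Q * norm (y - x) ^ Suc 1 / fact 1"
    proof (rule field_Taylor[of "{-R..R}"])
      fix z assume "z \<in> {-R..R}"
      then show "norm (F (Suc 1) z) \<le> Q" using Q t by (simp add: F_def)
    next
      fix i :: nat and z assume "i \<le> 1"
      then consider "i = 0" | "i = 1" by linarith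
      then show "(F i has_real_derivative F (Suc i) z) (at z within {-R..R})"
        using f f2 by cases (auto simp: F_def intro: has_field_derivative_at_within)
    qed (use xy in auto)
    then have "\<bar>f t y - f t x - f2 t x * (y - x)\<bar> \<le> Q * (y - x)\<^sup>2"
      by (simp add: F_def power2_eq_square algebra_simps)
    also have "\<dots> \<le> max Q 0 * (y - x)\<^sup>2" by (intro mult_right_mono) auto
    finally show ?thesis .
  qed
  then show ?thesis by (intro exI[of _ "max Q 0"]) auto
qed

section \<open>Sweeps and residuals\<close>

text \<open>Defect of the values \<open>U\<close> in the stage equations of a Runge-Kutta step of
  size 2d from \<open>x\<close>; for a = \<open>colloc\<close> these are the Radau IIA
  equations.\<close>

definition residual ::
  "nat \<Rightarrow> (nat \<Rightarrow> nat \<Rightarrow> real) \<Rightarrow> real \<Rightarrow> (nat \<Rightarrow> real \<Rightarrow> real) \<Rightarrow> real \<Rightarrow> (nat \<Rightarrow> real) \<Rightarrow> nat \<Rightarrow> real"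
  where "residual p a d F x U m = U m - x - d * (\<Sum>j\<le>p. a m j * F j (U j))"

text \<open>Explicit and implicit iterations are treated alike through the implicit relations they satisfy:
  the matrices \<open>b\<close> and \<open>c\<close> are strictly lower triangular for the explicit scheme and lower triangular
  for the implicit one. Throughout, \<open>d\<close> is half the step size and \<open>F i\<close> is the right-hand side at
  node \<open>i\<close>.\<close>

definition is_sweep ::
  "nat \<Rightarrow> (nat \<Rightarrow> nat \<Rightarrow> real) \<Rightarrow> (nat \<Rightarrow> nat \<Rightarrow> real) \<Rightarrow> real \<Rightarrow> (nat \<Rightarrow> real \<Rightarrow> real) \<Rightarrow> real \<Rightarrow>
    (nat \<Rightarrow> real) \<Rightarrow> (nat \<Rightarrow> real) \<Rightarrow> bool"
  where "is_sweep p a b d F x U U' \<longleftrightarrow> (\<forall>m\<le>p. U' m =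
    x + d * (\<Sum>i\<le>p. b m i * (F i (U' i) - F i (U i))) + d * (\<Sum>j\<le>p. a m j * F j (U j)))"

text \<open>The left end of the interval is not a Radau node, so the slope \<open>F0\<close> taken
  there by the explicit Euler start has its own coefficient \<open>c0\<close>; it is 0 for the
  implicit start.\<close>

definition is_euler ::
  "nat \<Rightarrow> real \<Rightarrow> (nat \<Rightarrow> nat \<Rightarrow> real) \<Rightarrow> real \<Rightarrow> (real \<Rightarrow> real) \<Rightarrow> (nat \<Rightarrow> real \<Rightarrow> real) \<Rightarrow> real \<Rightarrow>
    (nat \<Rightarrow> real) \<Rightarrow> bool"
  where "is_euler p c0 c d F0 F x U \<longleftrightarrow> (\<forall>m\<le>p. U m =
    x + d * (c0 * F0 x) + d * (\<Sum>i\<le>p. c m i * F i (U i)))"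

text \<open>Summation over all nodes bounds the total by (p + 1) c plus half of itself, and the half
  is absorbed. This treats explicit and implicit couplings alike.\<close>

lemma implicit_bound:
  fixes z :: "nat \<Rightarrow> real"
  assumes z: "\<And>m. m \<le> p \<Longrightarrow> \<bar>z m\<bar> \<le> c + q * (\<Sum>i\<le>p. \<bar>z i\<bar>)"
    and "0 \<le> c" "0 \<le> q" "2 * (q * real (Suc p)) \<le> 1" "m \<le> p"
  shows "\<bar>z m\<bar> \<le> 2 * c"
proof -
  define s where "s = (\<Sum>i\<le>p. \<bar>z i\<bar>)"
  have s0: "0 \<le> s" by (simp add: s_def sum_nonneg)
  have "s \<le> (\<Sum>i\<le>p. c + q * s)" unfolding s_def by (intro sum_mono z[unfolded s_def[symmetric]] z) auto
  also have "\<dots> = real (Suc p) * c + (q * real (Suc p)) * s" by (simp add: algebra_simps)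
  also have "\<dots> \<le> real (Suc p) * c + 1/2 * s" using assms s0 by (intro add_mono mult_right_mono) auto
  finally have s: "s \<le> 2 * real (Suc p) * c" by (simp add: algebra_simps)
  have "\<bar>z m\<bar> \<le> c + q * s" using z[OF \<open>m \<le> p\<close>] by (simp add: s_def)
  also have "\<dots> \<le> c + q * (2 * real (Suc p) * c)" using s assms by (intro add_mono mult_left_mono) auto
  also have "\<dots> = c + (2 * (q * real (Suc p))) * c" by simp
  also have "\<dots> \<le> c + 1 * c" using assms by (intro add_mono mult_right_mono) auto
  finally show ?thesis by simp
qed

text \<open>\<open>B\<close> is a common bound for the entries of all coefficient matrices. The
  condition \<open>small\<close> makes the coupling of the nodes at most 1/2, as the absorption in
  \<open>implicit_bound\<close> requires.\<close>

locale lipschitz_nodes =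
  fixes p :: nat and F :: "nat \<Rightarrow> real \<Rightarrow> real" and L B d :: real
  assumes F_lipschitz: "\<And>i x y. i \<le> p \<Longrightarrow> \<bar>F i x - F i y\<bar> \<le> L * \<bar>x - y\<bar>"
    and L_nonneg: "0 \<le> L" and B_nonneg: "0 \<le> B" and d_nonneg: "0 \<le> d"
    and small: "2 * (d * (B * L * real (Suc p))) \<le> 1"
begin

lemma sum_diff_le:
  assumes "\<forall>i\<le>p. \<bar>b i\<bar> \<le> B"
  shows "\<bar>\<Sum>i\<le>p. b i * (F i (U i) - F i (V i))\<bar> \<le> B * L * (\<Sum>i\<le>p. \<bar>U i - V i\<bar>)"
proof -
  have "\<bar>\<Sum>i\<le>p. b i * (F i (U i) - F i (V i))\<bar> \<le> (\<Sum>i\<le>p. \<bar>b i * (F i (U i) - F i (V i))\<bar>)"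
    by (rule sum_abs)
  also have "\<dots> \<le> (\<Sum>i\<le>p. B * (L * \<bar>U i - V i\<bar>))"
    using assms F_lipschitz B_nonneg by (intro sum_mono) (auto simp: abs_mult intro!: mult_mono)
  finally show ?thesis by (simp add: sum_distrib_left mult.assoc)
qed

lemma sum_diff_le':
  assumes "\<forall>i\<le>p. \<bar>b i\<bar> \<le> B" "\<forall>i\<le>p. \<bar>U i - V i\<bar> \<le> r"
  shows "\<bar>d * (\<Sum>i\<le>p. b i * (F i (U i) - F i (V i)))\<bar> \<le> d * (B * L * real (Suc p)) * r"
proof -
  have "(\<Sum>i\<le>p. \<bar>U i - V i\<bar>) \<le> (\<Sum>i\<le>p. r)" using assms by (intro sum_mono) auto
  then have "B * L * (\<Sum>i\<le>p. \<bar>U i - V i\<bar>) \<le> B * L * (real (Suc p) * r)"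
    using B_nonneg L_nonneg by (intro mult_left_mono) auto
  then have "\<bar>\<Sum>i\<le>p. b i * (F i (U i) - F i (V i))\<bar> \<le> B * L * (real (Suc p) * r)"
    using sum_diff_le[OF assms(1), of U V] by linarith
  then show ?thesis using d_nonneg by (auto simp: abs_mult mult.assoc intro!: mult_left_mono)
qed

lemma implicit_bound':
  fixes z :: "nat \<Rightarrow> real"
  assumes "\<And>m. m \<le> p \<Longrightarrow> \<bar>z m\<bar> \<le> c + d * (B * L * (\<Sum>i\<le>p. \<bar>z i\<bar>))" "0 \<le> c" "m \<le> p"
  shows "\<bar>z m\<bar> \<le> 2 * c"
  using assms B_nonneg L_nonneg d_nonneg small
  by (intro implicit_bound[of p z c "d * (B * L)"]) (auto simp: mult.assoc)

lemma abs_d_sum_diff_le: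
  assumes "\<forall>i\<le>p. \<bar>b i\<bar> \<le> B"
  shows "\<bar>d * (\<Sum>i\<le>p. b i * (F i (U i) - F i (V i)))\<bar> \<le> d * (B * L * (\<Sum>i\<le>p. \<bar>U i - V i\<bar>))"
  using sum_diff_le[OF assms, of U V] d_nonneg by (auto simp: abs_mult intro!: mult_left_mono)

text \<open>The update U' - U solves an implicit relation with right-hand side minus the old
  residual, so it is at most 2r. The new residual consists only of differences F(U') - F(U), once
  with weights \<open>b\<close> and once with \<open>a\<close>, each with a factor d; hence 4 = 2 +
  2.\<close>

lemma residual_sweep:
  assumes sweep: "is_sweep p a b d F x U U'"
    and a: "\<forall>m\<le>p. \<forall>i\<le>p. \<bar>a m i\<bar> \<le> B"
    and b: "\<forall>m\<le>p. \<forall>i\<le>p. \<bar>b m i\<bar> \<le> B"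
    and r: "\<forall>m\<le>p. \<bar>residual p a d F x U m\<bar> \<le> r" and m: "m \<le> p"
  shows "\<bar>residual p a d F x U' m\<bar> \<le> 4 * (d * (B * L * real (Suc p))) * r"
proof -
  have r0: "0 \<le> r" using r by (auto dest: spec[of _ 0])
  have U': "U' m = x + d * (\<Sum>i\<le>p. b m i * (F i (U' i) - F i (U i))) + d * (\<Sum>j\<le>p. a m j * F j (U j))"
    if "m \<le> p" for m using sweep that by (auto simp: is_sweep_def)
  have diff: "\<bar>U' i - U i\<bar> \<le> 2 * r" if "i \<le> p" for i
  proof (rule implicit_bound'[OF _ r0 that])
    fix m assume m: "m \<le> p"
    have "U' m - U m = d * (\<Sum>i\<le>p. b m i * (F i (U' i) - F i (U i))) - residual p a d F x U m"
      using U'[OF m] by (simp add: residual_def)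
    then show "\<bar>U' m - U m\<bar> \<le> r + d * (B * L * (\<Sum>i\<le>p. \<bar>U' i - U i\<bar>))"
      using abs_d_sum_diff_le[OF b[THEN spec, THEN mp, OF m], of U' U] b[THEN spec, THEN mp, OF m] r[THEN spec, THEN mp, OF m] by linarith
  qed
  have "residual p a d F x U' m = d * (\<Sum>i\<le>p. b m i * (F i (U' i) - F i (U i)))
      - d * (\<Sum>i\<le>p. a m i * (F i (U' i) - F i (U i)))"
    using U'[OF m] by (simp add: residual_def algebra_simps sum_subtractf)
  then show ?thesis
    using sum_diff_le'[of "b m" U' U "2 * r"] sum_diff_le'[of "a m" U' U "2 * r"] a[THEN spec, THEN mp, OF m] b[THEN spec, THEN mp, OF m] diff
    by auto
qed

text \<open>\<open>v\<close> stands for the exact solution at the nodes and \<open>s\<close> for the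
  node offsets. As the row sums of both coefficient sets equal \<open>s\<close>, the constant slope
  \<open>F0 x\<close> cancels, and what remains is quadratic in d.\<close>

lemma residual_euler:
  assumes euler: "is_euler p c0 c d F0 F x U"
    and a: "\<forall>m\<le>p. \<forall>i\<le>p. \<bar>a m i\<bar> \<le> B"
    and c: "\<forall>m\<le>p. \<forall>i\<le>p. \<bar>c m i\<bar> \<le> B"
    and sum_a: "\<forall>m\<le>p. (\<Sum>i\<le>p. a m i) = s m"
    and sum_c: "\<forall>m\<le>p. c0 + (\<Sum>i\<le>p. c m i) = s m"
    and v1: "\<forall>i\<le>p. \<bar>F i (v i) - F0 x\<bar> \<le> S * d"
    and v2: "\<forall>m\<le>p. \<bar>v m - x - d * (s m * F0 x)\<bar> \<le> S * d\<^sup>2"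
    and S: "0 \<le> S" and m: "m \<le> p"
  shows "\<bar>residual p a d F x U m\<bar> \<le> 4 * (S * (1 + B * real (Suc p))) * d\<^sup>2"
proof -
  let ?k = "B * real (Suc p)"
  have k0: "0 \<le> ?k" using B_nonneg by simp
  have drift: "\<bar>d * (\<Sum>i\<le>p. w i * (F i (v i) - F0 x))\<bar> \<le> ?k * S * d\<^sup>2"
    if w: "\<forall>i\<le>p. \<bar>w i\<bar> \<le> B" for w
  proof -
    have "\<bar>\<Sum>i\<le>p. w i * (F i (v i) - F0 x)\<bar> \<le> (\<Sum>i\<le>p. \<bar>w i * (F i (v i) - F0 x)\<bar>)" by (rule sum_abs)
    also have "\<dots> \<le> (\<Sum>i\<le>p. B * (S * d))"
      using w v1 B_nonneg by (intro sum_mono) (auto simp: abs_mult intro!: mult_mono)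
    also have "\<dots> = ?k * S * d" by simp
    finally have "d * \<bar>\<Sum>i\<le>p. w i * (F i (v i) - F0 x)\<bar> \<le> d * (?k * S * d)"
      using d_nonneg by (intro mult_left_mono)
    then show ?thesis using d_nonneg by (simp add: abs_mult power2_eq_square mult_ac)
  qed
  \<comment> \<open>The inhomogeneity of the equation for U - v: the Taylor error of
    \<open>v\<close> plus the drift of the slopes.\<close>
  define e where "e = S * d\<^sup>2 + ?k * S * d\<^sup>2"
  have e0: "0 \<le> e" using S k0 by (simp add: e_def)
  have U: "U m = x + d * (c0 * F0 x) + d * (\<Sum>i\<le>p. c m i * F i (U i))" if "m \<le> p" for m
    using euler that by (auto simp: is_euler_def)
  have z: "\<bar>U m - v m\<bar> \<le> 2 * e" if "m \<le> p" for m
  proof (rule implicit_bound'[OF _ e0 that])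
    fix m assume m: "m \<le> p"
    have "(\<Sum>i\<le>p. c m i * F i (U i)) = (\<Sum>i\<le>p. c m i * (F i (U i) - F i (v i))) +
        (\<Sum>i\<le>p. c m i * (F i (v i) - F0 x)) + (\<Sum>i\<le>p. c m i) * F0 x"
      by (simp add: algebra_simps sum_subtractf sum_distrib_left)
    then have "U m - v m = d * (\<Sum>i\<le>p. c m i * (F i (U i) - F i (v i))) +
        d * (\<Sum>i\<le>p. c m i * (F i (v i) - F0 x)) + (x + d * ((c0 + (\<Sum>i\<le>p. c m i)) * F0 x) - v m)"
      using U[OF m] by (simp add: algebra_simps)
    also have "x + d * ((c0 + (\<Sum>i\<le>p. c m i)) * F0 x) - v m = - (v m - x - d * (s m * F0 x))"
      using sum_c[THEN spec, THEN mp, OF m] by simp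
    finally show "\<bar>U m - v m\<bar> \<le> e + d * (B * L * (\<Sum>i\<le>p. \<bar>U i - v i\<bar>))"
      using abs_d_sum_diff_le[OF c[THEN spec, THEN mp, OF m], of U v] drift[OF c[THEN spec, THEN mp, OF m]] c[THEN spec, THEN mp, OF m] v2[THEN spec, THEN mp, OF m] unfolding e_def by linarith
  qed
  have "(\<Sum>i\<le>p. a m i * F i (U i)) = (\<Sum>i\<le>p. a m i * (F i (U i) - F i (v i))) +
        (\<Sum>i\<le>p. a m i * (F i (v i) - F0 x)) + (\<Sum>i\<le>p. a m i) * F0 x"
    by (simp add: algebra_simps sum_subtractf sum_distrib_left)
  then have "residual p a d F x U m = (U m - v m) + (v m - x - d * (s m * F0 x))
      - d * (\<Sum>i\<le>p. a m i * (F i (U i) - F i (v i))) - d * (\<Sum>i\<le>p. a m i * (F i (v i) - F0 x))"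
    using sum_a[THEN spec, THEN mp, OF m] by (simp add: residual_def algebra_simps)
  moreover have "\<bar>d * (\<Sum>i\<le>p. a m i * (F i (U i) - F i (v i)))\<bar> \<le> e"
  proof -
    have "\<bar>d * (\<Sum>i\<le>p. a m i * (F i (U i) - F i (v i)))\<bar> \<le> d * (B * L * real (Suc p)) * (2 * e)"
    using sum_diff_le'[of "a m" U v "2 * e"] a[THEN spec, THEN mp, OF m] z by auto
    also have "\<dots> \<le> e" using mult_right_mono[OF small e0] by (simp add: mult_ac)
    finally show ?thesis .
  qed
  ultimately have "\<bar>residual p a d F x U m\<bar> \<le> 4 * e"
    using z[OF m] v2[THEN spec, THEN mp, OF m] drift[OF a[THEN spec, THEN mp, OF m]] a[THEN spec, THEN mp, OF m] e_def by linarith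
  then show ?thesis by (simp add: e_def algebra_simps)
qed

text \<open>The crude first bound controls the input of the next sweep. The second one isolates x -
  y with coefficient exactly 1, as a stability constant 1 + O(h) demands.\<close>

lemma euler_stable:
  assumes U: "is_euler p c0 c d F0 F x U" and V: "is_euler p c0 c d F0 F y V"
    and c: "\<forall>m\<le>p. \<forall>i\<le>p. \<bar>c m i\<bar> \<le> B" and c0: "\<bar>c0\<bar> \<le> B"
    and F0: "\<bar>F0 x - F0 y\<bar> \<le> L * \<bar>x - y\<bar>" and m: "m \<le> p"
  shows "\<bar>U m - V m\<bar> \<le> 3 * \<bar>x - y\<bar>"
    and "\<bar>U m - V m - (x - y)\<bar> \<le> 4 * (d * (B * L * real (Suc p))) * \<bar>x - y\<bar>"
proof -
  let ?k = "d * (B * L * real (Suc p))"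
  have UV: "U m - V m = (x - y) + d * (c0 * (F0 x - F0 y)) + d * (\<Sum>i\<le>p. c m i * (F i (U i) - F i (V i)))"
    if "m \<le> p" for m
  proof -
    have "U m - V m = x + d * (c0 * F0 x) + d * (\<Sum>i\<le>p. c m i * F i (U i)) -
      (y + d * (c0 * F0 y) + d * (\<Sum>i\<le>p. c m i * F i (V i)))"
      using U V that by (auto simp: is_euler_def)
    then show ?thesis by (simp add: algebra_simps sum_subtractf)
  qed
  have "\<bar>c0 * (F0 x - F0 y)\<bar> \<le> B * (L * \<bar>x - y\<bar>)"
    using c0 F0 B_nonneg by (auto simp: abs_mult intro!: mult_mono)
  also have "\<dots> \<le> B * (L * \<bar>x - y\<bar>) * real (Suc p)"
    using mult_left_mono[of 1 "real (Suc p)" "B * (L * \<bar>x - y\<bar>)"] B_nonneg L_nonneg by simp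
  finally have "d * \<bar>c0 * (F0 x - F0 y)\<bar> \<le> d * (B * (L * \<bar>x - y\<bar>) * real (Suc p))"
    using d_nonneg by (intro mult_left_mono)
  then have 0: "\<bar>d * (c0 * (F0 x - F0 y))\<bar> \<le> ?k * \<bar>x - y\<bar>"
    using d_nonneg by (simp add: abs_mult mult_ac)
  have k: "?k * \<bar>x - y\<bar> \<le> 1/2 * \<bar>x - y\<bar>" using small by (intro mult_right_mono) auto
  have "\<bar>U m - V m\<bar> \<le> 2 * (3/2 * \<bar>x - y\<bar>)" if "m \<le> p" for m
  proof (rule implicit_bound'[OF _ _ that])
    fix m assume m: "m \<le> p"
    have "\<bar>d * (c0 * (F0 x - F0 y))\<bar> \<le> 1/2 * \<bar>x - y\<bar>" using 0 k by (rule order_trans)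
    then have "\<bar>x - y\<bar> + \<bar>d * (c0 * (F0 x - F0 y))\<bar> + \<bar>d * (\<Sum>i\<le>p. c m i * (F i (U i) - F i (V i)))\<bar>
        \<le> \<bar>x - y\<bar> + 1/2 * \<bar>x - y\<bar> + d * (B * L * (\<Sum>i\<le>p. \<bar>U i - V i\<bar>))"
      using abs_d_sum_diff_le[OF c[THEN spec, THEN mp, OF m], of U V] by (intro add_mono order_refl)
    moreover have "\<bar>U m - V m\<bar> \<le> \<bar>x - y\<bar> + \<bar>d * (c0 * (F0 x - F0 y))\<bar> +
        \<bar>d * (\<Sum>i\<le>p. c m i * (F i (U i) - F i (V i)))\<bar>"
      unfolding UV[OF m] by (intro order_trans[OF abs_triangle_ineq] add_mono order_refl)
    ultimately show "\<bar>U m - V m\<bar> \<le> 3/2 * \<bar>x - y\<bar> + d * (B * L * (\<Sum>i\<le>p. \<bar>U i - V i\<bar>))"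
      by simp
  qed auto
  then have *: "\<bar>U m - V m\<bar> \<le> 3 * \<bar>x - y\<bar>" if "m \<le> p" for m using that by simp
  then show "\<bar>U m - V m\<bar> \<le> 3 * \<bar>x - y\<bar>" using m .
  show "\<bar>U m - V m - (x - y)\<bar> \<le> 4 * ?k * \<bar>x - y\<bar>"
    using UV[OF m] sum_diff_le'[of "c m" U V "3 * \<bar>x - y\<bar>"] c[THEN spec, THEN mp, OF m] * 0 by auto
qed

text \<open>The previous iterates enter only through \<open>F\<close>, hence with a factor d. Their
  distance \<open>Y\<close> may thus be a large multiple of |x - y| without touching the leading
  coefficient 1.\<close>

lemma sweep_stable:
  assumes U: "is_sweep p a b d F x U U'" and V: "is_sweep p a b d F y V V'"
    and a: "\<forall>m\<le>p. \<forall>i\<le>p. \<bar>a m i\<bar> \<le> B"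
    and b: "\<forall>m\<le>p. \<forall>i\<le>p. \<bar>b m i\<bar> \<le> B"
    and Y: "\<forall>i\<le>p. \<bar>U i - V i\<bar> \<le> Y" and m: "m \<le> p"
  shows "\<bar>U' m - V' m\<bar> \<le> 2 * \<bar>x - y\<bar> + 2 * Y"
    and "\<bar>U' m - V' m - (x - y)\<bar> \<le> d * (B * L * real (Suc p)) * (4 * Y + 2 * \<bar>x - y\<bar>)"
proof -
  let ?k = "d * (B * L * real (Suc p))"
  have Y0: "0 \<le> Y" using Y by (auto dest: spec[of _ 0])
  have UV: "U' m - V' m = (x - y) + d * (\<Sum>i\<le>p. b m i * (F i (U' i) - F i (V' i)))
    - d * (\<Sum>i\<le>p. b m i * (F i (U i) - F i (V i))) + d * (\<Sum>i\<le>p. a m i * (F i (U i) - F i (V i)))"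
    if "m \<le> p" for m
  proof -
    have "U' m - V' m =
      x + d * (\<Sum>i\<le>p. b m i * (F i (U' i) - F i (U i))) + d * (\<Sum>j\<le>p. a m j * F j (U j)) -
      (y + d * (\<Sum>i\<le>p. b m i * (F i (V' i) - F i (V i))) + d * (\<Sum>j\<le>p. a m j * F j (V j)))"
      using U V that by (auto simp: is_sweep_def)
    then show ?thesis by (simp add: algebra_simps sum_subtractf)
  qed
  have old: "\<bar>d * (\<Sum>i\<le>p. b m i * (F i (U i) - F i (V i)))\<bar> \<le> ?k * Y"
    "\<bar>d * (\<Sum>i\<le>p. a m i * (F i (U i) - F i (V i)))\<bar> \<le> ?k * Y" if "m \<le> p" for m
    using sum_diff_le'[of "b m" U V Y] sum_diff_le'[of "a m" U V Y] a b Y that by auto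
  have k: "?k * Y \<le> 1/2 * Y" using small Y0 by (intro mult_right_mono) auto
  have new: "\<bar>U' m - V' m\<bar> \<le> 2 * (\<bar>x - y\<bar> + Y)" if "m \<le> p" for m
  proof (rule implicit_bound'[OF _ _ that])
    fix m assume m: "m \<le> p"
    show "\<bar>U' m - V' m\<bar> \<le> \<bar>x - y\<bar> + Y + d * (B * L * (\<Sum>i\<le>p. \<bar>U' i - V' i\<bar>))"
      using UV[OF m] abs_d_sum_diff_le[OF b[THEN spec, THEN mp, OF m], of U' V'] b[THEN spec, THEN mp, OF m] old[OF m] k by linarith
  qed (use Y0 in auto)
  show "\<bar>U' m - V' m\<bar> \<le> 2 * \<bar>x - y\<bar> + 2 * Y" using new[OF m] by simp
  have "\<bar>d * (\<Sum>i\<le>p. b m i * (F i (U' i) - F i (V' i)))\<bar> \<le> ?k * (2 * (\<bar>x - y\<bar> + Y))"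
    using sum_diff_le'[of "b m" U' V' "2 * (\<bar>x - y\<bar> + Y)"] b[THEN spec, THEN mp, OF m] new by auto
  then have "\<bar>U' m - V' m - (x - y)\<bar> \<le> ?k * (2 * (\<bar>x - y\<bar> + Y)) + ?k * Y + ?k * Y"
    using UV[OF m] old[OF m] by linarith
  then show "\<bar>U' m - V' m - (x - y)\<bar> \<le> ?k * (4 * Y + 2 * \<bar>x - y\<bar>)"
    by (simp add: algebra_simps)
qed

end

text \<open>Amplification of a perturbed start value: 3 from \<open>euler_stable\<close>, then the
  recursion given by the first bound of \<open>sweep_stable\<close>.\<close>

primrec stab_const :: "nat \<Rightarrow> real" where
  "stab_const 0 = 3"
| "stab_const (Suc k) = 2 + 2 * stab_const k"

lemma stab_const_ge: "0 \<le> stab_const k"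
  by (induction k) auto

section \<open>Stability and residual decay of the complete iteration\<close>

context lipschitz_nodes
begin

lemma iteration_stable:
  assumes U: "is_euler p c0 c d F0 F x (U 0)" "\<And>k. k < K \<Longrightarrow> is_sweep p a b d F x (U k) (U (Suc k))"
    and V: "is_euler p c0 c d F0 F y (V 0)" "\<And>k. k < K \<Longrightarrow> is_sweep p a b d F y (V k) (V (Suc k))"
    and a: "\<forall>m\<le>p. \<forall>i\<le>p. \<bar>a m i\<bar> \<le> B"
    and b: "\<forall>m\<le>p. \<forall>i\<le>p. \<bar>b m i\<bar> \<le> B"
    and c: "\<forall>m\<le>p. \<forall>i\<le>p. \<bar>c m i\<bar> \<le> B" and c0: "\<bar>c0\<bar> \<le> B"
    and F0: "\<bar>F0 x - F0 y\<bar> \<le> L * \<bar>x - y\<bar>" and m: "m \<le> p"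
  shows "\<bar>U K m - V K m\<bar> \<le> (1 + d * (B * L * real (Suc p)) * (4 * stab_const K + 2)) * \<bar>x - y\<bar>"
proof -
  let ?k = "d * (B * L * real (Suc p))"
  have k0: "0 \<le> ?k" using d_nonneg B_nonneg L_nonneg by simp
  have *: "\<forall>m\<le>p. \<bar>U k m - V k m\<bar> \<le> stab_const k * \<bar>x - y\<bar> \<and>
      \<bar>U k m - V k m - (x - y)\<bar> \<le> ?k * ((4 * stab_const k + 2) * \<bar>x - y\<bar>)" if "k \<le> K" for k
    using that
  proof (induction k)
    case 0
    show ?case
    proof (intro allI impI conjI)
      fix m assume m: "m \<le> p"
      note e = euler_stable[OF U(1) V(1) c c0 F0 m]
      show "\<bar>U 0 m - V 0 m\<bar> \<le> stab_const 0 * \<bar>x - y\<bar>" using e by simp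
      have "4 * ?k * \<bar>x - y\<bar> \<le> ?k * ((4 * stab_const 0 + 2) * \<bar>x - y\<bar>)"
        using mult_left_mono[of "4 * \<bar>x - y\<bar>" "14 * \<bar>x - y\<bar>" ?k] k0 by simp
      then show "\<bar>U 0 m - V 0 m - (x - y)\<bar> \<le> ?k * ((4 * stab_const 0 + 2) * \<bar>x - y\<bar>)"
        using e(2) by linarith
    qed
  next
    case (Suc k)
    then have Uk: "is_sweep p a b d F x (U k) (U (Suc k))" and Vk: "is_sweep p a b d F y (V k) (V (Suc k))"
      and Y: "\<forall>i\<le>p. \<bar>U k i - V k i\<bar> \<le> stab_const k * \<bar>x - y\<bar>"
      using U V by auto
    show ?case
    proof (intro allI impI conjI)
      fix m assume m: "m \<le> p"
      note e = sweep_stable[OF Uk Vk a b Y m]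
      show "\<bar>U (Suc k) m - V (Suc k) m\<bar> \<le> stab_const (Suc k) * \<bar>x - y\<bar>"
        using e(1) by (simp add: algebra_simps)
      have "4 * (stab_const k * \<bar>x - y\<bar>) + 2 * \<bar>x - y\<bar> = (4 * stab_const k + 2) * \<bar>x - y\<bar>"
        by (simp add: algebra_simps)
      also have "\<dots> \<le> (4 * stab_const (Suc k) + 2) * \<bar>x - y\<bar>"
        using stab_const_ge[of k] by (intro mult_right_mono) auto
      finally have "?k * (4 * (stab_const k * \<bar>x - y\<bar>) + 2 * \<bar>x - y\<bar>) \<le>
          ?k * ((4 * stab_const (Suc k) + 2) * \<bar>x - y\<bar>)"
        using k0 by (intro mult_left_mono)
      then show "\<bar>U (Suc k) m - V (Suc k) m - (x - y)\<bar> \<le> ?k * ((4 * stab_const (Suc k) + 2) * \<bar>x - y\<bar>)"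
        using e(2) by linarith
    qed
  qed
  have "\<bar>U K m - V K m\<bar> \<le> \<bar>x - y\<bar> + ?k * ((4 * stab_const K + 2) * \<bar>x - y\<bar>)"
    using *[of K] m abs_triangle_ineq[of "x - y" "U K m - V K m - (x - y)"] by fastforce
  then show ?thesis by (simp add: algebra_simps)
qed

lemma residual_iteration:
  assumes U: "\<And>k. k < K \<Longrightarrow> is_sweep p a b d F x (U k) (U (Suc k))"
    and a: "\<forall>m\<le>p. \<forall>i\<le>p. \<bar>a m i\<bar> \<le> B"
    and b: "\<forall>m\<le>p. \<forall>i\<le>p. \<bar>b m i\<bar> \<le> B"
    and r: "\<forall>m\<le>p. \<bar>residual p a d F x (U 0) m\<bar> \<le> r" and m: "m \<le> p"
  shows "\<bar>residual p a d F x (U K) m\<bar> \<le> (4 * (d * (B * L * real (Suc p)))) ^ K * r"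
proof -
  have "\<forall>m\<le>p. \<bar>residual p a d F x (U k) m\<bar> \<le> (4 * (d * (B * L * real (Suc p)))) ^ k * r"
    if "k \<le> K" for k
    using that
  proof (induction k)
    case 0
    then show ?case using r by simp
  next
    case (Suc k)
    then have IH: "\<forall>m\<le>p. \<bar>residual p a d F x (U k) m\<bar> \<le> (4 * (d * (B * L * real (Suc p)))) ^ k * r"
      by auto
    have "is_sweep p a b d F x (U k) (U (Suc k))" using U Suc.prems by auto
    from residual_sweep[OF this a b IH] show ?case by (simp add: mult.assoc)
  qed
  then show ?thesis using m by blast
qed

end

section \<open>Nodal error\<close>

lemma finite_matrix_bound:
  fixes a :: "nat \<Rightarrow> nat \<Rightarrow> real"
  shows "\<exists>B\<ge>0. \<forall>m\<le>p. \<forall>i\<le>p. \<bar>a m i\<bar> \<le> B"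
proof -
  let ?B = "\<Sum>m\<le>p. \<Sum>i\<le>p. \<bar>a m i\<bar>"
  have "\<bar>a m i\<bar> \<le> ?B" if "m \<le> p" "i \<le> p" for m i
  proof -
    have "\<bar>a m i\<bar> \<le> (\<Sum>i\<le>p. \<bar>a m i\<bar>)" by (rule member_le_sum) (use that in auto)
    also have "\<dots> \<le> ?B"
      by (rule member_le_sum[of m _ "\<lambda>m. \<Sum>i\<le>p. \<bar>a m i\<bar>"]) (use that in \<open>auto intro: sum_nonneg\<close>)
    finally show ?thesis .
  qed
  moreover have "0 \<le> ?B" by (intro sum_nonneg) auto
  ultimately show ?thesis by blast
qed

text \<open>\<open>G\<close> lists the derivatives of \<open>u\<close>. There are 2p + 2 of them,
  since the differential equation gives \<open>u\<close> one derivative more than \<open>f\<close>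
  has.\<close>

locale radau_ivp = radau +
  fixes T L M :: real and f :: "real \<Rightarrow> real \<Rightarrow> real" and u :: "real \<Rightarrow> real"
    and G :: "nat \<Rightarrow> real \<Rightarrow> real"
  assumes f_lipschitz: "\<And>t x y. \<bar>f t x - f t y\<bar> \<le> L * \<bar>x - y\<bar>" and L_nonneg: "0 \<le> L"
    and chain: "deriv_chain T (2 * p + 2) G M" and M_nonneg: "0 \<le> M"
    and G_0: "G 0 = u" and G_1: "G (Suc 0) = (\<lambda>t. f t (u t))"
begin

lemma node_eq: "node \<tau> t (2 * d) m = t + d * (\<tau> m + 1)"
  by (simp add: node_def algebra_simps)

lemma offset_bounds:
  assumes "j \<le> p" "0 \<le> d"
  shows "0 \<le> d * (\<tau> j + 1)" "d * (\<tau> j + 1) \<le> 2 * d"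
  using tau_bounds[OF assms(1)] assms(2) mult_left_mono[of "\<tau> j + 1" 2 d] by auto

lemma offset_in_interval:
  assumes "j \<le> p" "0 \<le> t" "0 \<le> d" "t + 2 * d \<le> T"
  shows "t \<in> {0..T}" "t + d * (\<tau> j + 1) \<in> {0..T}"
  using offset_bounds[OF assms(1,3)] assms by auto

abbreviation "rhs t d \<equiv> (\<lambda>i. f (node \<tau> t (2 * d) i))"

lemma taylor_u_error:
  assumes "r \<le> 2 * p + 1" "j \<le> p" "0 \<le> t" "0 \<le> d" "t + 2 * d \<le> T"
  shows "\<bar>u (node \<tau> t (2 * d) j) - poly (taylor_poly G t (Suc r)) (d * (\<tau> j + 1))\<bar> \<le> M * (2 * d) ^ Suc r"
    and "\<bar>rhs t d j (u (node \<tau> t (2 * d) j)) - poly (pderiv (taylor_poly G t (Suc r))) (d * (\<tau> j + 1))\<bar>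
      \<le> M * (2 * d) ^ r"
proof -
  note x = offset_bounds[OF assms(2,4)] offset_in_interval[OF assms(2-5)]
  have "\<bar>G 0 (t + d * (\<tau> j + 1)) - poly (taylor_poly G t (Suc r)) (d * (\<tau> j + 1))\<bar>
      \<le> M * \<bar>d * (\<tau> j + 1)\<bar> ^ Suc r"
    by (rule taylor_poly_error[OF chain _ x(3,4) M_nonneg]) (use assms in auto)
  also have "\<dots> \<le> M * (2 * d) ^ Suc r"
    using x M_nonneg by (intro mult_left_mono power_mono) auto
  finally show "\<bar>u (node \<tau> t (2 * d) j) - poly (taylor_poly G t (Suc r)) (d * (\<tau> j + 1))\<bar> \<le> M * (2 * d) ^ Suc r"
    by (simp add: G_0 node_eq)
  have "deriv_chain T (2 * p + 1) (\<lambda>i. G (Suc i)) M" using deriv_chain_Suc chain by simp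
  then have "\<bar>G (Suc 0) (t + d * (\<tau> j + 1)) - poly (taylor_poly (\<lambda>i. G (Suc i)) t r) (d * (\<tau> j + 1))\<bar>
      \<le> M * \<bar>d * (\<tau> j + 1)\<bar> ^ r"
    by (rule taylor_poly_error[OF _ _ x(3,4) M_nonneg]) (use assms in auto)
  also have "\<dots> \<le> M * (2 * d) ^ r"
    using x M_nonneg by (intro mult_left_mono power_mono) auto
  finally show "\<bar>rhs t d j (u (node \<tau> t (2 * d) j)) - poly (pderiv (taylor_poly G t (Suc r))) (d * (\<tau> j + 1))\<bar>
      \<le> M * (2 * d) ^ r"
    by (simp add: G_1 node_eq pderiv_taylor_poly)
qed

lemma poly_taylor_0: "poly (taylor_poly G t (Suc r)) 0 = u t"
  by (simp add: poly_0_coeff_0 coeff_taylor_poly G_0)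

text \<open>The Taylor polynomial of degree p + 1 satisfies the collocation relation exactly. What
  is left are its errors in value, of order p + 2, and in slope, of order p + 1 with a further
  factor d.\<close>

lemma colloc_residual_exact:
  assumes B: "\<forall>m\<le>p. \<forall>i\<le>p. \<bar>colloc m i\<bar> \<le> B" and B0: "0 \<le> B"
    and "m \<le> p" "0 \<le> t" "0 \<le> d" "t + 2 * d \<le> T"
  shows "\<bar>residual p colloc d (rhs t d) (u t) (\<lambda>m. u (node \<tau> t (2 * d) m)) m\<bar>
    \<le> (M + real (Suc p) * (B * M)) * (2 * d) ^ (p + 2)"
proof -
  define P where "P = taylor_poly G t (Suc (Suc p))"
  let ?r = "[:d, d:]"
  let ?x = "\<lambda>j. d * (\<tau> j + 1)"
  have dP: "degree P \<le> Suc p" unfolding P_def by (rule degree_taylor_poly)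
  have "degree (pcompose P ?r) \<le> Suc p" using dP by (simp add: degree_pcompose)
  from colloc_exact[OF this, of m]
  have P: "poly P (?x m) = u t + d * (\<Sum>j\<le>p. colloc m j * poly (pderiv P) (?x j))"
    using poly_taylor_0[of t "Suc p"]
    by (simp add: poly_pcompose pderiv_pcompose pderiv_pCons P_def algebra_simps sum_distrib_left)
  have e: "\<bar>u (node \<tau> t (2 * d) j) - poly P (?x j)\<bar> \<le> M * (2 * d) ^ (p + 2)"
    "\<bar>rhs t d j (u (node \<tau> t (2 * d) j)) - poly (pderiv P) (?x j)\<bar> \<le> M * (2 * d) ^ Suc p"
    if "j \<le> p" for j
    using taylor_u_error[of "Suc p" j t d] assms that by (auto simp: P_def)
  have "residual p colloc d (rhs t d) (u t) (\<lambda>m. u (node \<tau> t (2 * d) m)) m =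
      (u (node \<tau> t (2 * d) m) - poly P (?x m)) -
      d * (\<Sum>j\<le>p. colloc m j * (rhs t d j (u (node \<tau> t (2 * d) j)) - poly (pderiv P) (?x j)))"
    unfolding residual_def P by (simp add: algebra_simps sum_subtractf)
  moreover have "\<bar>d * (\<Sum>j\<le>p. colloc m j * (rhs t d j (u (node \<tau> t (2 * d) j)) - poly (pderiv P) (?x j)))\<bar>
      \<le> real (Suc p) * (B * M) * (2 * d) ^ (p + 2)"
  proof -
    have "\<bar>\<Sum>j\<le>p. colloc m j * (rhs t d j (u (node \<tau> t (2 * d) j)) - poly (pderiv P) (?x j))\<bar>
        \<le> (\<Sum>j\<le>p. B * (M * (2 * d) ^ Suc p))"
      using B e(2) B0 assms(3)
      by (intro order_trans[OF sum_abs] sum_mono) (auto simp only: abs_mult atMost_iff intro!: mult_mono)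
    then have "d * \<bar>\<Sum>j\<le>p. colloc m j * (rhs t d j (u (node \<tau> t (2 * d) j)) - poly (pderiv P) (?x j))\<bar>
        \<le> (2 * d) * (\<Sum>j\<le>p. B * (M * (2 * d) ^ Suc p))"
      using assms by (intro mult_mono) auto
    then show ?thesis using assms by (simp add: abs_mult mult_ac)
  qed
  ultimately show ?thesis using e(1)[OF assms(3)] unfolding distrib_right by linarith
qed

text \<open>Stability of the collocation equations: \<open>U\<close> and the exact nodal values
  solve them up to their respective residuals, and the Lipschitz terms are absorbed for small
  steps.\<close>

lemma node_error:
  "\<exists>C h0. 0 \<le> C \<and> 0 < h0 \<and> (\<forall>t d U r. 0 \<le> t \<and> 0 \<le> d \<and> 2 * d \<le> h0 \<and> t + 2 * d \<le> T \<and>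
     (\<forall>m\<le>p. \<bar>residual p colloc d (rhs t d) (u t) U m\<bar> \<le> r) \<longrightarrow>
     (\<forall>m\<le>p. \<bar>U m - u (node \<tau> t (2 * d) m)\<bar> \<le> C * ((2 * d) ^ (p + 2) + r)))"
proof -
  obtain B where B: "0 \<le> B" "\<forall>m\<le>p. \<forall>i\<le>p. \<bar>colloc m i\<bar> \<le> B"
    using finite_matrix_bound by blast
  define C1 where "C1 = M + real (Suc p) * (B * M)"
  define h0 where "h0 = 1 / (1 + B * L * real (Suc p))"
  have C1: "0 \<le> C1" using M_nonneg B by (simp add: C1_def)
  have pos: "0 \<le> B * L * real (Suc p)" using B L_nonneg by simp
  then have h0: "0 < h0" by (simp add: h0_def)
  have "\<bar>U m - u (node \<tau> t (2 * d) m)\<bar> \<le> 2 * (1 + C1) * ((2 * d) ^ (p + 2) + r)"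
    if t: "0 \<le> t" "0 \<le> d" "t + 2 * d \<le> T" and d: "2 * d \<le> h0"
      and r: "\<forall>m\<le>p. \<bar>residual p colloc d (rhs t d) (u t) U m\<bar> \<le> r" and m: "m \<le> p" for t d U r m
  proof -
    have "2 * d * (1 + B * L * real (Suc p)) \<le> 1"
      using mult_right_mono[OF d, of "1 + B * L * real (Suc p)"] pos by (simp add: h0_def)
    then have small: "2 * (d * (B * L * real (Suc p))) \<le> 1" using t by (simp add: algebra_simps)
    interpret lipschitz_nodes p "rhs t d" L B d
      by unfold_locales (use f_lipschitz L_nonneg B t small in auto)
    define v where "v m = u (node \<tau> t (2 * d) m)" for m
    have v: "\<bar>residual p colloc d (rhs t d) (u t) v m\<bar> \<le> C1 * (2 * d) ^ (p + 2)" if "m \<le> p" for m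
      using colloc_residual_exact[OF B(2,1) that t] by (simp add: v_def[abs_def] C1_def)
    have r0: "0 \<le> r" using r by (auto dest: spec[of _ 0])
    have "\<bar>U m - v m\<bar> \<le> 2 * (r + C1 * (2 * d) ^ (p + 2))"
    proof (rule implicit_bound'[OF _ _ m])
      fix m assume m: "m \<le> p"
      have "U m - v m = residual p colloc d (rhs t d) (u t) U m - residual p colloc d (rhs t d) (u t) v m
         + d * (\<Sum>i\<le>p. colloc m i * (rhs t d i (U i) - rhs t d i (v i)))"
        by (simp add: residual_def algebra_simps sum_subtractf)
      moreover have "\<bar>residual p colloc d (rhs t d) (u t) U m\<bar> \<le> r" using r m by blast
      ultimately show "\<bar>U m - v m\<bar> \<le> r + C1 * (2 * d) ^ (p + 2) + d * (B * L * (\<Sum>i\<le>p. \<bar>U i - v i\<bar>))"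
        using abs_d_sum_diff_le[OF B(2)[THEN spec, THEN mp, OF m], of U v] v[OF m] by linarith
    qed (use r0 C1 t in auto)
    also have "\<dots> \<le> 2 * (1 + C1) * ((2 * d) ^ (p + 2) + r)"
      using C1 r0 t by (simp add: algebra_simps)
    finally show ?thesis by (simp add: v_def)
  qed
  then show ?thesis using C1 h0 by (intro exI[of _ "2 * (1 + C1)"] exI[of _ h0]) auto
qed

end

section \<open>Superconvergence\<close>

context radau
begin

text \<open>The polynomial \<open>V\<close> of degree p + 1 starts at \<open>x\<close> and has nodal
  values \<open>W\<close> and nodal slopes d g. Its product with the rescaled \<open>P\<close> has
  degree at most 2p + 1, so the quadrature of its derivative is exact and yields a product rule at
  the nodes.\<close>

lemma weighted_collocation_identity:
  assumes deg: "degree P \<le> p" and P0: "poly P 0 = 1"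
    and W: "\<And>m. m \<le> p \<Longrightarrow> W m = x + d * (\<Sum>j\<le>p. colloc m j * g j)"
  shows "poly P (2 * d) * W p - x =
    d * (\<Sum>j\<le>p. \<omega> j * (poly (pderiv P) (d * (\<tau> j + 1)) * W j + poly P (d * (\<tau> j + 1)) * g j))"
proof -
  define V where "V = [:x:] + (\<Sum>j\<le>p. smult (d * g j) (antider j))"
  let ?P = "pcompose P [:d, d:]"
  have dV: "degree V \<le> Suc p"
    unfolding V_def
    by (intro degree_add_le degree_sum_le) (auto intro: order_trans[OF degree_smult_le] antider)
  have V: "poly V (\<tau> m) = W m" if "m \<le> p" for m
    using W[OF that] by (simp add: V_def poly_sum colloc_def sum_distrib_left mult_ac)
  have V': "poly (pderiv V) (\<tau> m) = d * g m" if m: "m \<le> p" for m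
  proof -
    have "poly (pderiv V) (\<tau> m) = (\<Sum>j\<le>p. d * g j * poly (lagrange p \<tau> j) (\<tau> m))"
      by (simp add: V_def pderiv_add pderiv_sum pderiv_smult antider pderiv_pCons poly_sum)
    also have "\<dots> = (\<Sum>j\<le>p. if j = m then d * g j else 0)"
      using m by (intro sum.cong) (auto simp: poly_lagrange)
    finally show ?thesis using m by simp
  qed
  have V0: "poly V (-1) = x" by (simp add: V_def poly_sum antider)
  have "degree (?P * V) \<le> 2 * p + 1"
    using degree_mult_le[of ?P V] dV deg by (simp add: degree_pcompose split: if_splits)
  from quadrature_pderiv[OF this]
  have "poly P (2 * d) * poly V 1 - poly P 0 * poly V (-1) =
     (\<Sum>j\<le>p. \<omega> j * (poly P (d * (\<tau> j + 1)) * poly (pderiv V) (\<tau> j) +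
        poly V (\<tau> j) * (poly (pderiv P) (d * (\<tau> j + 1)) * d)))"
    by (simp add: pderiv_mult pderiv_pcompose poly_pcompose pderiv_pCons algebra_simps)
  also have "\<dots> = (\<Sum>j\<le>p. d * (\<omega> j * (poly (pderiv P) (d * (\<tau> j + 1)) * W j + poly P (d * (\<tau> j + 1)) * g j)))"
    by (intro sum.cong) (auto simp: V V' algebra_simps)
  finally show ?thesis
    using V[of p] by (simp add: tau_p P0 V0 sum_distrib_left)
qed

end

context radau_ivp
begin

text \<open>The collocation equation is tested with a polynomial which nearly solves the adjoint
  linearized equation, so that the nodal errors, which are only of order \<open>p + 2\<close>, enter
  multiplied by a further factor of order \<open>p - 1\<close>.\<close>

lemma superconvergence_pos:
  assumes p: "p = Suc q"
    and A: "A 0 = (\<lambda>t. f2 t (u t))" "deriv_chain T (2 * p) A MA" "0 \<le> MA"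
    and lin: "\<And>R. \<exists>Q\<ge>0. \<forall>t\<in>{0..T}. \<forall>x y. \<bar>x\<bar> \<le> R \<and> \<bar>y\<bar> \<le> R \<longrightarrow>
      \<bar>f t y - f t x - f2 t x * (y - x)\<bar> \<le> Q * (y - x)\<^sup>2"
  shows "\<exists>C h0. 0 \<le> C \<and> 0 < h0 \<and> (\<forall>t d U r. 0 \<le> t \<and> 0 \<le> d \<and> 2 * d \<le> h0 \<and> t + 2 * d \<le> T \<and> r \<le> 1 \<and>
     (\<forall>m\<le>p. \<bar>residual p colloc d (rhs t d) (u t) U m\<bar> \<le> r) \<longrightarrow>
     \<bar>U p - u (t + 2 * d)\<bar> \<le> C * ((2 * d) ^ (2 * p + 2) + r))"
proof -
  obtain Ce h1 where Ce: "0 \<le> Ce" "0 < h1" and ne: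
    "\<forall>t d U r. 0 \<le> t \<and> 0 \<le> d \<and> 2 * d \<le> h1 \<and> t + 2 * d \<le> T \<and>
     (\<forall>m\<le>p. \<bar>residual p colloc d (rhs t d) (u t) U m\<bar> \<le> r) \<longrightarrow>
     (\<forall>m\<le>p. \<bar>U m - u (node \<tau> t (2 * d) m)\<bar> \<le> Ce * ((2 * d) ^ (p + 2) + r))"
    using node_error by (elim exE conjE)
  have node_err: "\<bar>U m - u (node \<tau> t (2 * d) m)\<bar> \<le> Ce * ((2 * d) ^ (p + 2) + r)"
    if "0 \<le> t" "0 \<le> d" "2 * d \<le> h1" "t + 2 * d \<le> T"
      "\<forall>m\<le>p. \<bar>residual p colloc d (rhs t d) (u t) U m\<bar> \<le> r" "m \<le> p" for t d U r m
    by (rule ne[rule_format]) (use that in auto)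
  obtain Cp where Cp: "0 \<le> Cp" and adj: "\<forall>a :: real poly. degree a \<le> q \<and> (\<forall>i. \<bar>coeff a i\<bar> \<le> MA) \<longrightarrow>
    (\<exists>\<pi>. degree \<pi> \<le> q \<and> poly \<pi> 0 = 1 \<and> (\<forall>i. \<bar>coeff \<pi> i\<bar> \<le> Cp) \<and>
      (\<forall>x\<in>{0..1}. \<bar>poly (pderiv \<pi> + a * \<pi>) x\<bar> \<le> Cp * x ^ q))"
    using exists_adjoint_poly[OF A(3), of q] by (elim exE conjE)
  \<comment> \<open>Degree of the test polynomial plus degree of the Taylor polynomial of
    \<open>u\<close>.\<close>
  define n where "n = q + (2 * p + 1)"
  obtain Cq where Cq: "0 \<le> Cq" and quad0: "\<forall>S d. degree S \<le> n \<and>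
      (\<forall>i. \<bar>coeff S i\<bar> \<le> real (Suc n) * (Cp * M)) \<and> 0 \<le> d \<and> 2 * d \<le> 1 \<longrightarrow>
    \<bar>poly S (2 * d) - poly S 0 - d * (\<Sum>j\<le>p. \<omega> j * poly (pderiv S) (d * (\<tau> j + 1)))\<bar>
      \<le> Cq * (2 * d) ^ (2 * p + 2)"
    using quadrature_pderiv_scaled_error[of n "real (Suc n) * (Cp * M)"] by (elim exE conjE)
  have quad: "\<bar>poly S (2 * d) - poly S 0 - d * (\<Sum>j\<le>p. \<omega> j * poly (pderiv S) (d * (\<tau> j + 1)))\<bar>
      \<le> Cq * (2 * d) ^ (2 * p + 2)"
    if "degree S \<le> n" "\<forall>i. \<bar>coeff S i\<bar> \<le> real (Suc n) * (Cp * M)" "0 \<le> d" "2 * d \<le> 1" for S d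
    by (rule quad0[rule_format]) (use that in auto)
  \<comment> \<open>The box contains the exact values, bounded by \<open>M\<close>, and the nodal
    values, whose error is at most 2 \<open>Ce\<close> because h and r are at most 1.\<close>
  obtain Q where Q: "0 \<le> Q" and lin0: "\<forall>t\<in>{0..T}. \<forall>x y. \<bar>x\<bar> \<le> M + 2 * Ce \<and> \<bar>y\<bar> \<le> M + 2 * Ce \<longrightarrow>
      \<bar>f t y - f t x - f2 t x * (y - x)\<bar> \<le> Q * (y - x)\<^sup>2"
    using lin[of "M + 2 * Ce"] by (elim exE conjE)
  have lin_err: "\<bar>f t y - f t x - f2 t x * (y - x)\<bar> \<le> Q * (y - x)\<^sup>2"
    if "t \<in> {0..T}" "\<bar>x\<bar> \<le> M + 2 * Ce" "\<bar>y\<bar> \<le> M + 2 * Ce" for t x y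
    by (rule lin0[rule_format]) (use that in auto)
  define Pb where "Pb = real (Suc q) * Cp"
  define Pb' where "Pb' = real (Suc q) * (real q * Cp)"
  define C1 where "C1 = Cp + MA * Pb"
  define C2 where "C2 = C1 * Ce + Pb' + Pb' * M + 2 * (Pb * Q * Ce\<^sup>2) + Pb * M"
  define C3 where "C3 = Cq + (\<Sum>j\<le>p. \<bar>\<omega> j\<bar>) * C2"
  \<comment> \<open>The last entry keeps the test polynomial at least 1/2 at the right end point,
    where it is divided out.\<close>
  define h0 where "h0 = min (min h1 1) (1 / (2 * (1 + Pb)))"
  have nonneg: "0 \<le> Pb" "0 \<le> Pb'" "0 \<le> C1" using Cp A(3) by (auto simp: Pb_def Pb'_def C1_def)
  then have C2: "0 \<le> C2" using Ce M_nonneg Q by (auto simp: C2_def intro!: add_nonneg_nonneg)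
  have C3: "0 \<le> C3" using C2 Cq by (auto simp: C3_def intro!: add_nonneg_nonneg mult_nonneg_nonneg sum_nonneg)
  have h0: "0 < h0" using Ce nonneg by (simp add: h0_def)
  have "\<bar>U p - u (t + 2 * d)\<bar> \<le> (2 * C3 + 1 + M) * ((2 * d) ^ (2 * p + 2) + r)"
    if t: "0 \<le> t" and d: "0 \<le> d" and dh: "2 * d \<le> h0" and tT: "t + 2 * d \<le> T" and r1: "r \<le> 1"
      and res: "\<forall>m\<le>p. \<bar>residual p colloc d (rhs t d) (u t) U m\<bar> \<le> r" for t d U r
  proof -
    define h where "h = 2 * d"
    define x where "x j = d * (\<tau> j + 1)" for j
    define tj where "tj j = node \<tau> t (2 * d) j" for j
    define v where "v j = u (tj j)" for j
    define e where "e j = U j - v j" for j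
    define g where "g j = f (tj j) (U j)" for j
    define rs where "rs = residual p colloc d (rhs t d) (u t) U"
    \<comment> \<open>Removing the residual gives values that satisfy the collocation relation
      exactly, with the slopes still evaluated at \<open>U\<close>.\<close>
    define W where "W j = U j - rs j" for j
    have h: "0 \<le> h" "h \<le> 1" "h \<le> h1" "d \<le> h" using d dh by (auto simp: h_def h0_def)
    have hPb: "h * Pb \<le> 1/2"
    proof -
      have "h \<le> 1 / (2 * (1 + Pb))" using dh by (simp add: h_def h0_def)
      then have "h * (2 * (1 + Pb)) \<le> 1 / (2 * (1 + Pb)) * (2 * (1 + Pb))"
        using nonneg by (intro mult_right_mono) auto
      then have "h * (2 * (1 + Pb)) \<le> 1" using nonneg by simp
      then show ?thesis using h by (simp add: algebra_simps)
    qed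
    have r0: "0 \<le> r" using res by (auto dest: spec[of _ 0])
    have tj: "tj j = t + x j" for j by (simp add: tj_def x_def node_eq)
    have x: "0 \<le> x j" "x j \<le> h" "x j \<le> 1" if "j \<le> p" for j
      using offset_bounds[OF that d] h by (auto simp: x_def h_def)
    have tT': "t \<in> {0..T}" "tj j \<in> {0..T}" if "j \<le> p" for j
      using offset_in_interval[OF that t d tT] by (auto simp: tj x_def)
    \<comment> \<open>The derivative f_u along the exact solution, truncated after q terms; its
      error of order q matches the adjoint defect.\<close>
    define a where "a = taylor_poly A t q"
    have "degree a \<le> q" by (rule degree_le) (simp add: a_def coeff_taylor_poly)
    moreover have "\<forall>i. \<bar>coeff a i\<bar> \<le> MA"
      using abs_coeff_taylor_poly_le[OF A(2) _ tT'(1)[of 0] A(3), of q] p by (simp add: a_def)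
    ultimately obtain P where P: "degree P \<le> q" "poly P 0 = 1" "\<And>i. \<bar>coeff P i\<bar> \<le> Cp"
      and adjP: "\<And>x. x \<in> {0..1} \<Longrightarrow> \<bar>poly (pderiv P + a * P) x\<bar> \<le> Cp * x ^ q"
      using adj by blast
    have Pb: "\<bar>poly P y\<bar> \<le> Pb" if "0 \<le> y" "y \<le> 1" for y
      using poly_bound_high_order[OF P(1,3), of 0 y] that by (simp add: Pb_def)
    have "degree (pderiv P) \<le> q" using P(1) by (simp add: degree_pderiv)
    from poly_bound_high_order[OF this abs_coeff_pderiv_le[OF P(3,1)], of 0]
    have Pb': "\<bar>poly (pderiv P) y\<bar> \<le> Pb'" if "0 \<le> y" "y \<le> 1" for y
      using that by (simp add: Pb'_def)
    have Ph: "1/2 \<le> poly P h"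
    proof -
      have c0: "coeff P 0 = 1" using P(2) by (simp add: poly_0_coeff_0)
      have "\<bar>poly (P - 1) h\<bar> \<le> real (Suc q) * Cp * h ^ 1"
      proof (rule poly_bound_high_order)
        show "degree (P - 1) \<le> q" using P(1) by (intro degree_diff_le) auto
        show "\<bar>coeff (P - 1) i\<bar> \<le> Cp" for i
          using P(3)[of i] Cp c0 by (cases i) auto
        show "coeff (P - 1) i = 0" if "i < 1" for i using c0 that by simp
      qed (use h in auto)
      then have "\<bar>poly P h - 1\<bar> \<le> h * Pb" by (simp add: Pb_def mult_ac)
      then show ?thesis using hPb by linarith
    qed
    define Pu where "Pu = taylor_poly G t (Suc (2 * p + 1))"
    have Pu: "degree Pu \<le> 2 * p + 1" "\<And>i. \<bar>coeff Pu i\<bar> \<le> M" "poly Pu 0 = u t"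
      unfolding Pu_def
      using degree_taylor_poly abs_coeff_taylor_poly_le[OF chain _ tT'(1)[of 0] M_nonneg] poly_taylor_0
      by auto
    have Pu_err: "\<bar>v j - poly Pu (x j)\<bar> \<le> M * h ^ (2 * p + 2)"
      "\<bar>f (tj j) (v j) - poly (pderiv Pu) (x j)\<bar> \<le> M * h ^ (2 * p + 1)" if "j \<le> p" for j
      using taylor_u_error[of "2 * p + 1" j t d] that t d tT by (auto simp: v_def tj_def Pu_def x_def h_def)
    have dS: "degree (P * Pu) \<le> n" using degree_mult_le[of P Pu] P(1) Pu(1) by (simp add: n_def)
    \<comment> \<open>The analogue of the weighted collocation identity for the exact solution. Here
      \<open>u\<close> is replaced by its Taylor polynomial, whose product with \<open>P\<close>
      exceeds the exactness degree when p > 1, hence the quadrature error.\<close>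
    have S_err: "\<bar>poly P h * poly Pu h - u t -
        d * (\<Sum>j\<le>p. \<omega> j * (poly (pderiv P) (x j) * poly Pu (x j) + poly P (x j) * poly (pderiv Pu) (x j)))\<bar>
        \<le> Cq * h ^ (2 * p + 2)"
    proof -
      have "poly (pderiv (P * Pu)) y = poly (pderiv P) y * poly Pu y + poly P y * poly (pderiv Pu) y" for y
        by (simp add: pderiv_mult)
      moreover have cS: "\<forall>i. \<bar>coeff (P * Pu) i\<bar> \<le> real (Suc n) * (Cp * M)"
        using abs_coeff_mult_le[OF P(3) Pu(2) dS] by blast
      moreover have d1: "2 * d \<le> 1" using h by (simp add: h_def)
      ultimately show ?thesis
        using quad[OF dS cS d d1] by (simp only: h_def x_def poly_mult P(2) Pu(3) mult_1)
    qed
    have V: "poly P h * W p - u t =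
        d * (\<Sum>j\<le>p. \<omega> j * (poly (pderiv P) (x j) * W j + poly P (x j) * g j))"
      unfolding h_def x_def
      by (rule weighted_collocation_identity)
        (use P p in \<open>auto simp: W_def rs_def residual_def g_def tj_def\<close>)
    define N where "N j = poly (pderiv P) (x j) * (W j - poly Pu (x j)) +
        poly P (x j) * (g j - poly (pderiv Pu) (x j))" for j
    have main: "\<bar>poly P h * (W p - poly Pu h) - d * (\<Sum>j\<le>p. \<omega> j * N j)\<bar> \<le> Cq * h ^ (2 * p + 2)"
    proof -
      have "poly P h * (W p - poly Pu h) - d * (\<Sum>j\<le>p. \<omega> j * N j) =
        (poly P h * W p - u t - d * (\<Sum>j\<le>p. \<omega> j * (poly (pderiv P) (x j) * W j + poly P (x j) * g j))) -
        (poly P h * poly Pu h - u t -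
        d * (\<Sum>j\<le>p. \<omega> j * (poly (pderiv P) (x j) * poly Pu (x j) + poly P (x j) * poly (pderiv Pu) (x j))))"
        by (simp add: N_def algebra_simps sum.distrib sum_subtractf)
      then show ?thesis using V S_err by simp
    qed
    define E where "E = Ce * (h ^ (p + 2) + r)"
    have E: "\<bar>e j\<bar> \<le> E" if "j \<le> p" for j
      using node_err[OF t d _ tT res that] h by (simp add: e_def v_def tj_def E_def h_def)
    have E0: "0 \<le> E" using Ce h r0 by (simp add: E_def)
    have E2: "E \<le> 2 * Ce"
    proof -
      have "h ^ (p + 2) + r \<le> 2" using power_le_one[of h "p + 2"] h r1 by simp
      then show ?thesis using Ce mult_left_mono[of "h ^ (p + 2) + r" 2 Ce] by (simp add: E_def)
    qed
    define \<epsilon> where "\<epsilon> = h ^ (2 * p + 2) + r"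
    have \<epsilon>0: "0 \<le> \<epsilon>" using h r0 by (simp add: \<epsilon>_def)
    have N_bound: "\<bar>d * N j\<bar> \<le> C2 * \<epsilon>" if j: "j \<le> p" for j
    proof -
      note xj = x[OF j]
      define \<alpha> where "\<alpha> = f2 (tj j) (v j)"
      define l where "l = g j - f (tj j) (v j) - \<alpha> * e j"
      \<comment> \<open>The nodal defect splits into the adjoint defect times the nodal error, the
        residual, the quadratic linearization remainder \<open>l\<close> and two Taylor
        errors.\<close>
      have N: "N j = (poly (pderiv P) (x j) + \<alpha> * poly P (x j)) * e j - poly (pderiv P) (x j) * rs j +
          poly (pderiv P) (x j) * (v j - poly Pu (x j)) + poly P (x j) * l +
          poly P (x j) * (f (tj j) (v j) - poly (pderiv Pu) (x j))"
        by (simp add: N_def W_def e_def l_def algebra_simps)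
      have "\<bar>A 0 (t + x j) - poly (taylor_poly A t q) (x j)\<bar> \<le> MA * \<bar>x j\<bar> ^ q"
        by (rule taylor_poly_error[OF A(2)]) (use p tT'[OF j] A(3) in \<open>auto simp: tj\<close>)
      then have \<alpha>: "\<bar>\<alpha> - poly a (x j)\<bar> \<le> MA * x j ^ q"
        using xj by (simp add: A(1) \<alpha>_def a_def v_def tj)
      have n1: "\<bar>(poly (pderiv P) (x j) + \<alpha> * poly P (x j)) * e j\<bar> \<le> C1 * h ^ q * E"
      proof -
        have "poly (pderiv P) (x j) + \<alpha> * poly P (x j) =
            poly (pderiv P + a * P) (x j) + (\<alpha> - poly a (x j)) * poly P (x j)"
          by (simp add: algebra_simps)
        moreover have "\<bar>(\<alpha> - poly a (x j)) * poly P (x j)\<bar> \<le> MA * x j ^ q * Pb"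
          unfolding abs_mult using \<alpha> Pb[of "x j"] xj A(3) by (intro mult_mono) auto
        ultimately have "\<bar>poly (pderiv P) (x j) + \<alpha> * poly P (x j)\<bar> \<le> Cp * x j ^ q + MA * x j ^ q * Pb"
          using adjP[of "x j"] xj by auto
        also have "\<dots> = C1 * x j ^ q" by (simp add: C1_def algebra_simps)
        also have "\<dots> \<le> C1 * h ^ q" using xj nonneg by (intro mult_left_mono power_mono) auto
        finally show ?thesis unfolding abs_mult
          using E[OF j] nonneg h by (intro mult_mono) auto
      qed
      have n2: "\<bar>poly (pderiv P) (x j) * rs j\<bar> \<le> Pb' * r"
        unfolding abs_mult using Pb'[of "x j"] xj res j nonneg by (intro mult_mono) (auto simp: rs_def)
      have n3: "\<bar>poly (pderiv P) (x j) * (v j - poly Pu (x j))\<bar> \<le> Pb' * (M * h ^ (2 * p + 2))"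
        unfolding abs_mult using Pb'[of "x j"] xj Pu_err[OF j] nonneg by (intro mult_mono) auto
      have n5: "\<bar>poly P (x j) * (f (tj j) (v j) - poly (pderiv Pu) (x j))\<bar> \<le> Pb * (M * h ^ (2 * p + 1))"
        unfolding abs_mult using Pb[of "x j"] xj Pu_err[OF j] nonneg by (intro mult_mono) auto
      have "\<bar>l\<bar> \<le> Q * (U j - v j)\<^sup>2"
      proof -
        have "\<bar>v j\<bar> \<le> M" using chain tT'(2)[OF j] by (auto simp: deriv_chain_def v_def G_0[symmetric])
        then have "\<bar>v j\<bar> \<le> M + 2 * Ce" "\<bar>U j\<bar> \<le> M + 2 * Ce"
          using Ce E[OF j] E2 unfolding e_def by linarith+
        from lin_err[OF tT'(2)[OF j] this] show ?thesis by (simp add: l_def g_def \<alpha>_def e_def)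
      qed
      also have "\<dots> \<le> Q * E\<^sup>2"
        using E[OF j] Q E0 by (intro mult_left_mono power2_le_iff_abs_le[THEN iffD2]) (auto simp: e_def)
      finally have n4: "\<bar>poly P (x j) * l\<bar> \<le> Pb * (Q * E\<^sup>2)"
        unfolding abs_mult using Pb[of "x j"] xj nonneg by (intro mult_mono) auto
      have "\<bar>N j\<bar> \<le> C1 * h ^ q * E + Pb' * r + Pb' * (M * h ^ (2 * p + 2)) + Pb * (Q * E\<^sup>2) +
          Pb * (M * h ^ (2 * p + 1))"
        unfolding N using n1 n2 n3 n4 n5 by linarith
      then have "d * \<bar>N j\<bar> \<le> h * (C1 * h ^ q * E + Pb' * r + Pb' * (M * h ^ (2 * p + 2)) + Pb * (Q * E\<^sup>2) +
          Pb * (M * h ^ (2 * p + 1)))"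
        using d h by (intro mult_mono) auto
      \<comment> \<open>The factor h in front of the quadrature sum raises h^q to h^p, which
        together with the nodal error gives order 2p + 2.\<close>
      also have "\<dots> = C1 * (h ^ p * E) + Pb' * (h * r) + Pb' * M * (h * h ^ (2 * p + 2)) + Pb * Q * (h * E\<^sup>2) +
          Pb * M * h ^ (2 * p + 2)"
        by (simp add: p algebra_simps)
      also have "\<dots> \<le> C1 * (Ce * \<epsilon>) + Pb' * \<epsilon> + Pb' * M * \<epsilon> + Pb * Q * (2 * Ce\<^sup>2 * \<epsilon>) + Pb * M * \<epsilon>"
      proof (intro add_mono mult_left_mono)
        have hp: "h ^ p \<le> 1" using h by (simp add: power_le_one)
        have "h ^ (2 * p + 2) = h ^ p * h ^ (p + 2)"
          by (subst power_add[symmetric]) (simp add: mult_2)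
        then have "h ^ p * E = Ce * (h ^ (2 * p + 2) + h ^ p * r)"
          by (simp only: E_def algebra_simps)
        also have "\<dots> \<le> Ce * \<epsilon>"
          unfolding \<epsilon>_def using Ce r0 hp by (intro mult_left_mono add_left_mono mult_left_le_one_le) (auto simp: h)
        finally show "h ^ p * E \<le> Ce * \<epsilon>" .
        have "h * r \<le> r" using h r0 by (intro mult_left_le_one_le) auto
        then show "h * r \<le> \<epsilon>" using zero_le_power[OF h(1), of "2 * p + 2"] unfolding \<epsilon>_def by linarith
        have "h * h ^ (2 * p + 2) \<le> h ^ (2 * p + 2)" using h by (intro mult_left_le_one_le) auto
        then show "h * h ^ (2 * p + 2) \<le> \<epsilon>" using r0 by (simp add: \<epsilon>_def)
        \<comment> \<open>The quadratic term is harmless: the squared nodal order 2p + 4 exceeds 2p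
          + 2, and r^2 \<le> r because r \<le> 1.\<close>
        have "(h ^ (p + 2) + r)\<^sup>2 \<le> 2 * ((h ^ (p + 2))\<^sup>2 + r\<^sup>2)"
          using sum_squares_bound[of "h ^ (p + 2)" r] by (simp add: power2_sum)
        also have "(h ^ (p + 2))\<^sup>2 + r\<^sup>2 \<le> \<epsilon>"
        proof -
          have "(h ^ (p + 2))\<^sup>2 = h ^ ((p + 2) * 2)" by (rule power_mult[symmetric])
          also have "\<dots> \<le> h ^ (2 * p + 2)" using h by (intro power_decreasing) auto
          finally have "(h ^ (p + 2))\<^sup>2 \<le> h ^ (2 * p + 2)" .
          moreover have "r\<^sup>2 \<le> r" using r0 r1 by (simp add: power2_eq_square mult_left_le_one_le)
          ultimately show ?thesis by (simp add: \<epsilon>_def)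
        qed
        finally have "(h ^ (p + 2) + r)\<^sup>2 \<le> 2 * \<epsilon>" by simp
        then have "Ce\<^sup>2 * (h ^ (p + 2) + r)\<^sup>2 \<le> Ce\<^sup>2 * (2 * \<epsilon>)" by (intro mult_left_mono) auto
        then have "E\<^sup>2 \<le> 2 * Ce\<^sup>2 * \<epsilon>" by (simp add: E_def power_mult_distrib mult_ac)
        moreover have "h * E\<^sup>2 \<le> E\<^sup>2" using h by (intro mult_left_le_one_le) auto
        ultimately show "h * E\<^sup>2 \<le> 2 * Ce\<^sup>2 * \<epsilon>" by linarith
        show "h ^ (2 * p + 2) \<le> \<epsilon>" using r0 by (simp add: \<epsilon>_def)
      qed (use nonneg M_nonneg Q in auto)
      also have "\<dots> = C2 * \<epsilon>" by (simp add: C2_def algebra_simps)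
      finally show ?thesis using d by (simp add: abs_mult)
    qed
    have "\<bar>d * (\<Sum>j\<le>p. \<omega> j * N j)\<bar> = \<bar>\<Sum>j\<le>p. \<omega> j * (d * N j)\<bar>"
      by (simp add: sum_distrib_left mult_ac)
    also have "\<dots> \<le> (\<Sum>j\<le>p. \<bar>\<omega> j\<bar> * (C2 * \<epsilon>))"
      using N_bound
      by (intro order_trans[OF sum_abs] sum_mono) (auto simp only: abs_mult atMost_iff intro!: mult_left_mono)
    also have "\<dots> = (\<Sum>j\<le>p. \<bar>\<omega> j\<bar>) * C2 * \<epsilon>" by (simp only: sum_distrib_right mult.assoc)
    finally have "\<bar>poly P h * (W p - poly Pu h)\<bar> \<le> Cq * h ^ (2 * p + 2) + (\<Sum>j\<le>p. \<bar>\<omega> j\<bar>) * C2 * \<epsilon>"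
      using main by linarith
    also have "\<dots> \<le> C3 * \<epsilon>"
      using Cq r0 by (simp add: C3_def \<epsilon>_def algebra_simps)
    finally have "\<bar>poly P h\<bar> * \<bar>W p - poly Pu h\<bar> \<le> C3 * \<epsilon>" by (simp add: abs_mult)
    moreover have "1/2 * \<bar>W p - poly Pu h\<bar> \<le> \<bar>poly P h\<bar> * \<bar>W p - poly Pu h\<bar>"
      using Ph by (intro mult_right_mono) auto
    ultimately have "1/2 * \<bar>W p - poly Pu h\<bar> \<le> C3 * \<epsilon>" by (rule order_trans[rotated])
    then have "\<bar>W p - poly Pu h\<bar> \<le> 2 * C3 * \<epsilon>" by simp
    moreover have "\<bar>u (t + 2 * d) - poly Pu h\<bar> \<le> M * \<epsilon>"
    proof -
      have "x p = h" by (simp add: x_def h_def tau_p)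
      then have "\<bar>u (t + 2 * d) - poly Pu h\<bar> \<le> M * h ^ (2 * p + 2)"
        using Pu_err(1)[of p] by (simp add: v_def tj h_def)
      also have "\<dots> \<le> M * \<epsilon>" using M_nonneg r0 by (intro mult_left_mono) (auto simp: \<epsilon>_def)
      finally show ?thesis .
    qed
    moreover have "\<bar>rs p\<bar> \<le> \<epsilon>"
    proof -
      have "\<bar>rs p\<bar> \<le> r" using res by (simp add: rs_def)
      also have "\<dots> \<le> \<epsilon>" using h by (simp add: \<epsilon>_def)
      finally show ?thesis .
    qed
    ultimately have "\<bar>U p - u (t + 2 * d)\<bar> \<le> 2 * C3 * \<epsilon> + \<epsilon> + M * \<epsilon>"
      unfolding W_def by linarith
    then show ?thesis by (simp add: \<epsilon>_def h_def algebra_simps)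
  qed
  then show ?thesis
    using C3 M_nonneg h0 by (intro exI[of _ "2 * C3 + 1 + M"] exI[of _ h0]) auto
qed

end

section \<open>Convergence of one-step methods\<close>

context radau_ivp
begin

text \<open>For p = 0 the nodal estimate already has the order 2p + 2, so the adjoint argument is
  reserved for positive p.\<close>

lemma superconvergence:
  assumes smooth: "smooth2 (2 * p + 1) f"
    and ode: "\<forall>t\<in>{0..T}. (u has_real_derivative f t (u t)) (at t within {0..T})"
  shows "\<exists>C h0. 0 \<le> C \<and> 0 < h0 \<and> (\<forall>t d U r. 0 \<le> t \<and> 0 \<le> d \<and> 2 * d \<le> h0 \<and> t + 2 * d \<le> T \<and> r \<le> 1 \<and>
     (\<forall>m\<le>p. \<bar>residual p colloc d (rhs t d) (u t) U m\<bar> \<le> r) \<longrightarrow>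
     \<bar>U p - u (t + 2 * d)\<bar> \<le> C * ((2 * d) ^ (2 * p + 2) + r))"
proof (cases p)
  case 0
  obtain C h0 where C: "0 \<le> C" "0 < h0" and ne:
    "\<forall>t d U r. 0 \<le> t \<and> 0 \<le> d \<and> 2 * d \<le> h0 \<and> t + 2 * d \<le> T \<and>
     (\<forall>m\<le>p. \<bar>residual p colloc d (rhs t d) (u t) U m\<bar> \<le> r) \<longrightarrow>
     (\<forall>m\<le>p. \<bar>U m - u (node \<tau> t (2 * d) m)\<bar> \<le> C * ((2 * d) ^ (p + 2) + r))"
    using node_error by (elim exE conjE)
  show ?thesis
  proof (rule exI[of _ C], rule exI[of _ h0], intro conjI allI impI C)
    fix t d U r
    assume "0 \<le> t \<and> 0 \<le> d \<and> 2 * d \<le> h0 \<and> t + 2 * d \<le> T \<and> r \<le> 1 \<and>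
     (\<forall>m\<le>p. \<bar>residual p colloc d (rhs t d) (u t) U m\<bar> \<le> r)"
    then have "\<bar>U p - u (node \<tau> t (2 * d) p)\<bar> \<le> C * ((2 * d) ^ (p + 2) + r)"
      by (intro ne[rule_format]) auto
    moreover have "node \<tau> t (2 * d) p = t + 2 * d" by (simp add: node_eq tau_p)
    ultimately show "\<bar>U p - u (t + 2 * d)\<bar> \<le> C * ((2 * d) ^ (2 * p + 2) + r)" using 0 by simp
  qed
next
  \<comment> \<open>Now \<open>f\<close> has at least three continuous derivatives: f_uu is
    continuous and controls the linearization, and f_u has 2p derivatives along the
    solution.\<close>
  case (Suc q)
  have "smooth2 (Suc (2 * p)) f" using smooth by simp
  then obtain f2 where f2: "\<And>t x. (f t has_real_derivative f2 t x) (at x)" "smooth2 (2 * p) f2"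
    unfolding smooth2.simps by blast
  have "smooth2 (Suc (Suc (2 * q))) f2" using f2(2) Suc by simp
  then obtain f22 where f22: "\<And>t x. (f2 t has_real_derivative f22 t x) (at x)" "smooth2 (Suc (2 * q)) f22"
    by (subst (asm) smooth2.simps(2)) blast
  have "smooth2 (2 * p) f" using smooth by (rule smooth2_mono) simp
  from exists_deriv_chain_along[OF this f2(2) ode]
  obtain A MA where A: "A 0 = (\<lambda>t. f2 t (u t))" "deriv_chain T (2 * p) A MA" by blast
  have "deriv_chain T (2 * p) A (max MA 0)" by (rule deriv_chain_mono[OF A(2)]) auto
  then show ?thesis
    by (rule superconvergence_pos[where q = q and A = A and ?f2.0 = f2 and MA = "max MA 0", OF Suc A(1)])
      (use linearization_bound[OF f2(1) f22(1) smooth2_continuous[OF f22(2)]] in auto)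
qed

end

lemma one_step_convergence:
  fixes S :: "real \<Rightarrow> real \<Rightarrow> real \<Rightarrow> real"
  assumes \<Lambda>: "0 \<le> \<Lambda>" and C: "0 \<le> C"
    and consistent: "\<And>t h. 0 \<le> t \<Longrightarrow> 0 < h \<Longrightarrow> h \<le> h0 \<Longrightarrow> t + h \<le> T \<Longrightarrow>
      \<bar>S t h (u t) - u (t + h)\<bar> \<le> C * h ^ Suc k"
    and stable: "\<And>t h x y. 0 < h \<Longrightarrow> h \<le> h0 \<Longrightarrow> \<bar>S t h x - S t h y\<bar> \<le> (1 + \<Lambda> * h) * \<bar>x - y\<bar>"
    and part: "time_partition T N t" and mesh: "mesh N t \<le> h0" and n: "n \<le> N"
  shows "\<bar>u (t n) - onestep_sol S t (u 0) n\<bar> \<le> C * T * exp (\<Lambda> * T) * mesh N t ^ k"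
proof -
  define H where "H = mesh N t"
  have t0: "t 0 = 0" and tN: "t N = T" and step: "\<And>n. n < N \<Longrightarrow> t n < t (Suc n)"
    using part by (auto simp: time_partition_def)
  have mono: "t i \<le> t j" if "i \<le> j" "j \<le> N" for i j
    using that
  proof (induction j)
    case (Suc j)
    then show ?case using step[of j] by (cases "i = Suc j") auto
  qed simp
  have tn: "0 \<le> t n" "t n \<le> T" if "n \<le> N" for n
    using mono[of 0 n] mono[of n N] that t0 tN by auto
  have hH: "t (Suc n) - t n \<le> H" if "n < N" for n
    unfolding H_def mesh_def using that by (intro Max_ge) auto
  have H0: "0 \<le> H" if "0 < N" using hH[OF that] step[OF that] by linarith
  \<comment> \<open>The factor \<open>t n\<close> accumulates the local errors and the exponential
    their amplification. The induction closes because 1 + \<Lambda> h \<le> exp(\<Lambda> h) and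
    both exponentials are at most the one at the new time.\<close>
  have err: "\<bar>u (t n) - onestep_sol S t (u 0) n\<bar> \<le> C * H ^ k * (t n * exp (\<Lambda> * t n))" if "n \<le> N" for n
    using that
  proof (induction n)
    case 0
    then show ?case by (simp add: t0)
  next
    case (Suc n)
    define h where "h = t (Suc n) - t n"
    define y where "y = onestep_sol S t (u 0) n"
    have n: "n < N" using Suc.prems by simp
    have h: "0 < h" "h \<le> H" "h \<le> h0" "t (Suc n) = t n + h"
      using step[OF n] hH[OF n] mesh by (auto simp: h_def H_def)
    note t = tn[of n] tn[OF Suc.prems]
    have IH: "\<bar>u (t n) - y\<bar> \<le> C * H ^ k * (t n * exp (\<Lambda> * t n))" using Suc n by (simp add: y_def)
    have E: "0 \<le> C * H ^ k" using C h by simp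
    have "\<bar>S (t n) h (u (t n)) - u (t n + h)\<bar> \<le> C * h ^ Suc k"
      using consistent[of "t n" h] t n h by simp
    also have "\<dots> \<le> C * H ^ k * h"
      using C h by (auto simp: mult_ac intro!: mult_left_mono power_mono)
    also have "\<dots> \<le> C * H ^ k * (h * exp (\<Lambda> * t (Suc n)))"
      using h E t \<Lambda> by (intro mult_left_mono) auto
    finally have 1: "\<bar>S (t n) h (u (t n)) - u (t n + h)\<bar> \<le> C * H ^ k * (h * exp (\<Lambda> * t (Suc n)))" .
    have "\<bar>S (t n) h (u (t n)) - S (t n) h y\<bar> \<le> (1 + \<Lambda> * h) * \<bar>u (t n) - y\<bar>"
      using h by (intro stable)
    also have "\<dots> \<le> exp (\<Lambda> * h) * (C * H ^ k * (t n * exp (\<Lambda> * t n)))"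
      using IH h \<Lambda> by (intro mult_mono exp_ge_add_one_self) auto
    also have "\<dots> = C * H ^ k * (t n * exp (\<Lambda> * t (Suc n)))"
      by (simp add: h(4) distrib_left exp_add mult_ac)
    finally have 2: "\<bar>S (t n) h (u (t n)) - S (t n) h y\<bar> \<le> C * H ^ k * (t n * exp (\<Lambda> * t (Suc n)))" .
    have "\<bar>u (t (Suc n)) - onestep_sol S t (u 0) (Suc n)\<bar> \<le>
        C * H ^ k * (h * exp (\<Lambda> * t (Suc n))) + C * H ^ k * (t n * exp (\<Lambda> * t (Suc n)))"
      using 1 2 by (simp add: h(4) flip: y_def h_def)
    also have "\<dots> = C * H ^ k * (t (Suc n) * exp (\<Lambda> * t (Suc n)))"
      by (simp add: h(4) algebra_simps)
    finally show ?case .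
  qed
  show ?thesis
  proof (cases "N = 0")
    \<comment> \<open>The mesh is then a maximum over the empty set; but T = 0 and the error
      vanishes.\<close>
    case True
    then show ?thesis using err[OF n] n t0 tN by simp
  next
    case False
    have "t n * exp (\<Lambda> * t n) \<le> T * exp (\<Lambda> * T)"
      using tn[OF n] \<Lambda> by (intro mult_mono) (auto intro: mult_left_mono)
    then have "C * H ^ k * (t n * exp (\<Lambda> * t n)) \<le> C * H ^ k * (T * exp (\<Lambda> * T))"
      using C H0 False by (intro mult_left_mono) auto
    then show ?thesis using err[OF n] by (simp add: H_def mult_ac)
  qed
qed

text \<open>The iterates are quantified existentially, so the convergence proof sees only the
  relations they satisfy and serves both schemes.\<close>

definition is_sdg_step where
  "is_sdg_step p a b c0 c K d F0 F x y \<longleftrightarrow> (\<exists>U. is_euler p c0 c d F0 F x (U 0) \<and>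
     (\<forall>k<K. is_sweep p a b d F x (U k) (U (Suc k))) \<and> y = U K p)"

context radau_ivp
begin

lemma sdg_convergence:
  assumes smooth: "smooth2 (2 * p + 1) f"
    and ode: "\<forall>t\<in>{0..T}. (u has_real_derivative f t (u t)) (at t within {0..T})"
    and sum_c: "\<And>m. m \<le> p \<Longrightarrow> c0 + (\<Sum>i\<le>p. c m i) = \<tau> m + 1" and h1: "0 < h1"
    and step: "\<And>t d x. 0 < d \<Longrightarrow> 2 * d \<le> h1 \<Longrightarrow>
      is_sdg_step p colloc b c0 c K d (f t) (rhs t d) x (S t (2 * d) x)"
  shows "\<exists>C h0. h0 > 0 \<and> (\<forall>N t. time_partition T N t \<and> mesh N t \<le> h0 \<longrightarrow>
            (\<forall>n\<le>N. \<bar>u (t n) - onestep_sol S t (u 0) n\<bar>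
                       \<le> C * mesh N t ^ min (2 * p + 1) (K + 1)))"
proof -
  obtain Ba where Ba: "0 \<le> Ba" "\<forall>m\<le>p. \<forall>i\<le>p. \<bar>colloc m i\<bar> \<le> Ba" using finite_matrix_bound by blast
  obtain Bb where Bb: "0 \<le> Bb" "\<forall>m\<le>p. \<forall>i\<le>p. \<bar>b m i\<bar> \<le> Bb" using finite_matrix_bound by blast
  obtain Bc where Bc: "0 \<le> Bc" "\<forall>m\<le>p. \<forall>i\<le>p. \<bar>c m i\<bar> \<le> Bc" using finite_matrix_bound by blast
  define B where "B = Ba + Bb + Bc + \<bar>c0\<bar>"
  have B: "0 \<le> B" "\<bar>c0\<bar> \<le> B" using Ba Bb Bc by (auto simp: B_def)
  have BB: "\<forall>m\<le>p. \<forall>i\<le>p. \<bar>colloc m i\<bar> \<le> B" "\<forall>m\<le>p. \<forall>i\<le>p. \<bar>b m i\<bar> \<le> B" "\<forall>m\<le>p. \<forall>i\<le>p. \<bar>c m i\<bar> \<le> B"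
  proof -
    have "Ba \<le> B" "Bb \<le> B" "Bc \<le> B" using Ba Bb Bc by (auto simp: B_def)
    then show "\<forall>m\<le>p. \<forall>i\<le>p. \<bar>colloc m i\<bar> \<le> B" "\<forall>m\<le>p. \<forall>i\<le>p. \<bar>b m i\<bar> \<le> B"
      "\<forall>m\<le>p. \<forall>i\<le>p. \<bar>c m i\<bar> \<le> B"
      using Ba Bb Bc by (meson order_trans)+
  qed
  define \<kappa> where "\<kappa> = B * L * real (Suc p)"
  have \<kappa>: "0 \<le> \<kappa>" using B L_nonneg by (simp add: \<kappa>_def)
  obtain Cs h2 where Cs: "0 \<le> Cs" "0 < h2" and sc:
    "\<forall>t d U r. 0 \<le> t \<and> 0 \<le> d \<and> 2 * d \<le> h2 \<and> t + 2 * d \<le> T \<and> r \<le> 1 \<and>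
     (\<forall>m\<le>p. \<bar>residual p colloc d (rhs t d) (u t) U m\<bar> \<le> r) \<longrightarrow>
     \<bar>U p - u (t + 2 * d)\<bar> \<le> Cs * ((2 * d) ^ (2 * p + 2) + r)"
    using superconvergence[OF smooth ode] by (elim exE conjE)
  \<comment> \<open>\<open>R\<close> is the constant of \<open>residual_euler\<close> with S = 4 M,
    and \<open>Cr\<close> adds the K sweep factors 4 d \<kappa> = 2 \<kappa> h.\<close>
  define R where "R = 4 * (4 * M * (1 + B * real (Suc p)))"
  define Cr where "Cr = (2 * \<kappa>) ^ K * R"
  have R: "0 \<le> R" using B M_nonneg by (simp add: R_def)
  then have Cr: "0 \<le> Cr" using \<kappa> by (simp add: Cr_def)
  \<comment> \<open>Besides the limits \<open>h1\<close> of the scheme and \<open>h2\<close> of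
    superconvergence, this ensures h \<le> 1, the smallness condition at the nodes, and a final
    residual of at most 1.\<close>
  define h0 where "h0 = min (min h1 h2) (min 1 (min (1 / (1 + \<kappa>)) (1 / (1 + Cr))))"
  have h0: "0 < h0" using h1 Cs \<kappa> Cr by (simp add: h0_def)
  have nodes: "lipschitz_nodes p (rhs t d) L B d" if d: "0 \<le> d" "2 * d \<le> h0" for t d
  proof -
    have "2 * d \<le> 1 / (1 + \<kappa>)" using d by (simp add: h0_def)
    then have "2 * d * (1 + \<kappa>) \<le> 1" using \<kappa> by (simp add: pos_le_divide_eq)
    then have "2 * (d * \<kappa>) \<le> 1" using d by (simp add: algebra_simps)
    then show ?thesis
      by unfold_locales (use d B L_nonneg f_lipschitz in \<open>auto simp: \<kappa>_def\<close>)
  qed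
  define \<mu> where "\<mu> = min (2 * p + 1) (K + 1)"
  define \<Lambda> where "\<Lambda> = \<kappa> * (4 * stab_const K + 2)"
  have \<Lambda>: "0 \<le> \<Lambda>" using \<kappa> stab_const_ge[of K] by (simp add: \<Lambda>_def)
  have stable: "\<bar>S t h x - S t h y\<bar> \<le> (1 + \<Lambda> * h) * \<bar>x - y\<bar>" if h: "0 < h" "h \<le> h0" for t h x y
  proof -
    define d where "d = h / 2"
    have d: "0 < d" "2 * d = h" "2 * d \<le> h0" "2 * d \<le> h1" using h by (auto simp: d_def h0_def)
    interpret lipschitz_nodes p "rhs t d" L B d by (rule nodes) (use d in auto)
    obtain U where U: "is_euler p c0 c d (f t) (rhs t d) x (U 0)"
      "\<And>k. k < K \<Longrightarrow> is_sweep p colloc b d (rhs t d) x (U k) (U (Suc k))" "S t (2 * d) x = U K p"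
      using step[OF d(1,4), of t x] by (auto simp: is_sdg_step_def)
    obtain V where V: "is_euler p c0 c d (f t) (rhs t d) y (V 0)"
      "\<And>k. k < K \<Longrightarrow> is_sweep p colloc b d (rhs t d) y (V k) (V (Suc k))" "S t (2 * d) y = V K p"
      using step[OF d(1,4), of t y] by (auto simp: is_sdg_step_def)
    have "\<bar>U K p - V K p\<bar> \<le> (1 + d * (B * L * real (Suc p)) * (4 * stab_const K + 2)) * \<bar>x - y\<bar>"
      by (rule iteration_stable[OF U(1,2) V(1,2) BB B(2) f_lipschitz order_refl])
    also have "\<dots> \<le> (1 + \<Lambda> * h) * \<bar>x - y\<bar>"
    proof (intro mult_right_mono add_left_mono)
      have "d * (B * L * real (Suc p)) * (4 * stab_const K + 2) = d * \<Lambda>"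
        by (simp add: \<Lambda>_def \<kappa>_def)
      also have "\<dots> \<le> h * \<Lambda>" using d \<Lambda> by (intro mult_right_mono) auto
      finally show "d * (B * L * real (Suc p)) * (4 * stab_const K + 2) \<le> \<Lambda> * h" by (simp add: mult_ac)
    qed simp
    finally show ?thesis using U(3) V(3) d(2) by simp
  qed
  have consistent: "\<bar>S t h (u t) - u (t + h)\<bar> \<le> Cs * (1 + Cr) * h ^ Suc \<mu>"
    if t: "0 \<le> t" "t + h \<le> T" and h: "0 < h" "h \<le> h0" for t h
  proof -
    define d where "d = h / 2"
    have d: "0 < d" "2 * d = h" "2 * d \<le> h0" "2 * d \<le> h1" "2 * d \<le> h2" "0 \<le> d" "d \<le> h"
      using h by (auto simp: d_def h0_def)
    have h1: "h \<le> 1" using h by (simp add: h0_def)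
    interpret lipschitz_nodes p "rhs t d" L B d by (rule nodes) (use d in auto)
    obtain U where U: "is_euler p c0 c d (f t) (rhs t d) (u t) (U 0)"
      "\<And>k. k < K \<Longrightarrow> is_sweep p colloc b d (rhs t d) (u t) (U k) (U (Suc k))" "S t (2 * d) (u t) = U K p"
      using step[OF d(1,4), of t "u t"] by (auto simp: is_sdg_step_def)
    have tT: "t + 2 * d \<le> T" using t d by simp
    have r_euler: "\<forall>m\<le>p. \<bar>residual p colloc d (rhs t d) (u t) (U 0) m\<bar> \<le> R * d\<^sup>2"
    proof (intro allI impI)
      fix m assume m: "m \<le> p"
      \<comment> \<open>The Taylor bounds are 2 M d for slopes and 4 M d^2 for values; 4 M serves
        both.\<close>
      have v1: "\<forall>i\<le>p. \<bar>rhs t d i (u (node \<tau> t (2 * d) i)) - f t (u t)\<bar> \<le> 4 * M * d"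
      proof (intro allI impI)
        fix i assume "i \<le> p"
        from taylor_u_error(2)[of 1, OF _ this t(1) d(6) tT]
        have "\<bar>rhs t d i (u (node \<tau> t (2 * d) i)) - f t (u t)\<bar> \<le> M * (2 * d)"
          by (simp add: pderiv_taylor_poly) (simp add: taylor_poly_def poly_monom G_1)
        also have "\<dots> \<le> 4 * M * d" using mult_nonneg_nonneg[OF M_nonneg d(6)] by linarith
        finally show "\<bar>rhs t d i (u (node \<tau> t (2 * d) i)) - f t (u t)\<bar> \<le> 4 * M * d" .
      qed
      have v2: "\<forall>m\<le>p. \<bar>u (node \<tau> t (2 * d) m) - u t - d * ((\<tau> m + 1) * f t (u t))\<bar> \<le> 4 * M * d\<^sup>2"
      proof (intro allI impI)
        fix i assume "i \<le> p"
        from taylor_u_error(1)[of 1, OF _ this t(1) d(6) tT]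
        show "\<bar>u (node \<tau> t (2 * d) i) - u t - d * ((\<tau> i + 1) * f t (u t))\<bar> \<le> 4 * M * d\<^sup>2"
          by (simp add: taylor_poly_def poly_monom G_0 G_1 power2_eq_square algebra_simps)
      qed
      show "\<bar>residual p colloc d (rhs t d) (u t) (U 0) m\<bar> \<le> R * d\<^sup>2"
        unfolding R_def
        by (rule residual_euler[OF U(1) BB(1,3) _ _ v1 v2 _ m])
          (use sum_colloc sum_c M_nonneg in auto)
    qed
    have res: "\<bar>residual p colloc d (rhs t d) (u t) (U K) m\<bar> \<le> Cr * h ^ (K + 2)" if "m \<le> p" for m
    proof -
      have "\<bar>residual p colloc d (rhs t d) (u t) (U K) m\<bar> \<le> (4 * (d * (B * L * real (Suc p)))) ^ K * (R * d\<^sup>2)"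
        by (rule residual_iteration[OF U(2) BB(1,2) r_euler that])
      also have "(4 * (d * (B * L * real (Suc p)))) ^ K * (R * d\<^sup>2) = Cr * (h ^ K * d\<^sup>2)"
      proof -
        have eq: "4 * (d * (B * L * real (Suc p))) = 2 * \<kappa> * h" by (simp add: \<kappa>_def d_def)
        show ?thesis unfolding eq Cr_def power_mult_distrib[of "2 * \<kappa>" h K] by (simp only: mult_ac)
      qed
      also have "\<dots> \<le> Cr * (h ^ K * h\<^sup>2)" using Cr d h by (intro mult_left_mono power_mono) auto
      finally show ?thesis by (simp only: power_add)
    qed
    have "Cr * h ^ (K + 2) \<le> 1"
    proof -
      have "h ^ (K + 2) \<le> h ^ 1" using h h1 by (intro power_decreasing) auto
      then have "Cr * h ^ (K + 2) \<le> Cr * h" using Cr by (intro mult_left_mono) auto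
      also have "\<dots> \<le> (1 + Cr) * h" using h Cr by simp
      also have "\<dots> \<le> 1"
      proof -
        have "h \<le> 1 / (1 + Cr)" using h by (simp add: h0_def)
        then show ?thesis using Cr by (simp add: pos_le_divide_eq mult.commute)
      qed
      finally show ?thesis .
    qed
    then have "\<bar>U K p - u (t + 2 * d)\<bar> \<le> Cs * ((2 * d) ^ (2 * p + 2) + Cr * h ^ (K + 2))"
      using res t d tT by (intro sc[rule_format]) auto
    \<comment> \<open>Both exponents 2p + 2 and K + 2 are at least \<mu> + 1, and h \<le> 1.\<close>
    also have "\<dots> \<le> Cs * (h ^ Suc \<mu> + Cr * h ^ Suc \<mu>)"
      unfolding d(2) using Cs Cr h h1
      by (intro mult_left_mono add_mono power_decreasing) (auto simp: \<mu>_def)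
    finally show ?thesis using U(3) d(2) by (simp add: algebra_simps)
  qed
  have "\<bar>u (t n) - onestep_sol S t (u 0) n\<bar> \<le> Cs * (1 + Cr) * T * exp (\<Lambda> * T) * mesh N t ^ \<mu>"
    if "time_partition T N t" "mesh N t \<le> h0" "n \<le> N" for N t n
    by (rule one_step_convergence[OF \<Lambda> _ consistent stable that]) (use Cs Cr in auto)
  then show ?thesis using h0 unfolding \<mu>_def by blast
qed

end

section \<open>The explicit and implicit schemes\<close>

text \<open>The implicit values are defined by \<open>THE\<close>, so their equation holds only
  after existence and uniqueness are known; a contraction of the real line provides both.\<close>

lemma The_fixed_point:
  fixes \<Phi> :: "real \<Rightarrow> real"
  assumes "\<And>x y. \<bar>\<Phi> x - \<Phi> y\<bar> \<le> q * \<bar>x - y\<bar>" "0 \<le> q" "q < 1"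
  shows "(THE x. x = \<Phi> x) = \<Phi> (THE x. x = \<Phi> x)"
proof -
  have "\<exists>!x. \<Phi> x = x"
    using assms by (intro banach_fix_type[of q]) (auto simp: dist_real_def)
  then have "\<exists>!x. x = \<Phi> x" by metis
  then show ?thesis by (rule theI')
qed

lemma sum_atMost_0: "(\<Sum>i\<le>(0::nat). g i) = (g 0 :: real)"
  by simp

lemma sum_atMost_restrict_less:
  fixes g :: "nat \<Rightarrow> real"
  assumes "m \<le> p"
  shows "(\<Sum>i\<le>p. (if i < m then w i else 0) * g i) = (\<Sum>i<m. w i * g i)"
proof -
  have "(\<Sum>i\<le>p. (if i < m then w i else 0) * g i) = (\<Sum>i\<in>{..p}. if i \<in> {..<m} then w i * g i else 0)"
    by (intro sum.cong) auto
  also have "\<dots> = (\<Sum>i\<in>{..p} \<inter> {..<m}. w i * g i)" by (rule sum.inter_restrict[symmetric]) simp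
  also have "{..p} \<inter> {..<m} = {..<m}" using assms by auto
  finally show ?thesis .
qed

lemma sum_atMost_restrict_le:
  fixes g :: "nat \<Rightarrow> real"
  assumes "m \<le> p"
  shows "(\<Sum>i\<le>p. (if i \<le> m then w i else 0) * g i) = (\<Sum>i\<le>m. w i * g i)"
proof -
  have "(\<Sum>i\<le>p. (if i \<le> m then w i else 0) * g i) = (\<Sum>i\<in>{..p}. if i \<in> {..m} then w i * g i else 0)"
    by (intro sum.cong) auto
  also have "\<dots> = (\<Sum>i\<in>{..p} \<inter> {..m}. w i * g i)" by (rule sum.inter_restrict[symmetric]) simp
  also have "{..p} \<inter> {..m} = {..m}" using assms by auto
  finally show ?thesis .
qed

section \<open>Unrolling the two recursions into triangular relations\<close>

context radau_ivp
begin

text \<open>The value -1 at index 0 is the left end of the reference interval, so that the Euler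
  increments telescope to the node offsets.\<close>

definition prev_tau :: "nat \<Rightarrow> real" where
  "prev_tau i = (case i of 0 \<Rightarrow> -1 | Suc j \<Rightarrow> \<tau> j)"

lemma node_diff:
  "node \<tau> t (2 * d) 0 - t = d * (\<tau> 0 + 1)"
  "node \<tau> t (2 * d) (Suc m) - node \<tau> t (2 * d) m = d * (\<tau> (Suc m) - \<tau> m)"
  unfolding node_eq by (simp_all add: algebra_simps)

lemma sum_sdg_corr:
  assumes "m \<le> p"
  shows "(\<Sum>i\<le>m. sdg_corr f p \<tau> \<omega> t (2 * d) U i) = d * (\<Sum>j\<le>p. colloc m j * rhs t d j (U j))"
proof -
  have "(\<Sum>i\<le>m. sdg_corr f p \<tau> \<omega> t (2 * d) U i) =
      d * (\<Sum>i\<le>m. \<Sum>j\<le>p. Ltil p \<tau> i j * \<omega> j * rhs t d j (U j))"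
    by (simp add: sdg_corr_def sum_distrib_left)
  also have "(\<Sum>i\<le>m. \<Sum>j\<le>p. Ltil p \<tau> i j * \<omega> j * rhs t d j (U j)) =
      (\<Sum>j\<le>p. (\<Sum>i\<le>m. Ltil p \<tau> i j * \<omega> j) * rhs t d j (U j))"
    unfolding sum_distrib_right by (rule sum.swap)
  also have "\<dots> = (\<Sum>j\<le>p. colloc m j * rhs t d j (U j))"
    using sum_Ltil assms by (intro sum.cong) auto
  finally show ?thesis .
qed

text \<open>Adding up the node-to-node increments produces the lower triangular sums. The slope at
  node i first affects node i + 1, hence the strict inequality and the shifted difference of
  nodes.\<close>

lemma step_expl_is_sdg_step:
  "is_sdg_step p colloc (\<lambda>m i. if i < m then \<omega> i else 0) (\<tau> 0 + 1)
     (\<lambda>m i. if i < m then \<tau> (Suc i) - \<tau> i else 0) K d (f t) (rhs t d) x (step_expl f p \<tau> \<omega> K t (2 * d) x)"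
proof -
  let ?U = "iter_expl f p \<tau> \<omega> t (2 * d) x"
  have euler: "?U 0 m = x + d * ((\<tau> 0 + 1) * f t x) + d * (\<Sum>i<m. (\<tau> (Suc i) - \<tau> i) * rhs t d i (?U 0 i))" for m
  proof (induction m)
    case 0
    show ?case by (simp add: node_diff)
  next
    case (Suc m)
    have "?U 0 (Suc m) = ?U 0 m + d * ((\<tau> (Suc m) - \<tau> m) * rhs t d m (?U 0 m))"
      by (simp add: node_diff)
    then show ?case using Suc.IH unfolding sum.lessThan_Suc distrib_left by linarith
  qed
  have "is_euler p (\<tau> 0 + 1) (\<lambda>m i. if i < m then \<tau> (Suc i) - \<tau> i else 0) d (f t) (rhs t d) x (?U 0)"
    unfolding is_euler_def
  proof (intro allI impI, goal_cases)
    case (1 m)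
    show ?case
      unfolding sum_atMost_restrict_less[OF 1] by (rule euler)
  qed
  moreover have "is_sweep p colloc (\<lambda>m i. if i < m then \<omega> i else 0) d (rhs t d) x (?U k) (?U (Suc k))" for k
  proof -
    have sweep: "?U (Suc k) m = x + d * (\<Sum>i<m. \<omega> i * (rhs t d i (?U (Suc k) i) - rhs t d i (?U k i))) +
        (\<Sum>i\<le>m. sdg_corr f p \<tau> \<omega> t (2 * d) (?U k) i)" for m
    proof (induction m)
      case (Suc m)
      have "?U (Suc k) (Suc m) = ?U (Suc k) m +
          d * (\<omega> m * (rhs t d m (?U (Suc k) m) - rhs t d m (?U k m))) + sdg_corr f p \<tau> \<omega> t (2 * d) (?U k) (Suc m)"
        by simp
      then show ?case using Suc.IH unfolding sum.lessThan_Suc sum.atMost_Suc distrib_left by linarith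
    qed simp
    show ?thesis
      unfolding is_sweep_def
    proof (intro allI impI, goal_cases)
      case (1 m)
      show ?case
        unfolding sum_atMost_restrict_less[OF 1] sum_sdg_corr[OF 1, of t d "?U k", symmetric]
        by (rule sweep)
    qed
  qed
  ultimately show ?thesis
    unfolding is_sdg_step_def step_expl_def by blast
qed

text \<open>The factor 1 + \<Sum>|\<omega>_i| in the smallness condition covers two kinds of scalar
  equations: Euler substeps of length at most 2d, and sweep equations with coefficient d
  \<omega>_i.\<close>

lemma step_impl_is_sdg_step:
  assumes d: "0 \<le> d" and small: "2 * d * ((1 + (\<Sum>i\<le>p. \<bar>\<omega> i\<bar>)) * L) < 1"
  shows "is_sdg_step p colloc (\<lambda>m i. if i \<le> m then \<omega> i else 0) 0
     (\<lambda>m i. if i \<le> m then \<tau> i - prev_tau i else 0) K d (f t) (rhs t d) x (step_impl f p \<tau> \<omega> K t (2 * d) x)"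
proof -
  let ?U = "iter_impl f p \<tau> \<omega> t (2 * d) x"
  define q where "q = 2 * d * ((1 + (\<Sum>i\<le>p. \<bar>\<omega> i\<bar>)) * L)"
  have q: "0 \<le> q" "q < 1" using d small L_nonneg by (auto simp: q_def intro!: mult_nonneg_nonneg add_nonneg_nonneg sum_nonneg)
  have fixpoint: "(THE y. y = \<alpha> + w * (f s y - g) + \<beta>) =
      \<alpha> + w * (f s (THE y. y = \<alpha> + w * (f s y - g) + \<beta>) - g) + \<beta>"
    if w: "\<bar>w\<bar> \<le> 2 * d * (1 + (\<Sum>i\<le>p. \<bar>\<omega> i\<bar>))" for \<alpha> w s g \<beta>
  proof (rule The_fixed_point[OF _ q])
    fix y z
    have "\<bar>\<alpha> + w * (f s y - g) + \<beta> - (\<alpha> + w * (f s z - g) + \<beta>)\<bar> = \<bar>w\<bar> * \<bar>f s y - f s z\<bar>"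
      by (simp add: abs_mult[symmetric] algebra_simps)
    also have "\<dots> \<le> (2 * d * (1 + (\<Sum>i\<le>p. \<bar>\<omega> i\<bar>))) * (L * \<bar>y - z\<bar>)"
      using w f_lipschitz by (intro mult_mono) auto
    finally show "\<bar>\<alpha> + w * (f s y - g) + \<beta> - (\<alpha> + w * (f s z - g) + \<beta>)\<bar> \<le> q * \<bar>y - z\<bar>"
      by (simp add: q_def mult_ac)
  qed
  have fixpoint_euler: "(THE y. y = \<alpha> + w * f s y) = \<alpha> + w * f s (THE y. y = \<alpha> + w * f s y)"
    if "0 \<le> w" "w \<le> 2 * d" for \<alpha> w s
  proof -
    have "2 * d * 1 \<le> 2 * d * (1 + (\<Sum>i\<le>p. \<bar>\<omega> i\<bar>))"
      using d by (intro mult_left_mono) (auto intro: sum_nonneg)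
    then show ?thesis using fixpoint[of w \<alpha> s 0 0] that by simp
  qed
  have w\<omega>: "\<bar>d * \<omega> i\<bar> \<le> 2 * d * (1 + (\<Sum>i\<le>p. \<bar>\<omega> i\<bar>))" if "i \<le> p" for i
  proof -
    have "\<bar>\<omega> i\<bar> \<le> (\<Sum>i\<le>p. \<bar>\<omega> i\<bar>)" using that by (intro member_le_sum) auto
    then have "d * \<bar>\<omega> i\<bar> \<le> (2 * d) * (1 + (\<Sum>i\<le>p. \<bar>\<omega> i\<bar>))" using d by (intro mult_mono) auto
    then show ?thesis using d by (simp add: abs_mult)
  qed
  have euler: "?U 0 m = x + d * (\<Sum>i\<le>m. (\<tau> i - prev_tau i) * rhs t d i (?U 0 i))" if "m \<le> p" for m
    using that
  proof (induction m)
    case 0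
    have "?U 0 0 = x + (node \<tau> t (2 * d) 0 - t) * rhs t d 0 (?U 0 0)"
      unfolding iter_impl.simps euler_impl.simps
      by (rule fixpoint_euler) (use offset_bounds[of 0 d] d in \<open>auto simp: node_eq\<close>)
    moreover have "node \<tau> t (2 * d) 0 - t = d * (\<tau> 0 - prev_tau 0)" by (simp add: node_diff prev_tau_def)
    ultimately have "?U 0 0 = x + d * ((\<tau> 0 - prev_tau 0) * rhs t d 0 (?U 0 0))" by (simp only: mult.assoc)
    then show ?case by (simp only: sum_atMost_0)
  next
    case (Suc m)
    have "?U 0 (Suc m) = ?U 0 m + (node \<tau> t (2 * d) (Suc m) - node \<tau> t (2 * d) m) * rhs t d (Suc m) (?U 0 (Suc m))"
      unfolding iter_impl.simps euler_impl.simps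
    proof (rule fixpoint_euler)
      have "\<tau> m < \<tau> (Suc m)" using tau_mono[of m "Suc m"] Suc.prems by simp
      then show "0 \<le> node \<tau> t (2 * d) (Suc m) - node \<tau> t (2 * d) m" using d by (simp add: node_diff)
      show "node \<tau> t (2 * d) (Suc m) - node \<tau> t (2 * d) m \<le> 2 * d"
        using offset_bounds[of "Suc m" d] offset_bounds[of m d] d Suc.prems by (simp add: node_eq)
    qed
    moreover have "node \<tau> t (2 * d) (Suc m) - node \<tau> t (2 * d) m = d * (\<tau> (Suc m) - prev_tau (Suc m))"
      by (simp add: node_diff prev_tau_def)
    ultimately have "?U 0 (Suc m) = ?U 0 m + d * ((\<tau> (Suc m) - prev_tau (Suc m)) * rhs t d (Suc m) (?U 0 (Suc m)))"
      by (simp only: mult.assoc)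
    moreover have "?U 0 m = x + d * (\<Sum>i\<le>m. (\<tau> i - prev_tau i) * rhs t d i (?U 0 i))" using Suc by simp
    ultimately show ?case unfolding sum.atMost_Suc distrib_left by linarith
  qed
  have "is_euler p 0 (\<lambda>m i. if i \<le> m then \<tau> i - prev_tau i else 0) d (f t) (rhs t d) x (?U 0)"
    unfolding is_euler_def
  proof (intro allI impI, goal_cases)
    case (1 m)
    show ?case
      unfolding sum_atMost_restrict_le[OF 1] mult_zero_left mult_zero_right add_0_right by (rule euler[OF 1])
  qed
  moreover have "is_sweep p colloc (\<lambda>m i. if i \<le> m then \<omega> i else 0) d (rhs t d) x (?U k) (?U (Suc k))" for k
  proof -
    have sweep: "?U (Suc k) m = x + d * (\<Sum>i\<le>m. \<omega> i * (rhs t d i (?U (Suc k) i) - rhs t d i (?U k i))) +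
        (\<Sum>i\<le>m. sdg_corr f p \<tau> \<omega> t (2 * d) (?U k) i)" if "m \<le> p" for m
      using that
    proof (induction m)
      case 0
      have "?U (Suc k) 0 = x + 2 * d / 2 * \<omega> 0 * (rhs t d 0 (?U (Suc k) 0) - rhs t d 0 (?U k 0)) +
          sdg_corr f p \<tau> \<omega> t (2 * d) (?U k) 0"
        unfolding iter_impl.simps sweep_impl.simps by (rule fixpoint) (use w\<omega>[of 0] in simp)
      then show ?case by (simp only: sum_atMost_0 mult.assoc)
    next
      case (Suc m)
      have "?U (Suc k) (Suc m) = ?U (Suc k) m +
          2 * d / 2 * \<omega> (Suc m) * (rhs t d (Suc m) (?U (Suc k) (Suc m)) - rhs t d (Suc m) (?U k (Suc m))) +
          sdg_corr f p \<tau> \<omega> t (2 * d) (?U k) (Suc m)"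
        unfolding iter_impl.simps sweep_impl.simps by (rule fixpoint) (use w\<omega>[of "Suc m"] Suc.prems in simp)
      moreover have "2 * d / 2 * \<omega> (Suc m) * (rhs t d (Suc m) (?U (Suc k) (Suc m)) - rhs t d (Suc m) (?U k (Suc m))) =
          d * (\<omega> (Suc m) * (rhs t d (Suc m) (?U (Suc k) (Suc m)) - rhs t d (Suc m) (?U k (Suc m))))"
        by (simp only: mult.assoc)
      moreover have "?U (Suc k) m = x + d * (\<Sum>i\<le>m. \<omega> i * (rhs t d i (?U (Suc k) i) - rhs t d i (?U k i))) +
        (\<Sum>i\<le>m. sdg_corr f p \<tau> \<omega> t (2 * d) (?U k) i)"
        using Suc by simp
      ultimately show ?case unfolding sum.atMost_Suc distrib_left by linarith
    qed
    show ?thesis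
      unfolding is_sweep_def
    proof (intro allI impI, goal_cases)
      case (1 m)
      show ?case
        unfolding sum_atMost_restrict_le[OF 1] sum_sdg_corr[OF 1, of t d "?U k", symmetric]
        by (rule sweep[OF 1])
    qed
  qed
  ultimately show ?thesis
    unfolding is_sdg_step_def step_impl_def by blast
qed

lemma sum_prev_tau: "(\<Sum>i\<le>m. \<tau> i - prev_tau i) = \<tau> m + 1"
  by (induction m) (simp_all add: prev_tau_def)

end

theorem theorem1:
  fixes p K :: nat and T u0 :: real and f :: "real \<Rightarrow> real \<Rightarrow> real"
    and u :: "real \<Rightarrow> real" and \<tau> \<omega> :: "nat \<Rightarrow> real"
  assumes T_pos: "T > 0"
    and smooth: "Ck_R2 (2 * p + 1) f"
    and lipschitz: "\<exists>Lc. \<forall>t x y. \<bar>f t x - f t y\<bar> \<le> Lc * \<bar>x - y\<bar>"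
    and radau: "right_radau p \<tau> \<omega>"
    and u_init: "u 0 = u0"
    and u_ode: "\<forall>t\<in>{0..T}. (u has_real_derivative f t (u t)) (at t within {0..T})"
  shows "(\<exists>C h0. h0 > 0 \<and> (\<forall>N t. time_partition T N t \<and> mesh N t \<le> h0 \<longrightarrow>
            (\<forall>n\<le>N. \<bar>u (t n) - onestep_sol (step_expl f p \<tau> \<omega> K) t u0 n\<bar>
                       \<le> C * mesh N t ^ min (2 * p + 1) (K + 1)))) \<and>
         (\<exists>C h0. h0 > 0 \<and> (\<forall>N t. time_partition T N t \<and> mesh N t \<le> h0 \<longrightarrow>
            (\<forall>n\<le>N. \<bar>u (t n) - onestep_sol (step_impl f p \<tau> \<omega> K) t u0 n\<bar>
                       \<le> C * mesh N t ^ min (2 * p + 1) (K + 1))))"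
proof -
  have f: "smooth2 (2 * p + 1) f" using smooth by (rule Ck_R2_imp_smooth2)
  obtain L0 where L0: "\<And>t x y. \<bar>f t x - f t y\<bar> \<le> L0 * \<bar>x - y\<bar>" using lipschitz by blast
  define L where "L = max L0 0"
  have L: "\<bar>f t x - f t y\<bar> \<le> L * \<bar>x - y\<bar>" for t x y
    using L0[of t x y] mult_right_mono[of L0 L "\<bar>x - y\<bar>"] by (simp add: L_def)
  have L': "0 \<le> L" by (simp add: L_def)
  obtain H M0 where H: "H 0 = (\<lambda>t. f t (u t))" "deriv_chain T (2 * p + 1) H M0"
    using exists_deriv_chain_along[OF f f u_ode] by blast
  have "continuous_on {0..T} u"
    using u_ode DERIV_continuous unfolding continuous_on_eq_continuous_within by blast
  then have "compact (u ` {0..T})" by (intro compact_continuous_image) auto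
  then obtain M1 where M1: "\<forall>t\<in>{0..T}. \<bar>u t\<bar> \<le> M1"
    by (auto dest!: compact_imp_bounded simp: bounded_iff)
  define M where "M = max 0 (max M0 M1)"
  \<comment> \<open>The derivatives of f(t, u(t)) are shifted by one and \<open>u\<close> is put in
    front.\<close>
  define G where "G i = (case i of 0 \<Rightarrow> u | Suc j \<Rightarrow> H j)" for i
  have G: "G 0 = u" "G (Suc j) = H j" for j by (simp_all add: G_def)
  have "(G i has_real_derivative G (Suc i) t) (at t within {0..T})" if "i < 2 * p + 2" "t \<in> {0..T}" for i t
    using that H u_ode by (cases i) (auto simp: G deriv_chain_def)
  moreover have "\<bar>G i t\<bar> \<le> M" if "i \<le> 2 * p + 2" "t \<in> {0..T}" for i t
  proof (cases i)
    case 0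
    then show ?thesis using M1 that by (auto simp: G M_def le_max_iff_disj)
  next
    case (Suc j)
    then have "\<bar>H j t\<bar> \<le> M0" using H(2) that by (simp add: deriv_chain_def)
    then show ?thesis using Suc by (auto simp: G M_def le_max_iff_disj)
  qed
  ultimately have "deriv_chain T (2 * p + 2) G M" by (simp add: deriv_chain_def)
  then interpret radau_ivp p \<tau> \<omega> T L M f u G
    by unfold_locales (use radau L L' G H in \<open>auto simp: M_def\<close>)
  show ?thesis
    unfolding u_init[symmetric]
  proof (rule conjI)
    show "\<exists>C h0. h0 > 0 \<and> (\<forall>N t. time_partition T N t \<and> mesh N t \<le> h0 \<longrightarrow>
            (\<forall>n\<le>N. \<bar>u (t n) - onestep_sol (step_expl f p \<tau> \<omega> K) t (u 0) n\<bar>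
                       \<le> C * mesh N t ^ min (2 * p + 1) (K + 1)))"
    \<comment> \<open>The explicit relations hold for every step size, so the scheme's own limit may
      be any positive number, here 1.\<close>
    proof (rule sdg_convergence[OF f u_ode _ zero_less_one step_expl_is_sdg_step])
      fix m assume "m \<le> p"
      then have "(\<Sum>i\<le>p. (if i < m then \<tau> (Suc i) - \<tau> i else 0) * 1) = (\<Sum>i<m. (\<tau> (Suc i) - \<tau> i) * 1)"
        by (rule sum_atMost_restrict_less)
      then show "\<tau> 0 + 1 + (\<Sum>i\<le>p. if i < m then \<tau> (Suc i) - \<tau> i else 0) = \<tau> m + 1"
        by (simp add: sum_lessThan_telescope)
    qed
    define W where "W = (1 + (\<Sum>i\<le>p. \<bar>\<omega> i\<bar>)) * L"
    have W: "0 \<le> W" using L' by (auto simp: W_def intro!: mult_nonneg_nonneg add_nonneg_nonneg sum_nonneg)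
    show "\<exists>C h0. h0 > 0 \<and> (\<forall>N t. time_partition T N t \<and> mesh N t \<le> h0 \<longrightarrow>
            (\<forall>n\<le>N. \<bar>u (t n) - onestep_sol (step_impl f p \<tau> \<omega> K) t (u 0) n\<bar>
                       \<le> C * mesh N t ^ min (2 * p + 1) (K + 1)))"
    proof (rule sdg_convergence[OF f u_ode _ _ step_impl_is_sdg_step])
      fix m assume "m \<le> p"
      then have "(\<Sum>i\<le>p. (if i \<le> m then \<tau> i - prev_tau i else 0) * 1) = (\<Sum>i\<le>m. (\<tau> i - prev_tau i) * 1)"
        by (rule sum_atMost_restrict_le)
      then show "0 + (\<Sum>i\<le>p. if i \<le> m then \<tau> i - prev_tau i else 0) = \<tau> m + 1"
        using sum_prev_tau[of m] by simp
    next
      \<comment> \<open>The extra 1 in the denominator makes the contraction condition strict, since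
        d > 0.\<close>
      show "0 < 1 / (1 + W)" using W by simp
      fix d :: real assume d: "0 < d" "2 * d \<le> 1 / (1 + W)"
      then show "0 \<le> d" by simp
      have "2 * d * (1 + W) \<le> 1" using d W by (simp add: pos_le_divide_eq)
      then have "2 * d * W < 1" using d by (simp add: distrib_left)
      then show "2 * d * ((1 + (\<Sum>i\<le>p. \<bar>\<omega> i\<bar>)) * L) < 1" unfolding W_def .
    qed
  qed
qed

end
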